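(* Let $\mu$, $z$, $E$, $c$, $\tilde c$ and $({\cal E},D({\cal E}))$ be as specified in the context, and let $(H,D(H))$ be the generator of $({\cal E},D({\cal E}))$. Assume that, for each compact $\Lambda\subset X$, the function $$\gamma\mapsto\int_X\gamma(dx)\int_X z\,m(dy)\,\tilde c(x,y,\gamma)(\mathbf 1_\Lambda(x)+\mathbf 1_\Lambda(y))$$ belongs to $L^2(\Gamma,\mu)$. Then $${\cal E}(F,G)=\int_\Gamma(HF)(\gamma)G(\gamma)\,\mu(d\gamma),\qquad F,G\in{\cal F}C_{\mathrm b}(C_0(X),\Gamma),$$ where $$(HF)(\gamma)=-2\int_X\gamma(dx)\int_X z\,m(dy)\,\tilde c(x,y,\gamma)(D^{-+}_{xy}F)(\gamma)\qquad\mu\text{-a.e.},$$ and $HF\in L^2(\Gamma,\mu)$. The Friedrichs extension of the operator $(H,{\cal F}C_{\mathrm b}(C_0(X),\Gamma))$ in $L^2(\Gamma,\mu)$ is $(H,D(H))$.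
   Context: Setting. $X$ is a connected oriented $C^\infty$ Riemannian manifold with Borel $\sigma$-algebra ${\cal B}(X)$ and volume measure $m$. $C_0(X)$ is the space of continuous real-valued functions on $X$ with compact support. The configuration space is $\Gamma=\{\gamma\subset X:\ |\gamma\cap\Lambda|<\infty\text{ for each compact }\Lambda\subset X\}$. Each $\gamma\in\Gamma$ is identified with the Radon measure $\sum_{x\in\gamma}\varepsilon_x$ ($\varepsilon_x$ the Dirac measure at $x$), and $\langle f,\gamma\rangle=\int_X f\,d\gamma=\sum_{x\in\gamma}f(x)$. $\Gamma$ carries the vague topology (the weakest making all $\gamma\mapsto\langle f,\gamma\rangle$, $f\in C_0(X)$, continuous), with Borel $\sigma$-algebra ${\cal B}(\Gamma)$. One writes $\gamma\setminus x\cup y$ for $(\gamma\setminus\{x\})\cup\{y\}$, etc. Gibbs measure. $E:X\times\Gamma\to(-\infty,+\infty]$ is measurable, $z>0$, and $\mu$ is a probability measure on $(\Gamma,{\cal B}(\Gamma))$ such that: (i) for every measurable $F:X\times\Gamma\to[0,+\infty]$, $\int_\Gamma\mu(d\gamma)\int_X\gamma(dx)F(x,\gamma)=\int_\Gamma\mu(d\gamma)\int_X z\,m(dx)\exp[-E(x,\gamma)]F(x,\gamma\cup x)$; (ii) $E(x,\gamma)\in\mathbb R$ for $m\otimes\mu$-a.e. $(x,\gamma)\in X\times\Gamma$; (iii) for every $n\in\mathbb N$ there is a non-negative measurable symmetric function $k_\mu^{(n)}$ on $X^n$ such that for every measurable symmetric $f^{(n)}:X^n\to[0,\infty]$, $\int_\Gamma\sum_{\{x_1,\dots,x_n\}\subset\gamma}f^{(n)}(x_1,\dots,x_n)\,\mu(d\gamma)=\frac1{n!}\int_{X^n}f^{(n)}k_\mu^{(n)}\,dm^{\otimes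 n}$, and $k_\mu^{(n)}\le\xi^n$ everywhere on $X^n$ for some constant $\xi>0$ independent of $n$. The form. $c:X\times X\times\Gamma\to[0,\infty)$ is measurable and for each compact $\Lambda\subset X$ $$\int_\Gamma\mu(d\gamma)\int_X\gamma(dx)\int_X m(dy)\,c(x,y,\gamma)(\mathbf 1_\Lambda(x)+\mathbf 1_\Lambda(y))<\infty.$$ ${\cal F}C_{\mathrm b}(C_0(X),\Gamma)$ denotes the set of functions $F(\gamma)=g_F(\langle\varphi_1,\gamma\rangle,\dots,\langle\varphi_N,\gamma\rangle)$ with $N\in\mathbb N$, $\varphi_i\in C_0(X)$, $g_F$ a continuous bounded function on $\mathbb R^N$. With $(D^{-+}_{xy}F)(\gamma)=F(\gamma\setminus x\cup y)-F(\gamma)$, set for $F,G\in{\cal F}C_{\mathrm b}(C_0(X),\Gamma)$ $${\cal E}(F,G)=\int_\Gamma\mu(d\gamma)\int_X\gamma(dx)\int_X z\,m(dy)\,c(x,y,\gamma)(D^{-+}_{xy}F)(\gamma)(D^{-+}_{xy}G)(\gamma).$$ This is a well-defined closable bilinear form on $L^2(\Gamma,\mu)$, and $({\cal E},D({\cal E}))$ denotes its closure. Its generator $(H,D(H))$ is the non-negative self-adjoint operator in $L^2(\Gamma,\mu)$ with ${\cal E}(F,G)=(HF,G)_{L^2(\mu)}$ for $F\in D(H)$, $G\in D({\cal E})$. Symmetrized coefficient. $$\tilde c(x,y,\gamma)=\tfrac12\big(c(x,y,\gamma)+c(y,x,\gamma\setminus x\cup y)\exp[-E(y,\gamma)+E(x,\gamma\setminus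 x\cup y)]\big),$$ considered for a.e. $(x,y,\gamma)$ with respect to $\gamma(dx)\,z\,m(dy)\,\mu(d\gamma)$. *)

theory Defs
  imports "HOL-Probability.Probability"
begin

section \<open>Connected oriented Riemannian manifolds and their volume measure\<close>

text \<open>
  Continuous differentiability is only meant for open \<open>S\<close>; it is expressed by iterated
  partial derivatives.
\<close>

primrec Ck_on :: "nat \<Rightarrow> (real^'n) set \<Rightarrow> (real^'n \<Rightarrow> 'b::real_normed_vector) \<Rightarrow> bool" where
  "Ck_on 0 S f \<longleftrightarrow> continuous_on S f"
| "Ck_on (Suc k) S f \<longleftrightarrow> f differentiable_on S \<and>
     (\<forall>i. Ck_on k S (\<lambda>u. frechet_derivative f (at u) (axis i 1)))"

definition smooth_on :: "(real^'n) set \<Rightarrow> (real^'n \<Rightarrow> 'b::real_normed_vector) \<Rightarrow> bool" where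
  "smooth_on S f \<longleftrightarrow> (\<forall>k. Ck_on k S f)"

text \<open>A chart is a pair of its domain and its coordinate map; the manifold is the whole type \<open>'a\<close>.\<close>

type_synonym ('a, 'n) chart = "'a set \<times> ('a \<Rightarrow> real^'n)"

definition chart_inv :: "('a, 'n::finite) chart \<Rightarrow> real^'n \<Rightarrow> 'a" where
  "chart_inv \<kappa> = inv_into (fst \<kappa>) (snd \<kappa>)"

definition transition :: "('a, 'n::finite) chart \<Rightarrow> ('a, 'n) chart \<Rightarrow> real^'n \<Rightarrow> real^'n" where
  "transition \<kappa> \<kappa>' = snd \<kappa>' \<circ> chart_inv \<kappa>"

definition transition_jacobian :: "('a, 'n::finite) chart \<Rightarrow> ('a, 'n) chart \<Rightarrow> 'a \<Rightarrow> real^'n^'n" where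
  "transition_jacobian \<kappa> \<kappa>' p = matrix (frechet_derivative (transition \<kappa> \<kappa>') (at (snd \<kappa> p)))"

definition smooth_atlas :: "('a::topological_space, 'n::finite) chart set \<Rightarrow> bool" where
  "smooth_atlas \<A> \<longleftrightarrow>
     (\<Union>\<kappa>\<in>\<A>. fst \<kappa>) = UNIV \<and>
     (\<forall>\<kappa>\<in>\<A>. open (fst \<kappa>) \<and> open (snd \<kappa> ` fst \<kappa>) \<and>
        homeomorphism (fst \<kappa>) (snd \<kappa> ` fst \<kappa>) (snd \<kappa>) (chart_inv \<kappa>)) \<and>
     (\<forall>\<kappa>\<in>\<A>. \<forall>\<kappa>'\<in>\<A>. smooth_on (snd \<kappa> ` (fst \<kappa> \<inter> fst \<kappa>')) (transition \<kappa> \<kappa>'))"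

text \<open>An orientation is given by an atlas all of whose coordinate changes preserve orientation.\<close>

definition oriented_atlas :: "('a::topological_space, 'n::finite) chart set \<Rightarrow> bool" where
  "oriented_atlas \<A> \<longleftrightarrow> smooth_atlas \<A> \<and>
     (\<forall>\<kappa>\<in>\<A>. \<forall>\<kappa>'\<in>\<A>. \<forall>p\<in>fst \<kappa> \<inter> fst \<kappa>'. det (transition_jacobian \<kappa> \<kappa>' p) > 0)"

text \<open>\<open>g \<kappa> p\<close> is the Gram matrix of the metric at \<open>p\<close> in the coordinates \<open>\<kappa>\<close>.\<close>

definition riemannian_metric ::
  "('a::topological_space, 'n::finite) chart set \<Rightarrow> (('a, 'n) chart \<Rightarrow> 'a \<Rightarrow> real^'n^'n) \<Rightarrow> bool" where
  "riemannian_metric \<A> g \<longleftrightarrow>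
     (\<forall>\<kappa>\<in>\<A>. smooth_on (snd \<kappa> ` fst \<kappa>) (g \<kappa> \<circ> chart_inv \<kappa>)) \<and>
     (\<forall>\<kappa>\<in>\<A>. \<forall>p\<in>fst \<kappa>. transpose (g \<kappa> p) = g \<kappa> p \<and> (\<forall>v. v \<noteq> 0 \<longrightarrow> v \<bullet> (g \<kappa> p *v v) > 0)) \<and>
     (\<forall>\<kappa>\<in>\<A>. \<forall>\<kappa>'\<in>\<A>. \<forall>p\<in>fst \<kappa> \<inter> fst \<kappa>'.
        g \<kappa> p = transpose (transition_jacobian \<kappa> \<kappa>' p) ** g \<kappa>' p ** transition_jacobian \<kappa> \<kappa>' p)"

definition riemannian_volume ::
  "('a::topological_space, 'n::finite) chart set \<Rightarrow> (('a, 'n) chart \<Rightarrow> 'a \<Rightarrow> real^'n^'n)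
     \<Rightarrow> 'a measure \<Rightarrow> bool" where
  "riemannian_volume \<A> g m \<longleftrightarrow> sets m = sets borel \<and>
     (\<forall>\<kappa>\<in>\<A>. \<forall>B\<in>sets borel. B \<subseteq> fst \<kappa> \<longrightarrow>
        emeasure m B = (\<integral>\<^sup>+u. ennreal (sqrt (det (g \<kappa> (chart_inv \<kappa> u)))) * indicator (snd \<kappa> ` B) u \<partial>lborel))"


section \<open>Configuration space\<close>

definition C0 :: "('a::topological_space \<Rightarrow> real) set" where
  "C0 = {f. continuous_on UNIV f \<and> compact (closure {x. f x \<noteq> 0})}"

definition configs :: "'a::topological_space set set" where
  "configs = {\<gamma>. \<forall>\<Lambda>. compact \<Lambda> \<longrightarrow> finite (\<gamma> \<inter> \<Lambda>)}"

text \<open>The Radon measure \<open>\<Sum>x\<in>\<gamma>. \<epsilon>\<^sub>x\<close> identified with \<open>\<gamma>\<close>.\<close>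

definition config_measure :: "'a::topological_space set \<Rightarrow> 'a measure" where
  "config_measure \<gamma> = distr (count_space \<gamma>) borel (\<lambda>x. x)"

definition pairing :: "('a::topological_space \<Rightarrow> real) \<Rightarrow> 'a set \<Rightarrow> real" where
  "pairing f \<gamma> = (LINT x|config_measure \<gamma>. f x)"

definition vague_topology :: "'a::topological_space set topology" where
  "vague_topology = topology_generated_by {{\<gamma>\<in>configs. pairing f \<gamma> \<in> U} | f U. f \<in> C0 \<and> open U}"

definition config_borel :: "'a::topological_space set measure" where
  "config_borel = sigma configs {U. openin vague_topology U}"


section \<open>Gibbs measures and correlation functions\<close>

text \<open>\<open>exp (-e)\<close> for \<open>e \<in> (-\<infinity>, \<infinity>]\<close>.\<close>

definition exp_neg :: "ereal \<Rightarrow> ennreal" where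
  "exp_neg e = (if e = \<infinity> then 0 else ennreal (exp (- real_of_ereal e)))"

definition gibbs_identity ::
  "'a::topological_space measure \<Rightarrow> real \<Rightarrow> ('a \<Rightarrow> 'a set \<Rightarrow> ereal) \<Rightarrow> 'a set measure \<Rightarrow> bool" where
  "gibbs_identity m z E \<mu> \<longleftrightarrow>
     (\<forall>F \<in> borel_measurable (borel \<Otimes>\<^sub>M config_borel) :: ('a \<times> 'a set \<Rightarrow> ennreal) set.
        (\<integral>\<^sup>+\<gamma>. (\<integral>\<^sup>+x. F (x, \<gamma>) \<partial>config_measure \<gamma>) \<partial>\<mu>) =
        (\<integral>\<^sup>+\<gamma>. (\<integral>\<^sup>+x. ennreal z * exp_neg (E x \<gamma>) * F (x, insert x \<gamma>) \<partial>m) \<partial>\<mu>))"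

text \<open>
  Functions on \<open>X\<^sup>n\<close> are functions of extensional maps \<open>{..<n} \<rightarrow>\<^sub>E X\<close>; a symmetric one is
  evaluated at an \<open>n\<close>-point set by choosing an arbitrary enumeration.
\<close>

definition symmetric_fun :: "nat \<Rightarrow> ((nat \<Rightarrow> 'a) \<Rightarrow> 'b) \<Rightarrow> bool" where
  "symmetric_fun n f \<longleftrightarrow> (\<forall>x \<in> {..<n} \<rightarrow>\<^sub>E UNIV. \<forall>p. p permutes {..<n} \<longrightarrow> f (x \<circ> p) = f x)"

definition enum_points :: "nat \<Rightarrow> 'a set \<Rightarrow> nat \<Rightarrow> 'a" where
  "enum_points n \<eta> = (SOME x. x \<in> extensional {..<n} \<and> bij_betw x {..<n} \<eta>)"

definition correlation_function ::
  "'a::topological_space measure \<Rightarrow> 'a set measure \<Rightarrow> nat \<Rightarrow> ((nat \<Rightarrow> 'a) \<Rightarrow> real) \<Rightarrow> bool" where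
  "correlation_function m \<mu> n k \<longleftrightarrow>
     k \<in> borel_measurable (\<Pi>\<^sub>M i\<in>{..<n}. borel) \<and> symmetric_fun n k \<and>
     (\<forall>x \<in> {..<n} \<rightarrow>\<^sub>E UNIV. 0 \<le> k x) \<and>
     (\<forall>f \<in> borel_measurable (\<Pi>\<^sub>M i\<in>{..<n}. borel) :: ((nat \<Rightarrow> 'a) \<Rightarrow> ennreal) set.
        symmetric_fun n f \<longrightarrow>
        (\<integral>\<^sup>+\<gamma>. (\<integral>\<^sup>+\<eta>. f (enum_points n \<eta>)
            \<partial>count_space {\<eta>. \<eta> \<subseteq> \<gamma> \<and> finite \<eta> \<and> card \<eta> = n}) \<partial>\<mu>) =
        ennreal (1 / fact n) * (\<integral>\<^sup>+x. f x * ennreal (k x) \<partial>(\<Pi>\<^sub>M i\<in>{..<n}. m)))"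

definition ruelle_bounded_correlations ::
  "'a::topological_space measure \<Rightarrow> 'a set measure \<Rightarrow> bool" where
  "ruelle_bounded_correlations m \<mu> \<longleftrightarrow>
     (\<exists>\<xi>>0. \<forall>n\<ge>1. \<exists>k. correlation_function m \<mu> n k \<and> (\<forall>x \<in> {..<n} \<rightarrow>\<^sub>E UNIV. k x \<le> \<xi> ^ n))"


section \<open>The Kawasaki form\<close>

definition FCb :: "('a::topological_space set \<Rightarrow> real) set" where
  "FCb = {F. \<exists>N \<phi> g. (\<forall>i<N. \<phi> i \<in> C0) \<and>
     continuous_map (Euclidean_space N) euclideanreal g \<and> bounded (g ` topspace (Euclidean_space N)) \<and>
     (\<forall>\<gamma>\<in>configs. F \<gamma> = g (\<lambda>i. if i < N then pairing (\<phi> i) \<gamma> else 0))}"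

definition move :: "'a \<Rightarrow> 'a \<Rightarrow> 'a set \<Rightarrow> 'a set" where
  "move x y \<gamma> = insert y (\<gamma> - {x})"

definition Dmp :: "'a \<Rightarrow> 'a \<Rightarrow> ('a set \<Rightarrow> real) \<Rightarrow> 'a set \<Rightarrow> real" where
  "Dmp x y F \<gamma> = F (move x y \<gamma>) - F \<gamma>"

definition kawasaki_form ::
  "'a::topological_space measure \<Rightarrow> real \<Rightarrow> 'a set measure \<Rightarrow> ('a \<Rightarrow> 'a \<Rightarrow> 'a set \<Rightarrow> real)
     \<Rightarrow> ('a set \<Rightarrow> real) \<Rightarrow> ('a set \<Rightarrow> real) \<Rightarrow> real" where
  "kawasaki_form m z \<mu> c F G =
     (LINT \<gamma>|\<mu>. (LINT x|config_measure \<gamma>. (LINT y|m. z * c x y \<gamma> * Dmp x y F \<gamma> * Dmp x y G \<gamma>)))"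

definition integrable_coefficient ::
  "'a::topological_space measure \<Rightarrow> 'a set measure \<Rightarrow> ('a \<Rightarrow> 'a \<Rightarrow> 'a set \<Rightarrow> real) \<Rightarrow> bool" where
  "integrable_coefficient m \<mu> c \<longleftrightarrow>
     (\<forall>\<Lambda>. compact \<Lambda> \<longrightarrow>
        (\<integral>\<^sup>+\<gamma>. (\<integral>\<^sup>+x. (\<integral>\<^sup>+y. ennreal (c x y \<gamma>) * (indicator \<Lambda> x + indicator \<Lambda> y) \<partial>m)
           \<partial>config_measure \<gamma>) \<partial>\<mu>) < \<infinity>)"

text \<open>
  Both energies below are finite for almost every \<open>(x, y, \<gamma>)\<close> with respect to
  \<open>\<gamma>(dx) z m(dy) \<mu>(d\<gamma>)\<close>; on the exceptional null set \<open>real_of_ereal\<close> makes an arbitrary choice.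
\<close>

definition csym ::
  "('a \<Rightarrow> 'a set \<Rightarrow> ereal) \<Rightarrow> ('a \<Rightarrow> 'a \<Rightarrow> 'a set \<Rightarrow> real) \<Rightarrow> 'a \<Rightarrow> 'a \<Rightarrow> 'a set \<Rightarrow> real" where
  "csym E c x y \<gamma> = 1 / 2 * (c x y \<gamma> +
     c y x (move x y \<gamma>) * exp (- real_of_ereal (E y \<gamma>) + real_of_ereal (E x (move x y \<gamma>))))"

definition csym_weight ::
  "'a::topological_space measure \<Rightarrow> real \<Rightarrow> ('a \<Rightarrow> 'a set \<Rightarrow> ereal) \<Rightarrow> ('a \<Rightarrow> 'a \<Rightarrow> 'a set \<Rightarrow> real)
     \<Rightarrow> 'a set \<Rightarrow> 'a set \<Rightarrow> ennreal" where
  "csym_weight m z E c \<Lambda> \<gamma> =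
     (\<integral>\<^sup>+x. (\<integral>\<^sup>+y. ennreal (z * csym E c x y \<gamma>) * (indicator \<Lambda> x + indicator \<Lambda> y) \<partial>m)
        \<partial>config_measure \<gamma>)"


section \<open>Forms and operators in a real \<open>L\<^sup>2\<close> space\<close>

text \<open>
  Elements of \<open>L\<^sup>2\<close> are represented by functions, and equality in \<open>L\<^sup>2\<close> by equality almost
  everywhere. An operator is a pair of a domain \<open>D\<close> and a map \<open>A\<close>, of which only the values on
  \<open>D\<close> matter.
\<close>

definition L2 :: "'b measure \<Rightarrow> ('b \<Rightarrow> real) set" where
  "L2 M = {f \<in> borel_measurable M. integrable M (\<lambda>w. (f w)\<^sup>2)}"

definition L2_inner :: "'b measure \<Rightarrow> ('b \<Rightarrow> real) \<Rightarrow> ('b \<Rightarrow> real) \<Rightarrow> real" where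
  "L2_inner M f g = (LINT w|M. f w * g w)"

definition L2_dist :: "'b measure \<Rightarrow> ('b \<Rightarrow> real) \<Rightarrow> ('b \<Rightarrow> real) \<Rightarrow> real" where
  "L2_dist M f g = sqrt (LINT w|M. (f w - g w)\<^sup>2)"

definition L2_dense :: "'b measure \<Rightarrow> ('b \<Rightarrow> real) set \<Rightarrow> bool" where
  "L2_dense M D \<longleftrightarrow> (\<forall>f\<in>L2 M. \<forall>e>0. \<exists>g\<in>D. L2_dist M f g < e)"

definition L2_operator :: "'b measure \<Rightarrow> ('b \<Rightarrow> real) set \<Rightarrow> (('b \<Rightarrow> real) \<Rightarrow> 'b \<Rightarrow> real) \<Rightarrow> bool" where
  "L2_operator M D A \<longleftrightarrow> D \<subseteq> L2 M \<and> A ` D \<subseteq> L2 M \<and>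
     (\<forall>f\<in>D. \<forall>g\<in>D. (AE w in M. f w = g w) \<longrightarrow> (AE w in M. A f w = A g w)) \<and>
     (\<forall>f\<in>D. \<forall>g\<in>D. \<forall>a b. (\<lambda>w. a * f w + b * g w) \<in> D \<and>
        (AE w in M. A (\<lambda>w. a * f w + b * g w) w = a * A f w + b * A g w))"

definition nonneg_operator :: "'b measure \<Rightarrow> ('b \<Rightarrow> real) set \<Rightarrow> (('b \<Rightarrow> real) \<Rightarrow> 'b \<Rightarrow> real) \<Rightarrow> bool" where
  "nonneg_operator M D A \<longleftrightarrow> (\<forall>f\<in>D. 0 \<le> L2_inner M (A f) f)"

definition symmetric_operator :: "'b measure \<Rightarrow> ('b \<Rightarrow> real) set \<Rightarrow> (('b \<Rightarrow> real) \<Rightarrow> 'b \<Rightarrow> real) \<Rightarrow> bool" where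
  "symmetric_operator M D A \<longleftrightarrow> L2_operator M D A \<and> L2_dense M D \<and>
     (\<forall>f\<in>D. \<forall>g\<in>D. L2_inner M (A f) g = L2_inner M f (A g))"

text \<open>The last conjunct says that the graph of the adjoint equals the graph of \<open>A\<close>.\<close>

definition self_adjoint_operator :: "'b measure \<Rightarrow> ('b \<Rightarrow> real) set \<Rightarrow> (('b \<Rightarrow> real) \<Rightarrow> 'b \<Rightarrow> real) \<Rightarrow> bool" where
  "self_adjoint_operator M D A \<longleftrightarrow> L2_operator M D A \<and> L2_dense M D \<and>
     (\<forall>g\<in>L2 M. \<forall>h\<in>L2 M. (\<forall>f\<in>D. L2_inner M (A f) g = L2_inner M f h) \<longleftrightarrow>
        g \<in> D \<and> (AE w in M. A g w = h w))"

text \<open>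
  The closure of a closable form \<open>q\<close> with domain \<open>D\<close>: its domain consists of the \<open>L\<^sup>2\<close>-limits of
  \<open>q\<close>-Cauchy sequences in \<open>D\<close>, and its values are the limits along such sequences, which do not
  depend on the choice of the sequences by closability.
\<close>

definition form_approx ::
  "'b measure \<Rightarrow> ('b \<Rightarrow> real) set \<Rightarrow> (('b \<Rightarrow> real) \<Rightarrow> ('b \<Rightarrow> real) \<Rightarrow> real)
     \<Rightarrow> (nat \<Rightarrow> 'b \<Rightarrow> real) \<Rightarrow> ('b \<Rightarrow> real) \<Rightarrow> bool" where
  "form_approx M D q s f \<longleftrightarrow> (\<forall>n. s n \<in> D) \<and> f \<in> L2 M \<and>
     (\<lambda>n. L2_dist M (s n) f) \<longlonglongrightarrow> 0 \<and>
     (\<forall>e>0. \<exists>N. \<forall>i\<ge>N. \<forall>j\<ge>N. q (\<lambda>w. s i w - s j w) (\<lambda>w. s i w - s j w) < e)"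

definition closure_domain ::
  "'b measure \<Rightarrow> ('b \<Rightarrow> real) set \<Rightarrow> (('b \<Rightarrow> real) \<Rightarrow> ('b \<Rightarrow> real) \<Rightarrow> real) \<Rightarrow> ('b \<Rightarrow> real) set" where
  "closure_domain M D q = {f. \<exists>s. form_approx M D q s f}"

definition closure_form ::
  "'b measure \<Rightarrow> ('b \<Rightarrow> real) set \<Rightarrow> (('b \<Rightarrow> real) \<Rightarrow> ('b \<Rightarrow> real) \<Rightarrow> real)
     \<Rightarrow> ('b \<Rightarrow> real) \<Rightarrow> ('b \<Rightarrow> real) \<Rightarrow> real" where
  "closure_form M D q f g = (THE l. \<forall>s t. form_approx M D q s f \<longrightarrow> form_approx M D q t g \<longrightarrow>
     (\<lambda>n. q (s n) (t n)) \<longlonglongrightarrow> l)"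

text \<open>\<open>(A, D)\<close> is the generator of the closed form \<open>q\<close> with domain \<open>Q\<close>.\<close>

definition generator_of_form ::
  "'b measure \<Rightarrow> ('b \<Rightarrow> real) set \<Rightarrow> (('b \<Rightarrow> real) \<Rightarrow> ('b \<Rightarrow> real) \<Rightarrow> real)
     \<Rightarrow> ('b \<Rightarrow> real) set \<Rightarrow> (('b \<Rightarrow> real) \<Rightarrow> 'b \<Rightarrow> real) \<Rightarrow> bool" where
  "generator_of_form M Q q D A \<longleftrightarrow> self_adjoint_operator M D A \<and> nonneg_operator M D A \<and> D \<subseteq> Q \<and>
     (\<forall>f\<in>D. \<forall>g\<in>Q. q f g = L2_inner M (A f) g)"

text \<open>
  The Friedrichs extension \<open>(A', D')\<close> of a non-negative, densely defined symmetric operator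
  \<open>(A, D)\<close> is the generator of the closure of the form \<open>(f, g) \<mapsto> (A f, g)\<close> on \<open>D\<close>.
\<close>

definition friedrichs_extension ::
  "'b measure \<Rightarrow> ('b \<Rightarrow> real) set \<Rightarrow> (('b \<Rightarrow> real) \<Rightarrow> 'b \<Rightarrow> real)
     \<Rightarrow> ('b \<Rightarrow> real) set \<Rightarrow> (('b \<Rightarrow> real) \<Rightarrow> 'b \<Rightarrow> real) \<Rightarrow> bool" where
  "friedrichs_extension M D A D' A' \<longleftrightarrow> symmetric_operator M D A \<and> nonneg_operator M D A \<and>
     (let q = (\<lambda>f g. L2_inner M (A f) g) in
        generator_of_form M (closure_domain M D q) (closure_form M D q) D' A')"

end

theory Submission
  imports Defs
begin

text \<open>
  Write \<open>M\<close> for the measure \<open>\<gamma>(dx) m(dy) \<mu>(d\<gamma>)\<close> on triples and \<open>\<tau>(x, y, \<gamma>) = (y, x, \<gamma> \<setminus> x \<union> y)\<close>.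
  Applying the Gibbs identity to both points of a pair, in either order, shows that \<open>E\<close> satisfies
  \<open>E(x, \<gamma>) + E(y, \<gamma> \<union> x) = E(y, \<gamma>) + E(x, \<gamma> \<union> y)\<close> almost everywhere, hence \<open>\<tau>\<close> maps \<open>M\<close> to a measure
  with density \<open>exp (-E(y, \<gamma>) + E(x, \<gamma> \<setminus> x \<union> y))\<close>, and \<open>c~ M\<close> is the \<open>\<tau>\<close>-symmetrization of \<open>c M\<close>.
  As \<open>D F D G\<close> is \<open>\<tau>\<close>-invariant and \<open>D F\<close> is \<open>\<tau>\<close>-odd, the form equals \<open>-2 \<integral> c~ (D F) G dM\<close>, that is,
  \<open>(A F, G)\<close> for the announced \<open>A F\<close>, which is in \<open>L\<^sup>2\<close> by the assumption on \<open>c~\<close>. A form given by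
  an operator on its core is closable, and self-adjointness of the generator \<open>H\<close> of its closure
  forces \<open>H\<close> to extend \<open>A\<close>. Density of the cylinder functions is inherited from the domain of \<open>H\<close>.
\<close>

text \<open>The first obstacle is measurability. The Gibbs identity takes jointly measurable test
  functions, while \<open>config_borel\<close> comes from a topology with uncountably many
  generators. The events that a configuration meets a basic open set replace the pairings with test
  functions: they generate the same \<sigma>-algebra, and adding, deleting and counting points and
  integrating against a configuration become measurable through countable combinations of them. The
  second obstacle is sign. The balance identities concern nonnegative integrals, whereas D F and G
  take both signs and a Bochner integral that fails to exist is 0. Signed integrands are split into
  positive and negative parts once absolute integrability is known; it follows from the weight
  1_\<Lambda>(x) + 1_\<Lambda>(y), where \<Lambda> is a compact set such that moves outside it leave
  F unchanged. Energies can be subtracted only where they are finite, so finiteness of E(x,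
  \<gamma>) is carried over to E(y, \<gamma> \<union> x) through the Gibbs identity. For the closed
  form it suffices to evaluate it with one argument in the core, since this is what membership in
  the graph of the adjoint tests.\<close>

lemma finite_separation:
  fixes P :: "'a::t2_space set"
  assumes "finite P"
  obtains N where "\<And>x. x \<in> P \<Longrightarrow> open (N x) \<and> x \<in> N x" "disjoint_family_on N P"
proof -
  have "\<forall>p :: 'a \<times> 'a. \<exists>W :: 'a set \<times> 'a set. fst p \<noteq> snd p \<longrightarrow>
    open (fst W) \<and> open (snd W) \<and> fst p \<in> fst W \<and> snd p \<in> snd W \<and> fst W \<inter> snd W = {}"
  proof
    fix p :: "'a \<times> 'a"
    show "\<exists>W. fst p \<noteq> snd p \<longrightarrow> open (fst W) \<and> open (snd W) \<and> fst p \<in> fst W \<and> snd p \<in> snd W \<and> fst W \<inter> snd W = {}"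
      using hausdorff[of "fst p" "snd p"] by (metis fst_conv snd_conv)
  qed
  then obtain W :: "'a \<times> 'a \<Rightarrow> 'a set \<times> 'a set" where W: "\<And>p. fst p \<noteq> snd p \<Longrightarrow>
    open (fst (W p)) \<and> open (snd (W p)) \<and> fst p \<in> fst (W p) \<and> snd p \<in> snd (W p) \<and> fst (W p) \<inter> snd (W p) = {}"
    by metis
  \<comment> \<open>\<open>W\<close> is chosen for ordered pairs, with no relation between
    \<open>W (x, y)\<close> and \<open>W (y, x)\<close>. One factor is taken from each, so that
    \<open>N x\<close> and \<open>N y\<close> lie in opposite halves of
    \<open>W (x, y)\<close>.\<close>
  define N where "N x = (\<Inter>y\<in>P - {x}. fst (W (x, y)) \<inter> snd (W (y, x)))" for x
  show thesis
  proof
    fix x assume "x \<in> P"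
    show "open (N x) \<and> x \<in> N x"
    proof
      show "open (N x)" unfolding N_def
      proof (intro open_INT ballI open_Int)
        fix y assume y: "y \<in> P - {x}"
        show "open (fst (W (x, y)))" using W[of "(x, y)"] y by auto
        show "open (snd (W (y, x)))" using W[of "(y, x)"] y by auto
      qed (use assms in simp)
      show "x \<in> N x" unfolding N_def
      proof (intro INT_I IntI)
        fix y assume y: "y \<in> P - {x}"
        show "x \<in> fst (W (x, y))" using W[of "(x, y)"] y by auto
        show "x \<in> snd (W (y, x))" using W[of "(y, x)"] y by auto
      qed
    qed
  next
    show "disjoint_family_on N P"
      unfolding disjoint_family_on_def N_def using W by fastforce
  qed
qed

section \<open>The configuration space as a measurable space\<close>

text \<open>The topological input that the manifold will supply. Bump functions provide compact
  neighbourhoods, and they let vaguely open sets detect whether a configuration has a point in a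
  given open set.\<close>

locale bump_space =
  fixes m :: "'a::{t2_space, second_countable_topology} measure"
  assumes bump: "\<And>(p::'a) V. open V \<Longrightarrow> p \<in> V \<Longrightarrow>
      \<exists>f\<in>C0. (\<forall>x. 0 \<le> f x) \<and> 0 < f p \<and> (\<forall>x. x \<notin> V \<longrightarrow> f x = 0)"
begin

lemma compact_nbhd:
  obtains U K where "open U" "(p::'a) \<in> U" "compact K" "U \<subseteq> K"
proof -
  obtain f :: "'a \<Rightarrow> real" where f: "f \<in> C0" "0 < f p" using bump[of UNIV p] by auto
  have "open {x. 0 < f x}"
    using f by (intro open_Collect_less) (auto simp: C0_def)
  moreover have "{x. 0 < f x} \<subseteq> closure {x. f x \<noteq> 0}"
    using closure_subset by force
  ultimately show thesis using f that[of "{x. 0 < f x}" "closure {x. f x \<noteq> 0}"] by (auto simp: C0_def)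
qed

text \<open>By Lindelof, countably many open sets with compact hull cover the space; finite unions
  make the sequence increasing. It reduces statements about infinite configurations to finite
  windows.\<close>

lemma exhaustion:
  obtains U :: "nat \<Rightarrow> 'a set" where "\<And>n. open (U n)" "\<And>n. \<exists>K. compact K \<and> U n \<subseteq> K"
    "incseq U" "(\<Union>n. U n) = UNIV"
proof -
  define \<U> where "\<U> = {U::'a set. open U \<and> (\<exists>K. compact K \<and> U \<subseteq> K)}"
  obtain \<V> where \<V>: "\<V> \<subseteq> \<U>" "countable \<V>" "\<Union>\<V> = \<Union>\<U>"
    using Lindelof[of \<U>] unfolding \<U>_def by blast
  have cov: "\<Union>\<U> = UNIV"
  proof -
    have "p \<in> \<Union>\<U>" for p :: 'a
      using compact_nbhd[of p] unfolding \<U>_def by (metis (mono_tags, lifting) UnionI mem_Collect_eq)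
    then show ?thesis by auto
  qed
  have ne: "\<V> \<noteq> {}" using \<V> cov by auto
  define V where "V = from_nat_into \<V>"
  have rV: "range V = \<V>" unfolding V_def using ne \<V> by (simp add: range_from_nat_into)
  define U where "U n = (\<Union>i\<le>n. V i)" for n
  have V\<U>: "V i \<in> \<U>" for i using rV \<V> by auto
  show thesis
  proof
    show "open (U n)" for n unfolding U_def using V\<U> by (auto simp: \<U>_def)
    show "\<exists>K. compact K \<and> U n \<subseteq> K" for n
    proof -
      have "\<forall>i. \<exists>K. compact K \<and> V i \<subseteq> K" using V\<U> by (auto simp: \<U>_def)
      then obtain K where "\<And>i. compact (K i) \<and> V i \<subseteq> K i" by metis
      then show ?thesis unfolding U_def by (intro exI[of _ "\<Union>i\<le>n. K i"]) auto
    qed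
    show "incseq U" unfolding U_def by (fastforce simp: incseq_def)
    have "(\<Union>n. U n) = \<Union>\<V>" unfolding U_def rV[symmetric] by auto
    then show "(\<Union>n. U n) = UNIV" using \<V> cov by simp
  qed
qed

section \<open>Elementary properties of configurations and pairings\<close>

lemma configs_insert: "\<gamma> \<in> configs \<Longrightarrow> insert x \<gamma> \<in> configs"
  by (auto simp: configs_def Int_insert_left)

lemma configs_subset: "\<gamma> \<in> configs \<Longrightarrow> \<eta> \<subseteq> \<gamma> \<Longrightarrow> \<eta> \<in> configs"
  unfolding configs_def by (blast intro: finite_subset[of "_ \<inter> _" "\<gamma> \<inter> _"])

lemma configs_countable:
  assumes "\<gamma> \<in> configs" shows "countable (\<gamma> :: 'a set)"
proof -
  obtain U :: "nat \<Rightarrow> 'a set" where U: "\<And>n. \<exists>K. compact K \<and> U n \<subseteq> K" "(\<Union>n. U n) = UNIV"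
    using exhaustion by metis
  have "finite (\<gamma> \<inter> U n)" for n
    using U(1)[of n] assms unfolding configs_def by (blast intro: finite_subset[of "\<gamma> \<inter> U n" "\<gamma> \<inter> _"])
  then have "countable (\<Union>n. \<gamma> \<inter> U n)" by (intro countable_UN) (auto intro: countable_finite)
  also have "(\<Union>n. \<gamma> \<inter> U n) = \<gamma>" using U(2) by blast
  finally show ?thesis .
qed

lemma configs_closed:
  assumes "\<gamma> \<in> configs" shows "closed (\<gamma> :: 'a set)"
proof -
  have "open (- \<gamma>)"
  proof (subst open_subopen, intro ballI)
    fix p assume p: "p \<in> - \<gamma>"
    obtain U K where U: "open U" "p \<in> U" "compact K" "U \<subseteq> K" using compact_nbhd .
    have "finite (\<gamma> \<inter> K)" using assms U by (auto simp: configs_def)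
    then have "open (U - (\<gamma> \<inter> K))" using U by (intro open_Diff) (auto intro: finite_imp_closed)
    then show "\<exists>T. open T \<and> p \<in> T \<and> T \<subseteq> - \<gamma>" using U p by (intro exI[of _ "U - (\<gamma> \<inter> K)"]) auto
  qed
  then show ?thesis by (simp add: closed_def)
qed

lemma C0_measurable: "f \<in> C0 \<Longrightarrow> f \<in> borel_measurable (borel :: 'a measure)"
  by (auto simp: C0_def intro: borel_measurable_continuous_onI)

text \<open>\<open>T\<close> may be any finite part of \<gamma> that carries all nonzero terms. This
  freedom lets the pairings of two configurations be written over the same index set, or over
  matched points.\<close>

lemma pairing_eq_sum:
  fixes f :: "'a \<Rightarrow> real"
  assumes "f \<in> C0" "finite T" "\<gamma> \<inter> {x. f x \<noteq> 0} \<subseteq> T" "T \<subseteq> \<gamma>"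
  shows "pairing f \<gamma> = sum f T"
proof -
  have eq: "{x\<in>\<gamma>. f x \<noteq> 0} = \<gamma> \<inter> {x. f x \<noteq> 0}" by auto
  have fin: "finite {x\<in>\<gamma>. f x \<noteq> 0}" using assms unfolding eq by (auto intro: finite_subset)
  have "pairing f \<gamma> = (LINT x|count_space \<gamma>. f x)"
    unfolding pairing_def config_measure_def using C0_measurable[OF assms(1)]
    by (subst integral_distr) auto
  also have "\<dots> = (\<Sum>x | x \<in> \<gamma> \<and> f x \<noteq> 0. f x)"
    using fin by (rule lebesgue_integral_count_space_finite_support)
  also have "\<dots> = sum f T" using assms by (intro sum.mono_neutral_left) auto
  finally show ?thesis .
qed

lemma configs_finite_support:
  assumes "f \<in> C0" "\<gamma> \<in> configs" shows "finite (\<gamma> \<inter> {x::'a. f x \<noteq> (0::real)})"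
proof -
  have "finite (\<gamma> \<inter> closure {x. f x \<noteq> 0})" using assms by (auto simp: C0_def configs_def)
  then show ?thesis by (rule rev_finite_subset) (auto intro: subsetD[OF closure_subset])
qed

section \<open>The vague topology and a countable generator of its Borel \<sigma>-algebra\<close>

lemma topspace_vague: "topspace (vague_topology :: 'a set topology) = configs"
proof -
  have "(\<lambda>_. 0) \<in> (C0 :: ('a \<Rightarrow> real) set)" by (auto simp: C0_def)
  then have "configs \<in> {{\<gamma>\<in>configs. pairing f \<gamma> \<in> U} | (f::'a \<Rightarrow> real) U. f \<in> C0 \<and> open U}"
    by (intro CollectI exI[of _ "\<lambda>_. 0"] exI[of _ UNIV]) auto
  then show ?thesis unfolding vague_topology_def topology_generated_by_topspace
    by (intro equalityI Union_upper) auto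
qed

lemma openin_vague_subset: "openin vague_topology W \<Longrightarrow> W \<subseteq> (configs :: 'a set set)"
  using openin_subset topspace_vague by fastforce

lemma space_config_borel[simp]: "space config_borel = (configs :: 'a set set)"
  unfolding config_borel_def by (intro space_measure_of) (auto dest: openin_vague_subset)

lemma sets_config_borel: "sets config_borel = sigma_sets (configs :: 'a set set) {U. openin vague_topology U}"
  unfolding config_borel_def by (intro sets_measure_of) (auto dest: openin_vague_subset)

lemma pairing_measurable[measurable]:
  assumes "f \<in> C0" shows "pairing (f :: 'a \<Rightarrow> real) \<in> borel_measurable config_borel"
proof (rule borel_measurableI)
  fix S :: "real set" assume "open S"
  then have "openin vague_topology {\<gamma>\<in>configs. pairing f \<gamma> \<in> S}"
    unfolding vague_topology_def using assms by (intro topology_generated_by_Basis) auto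
  moreover have "pairing f -` S \<inter> space config_borel = {\<gamma>\<in>configs. pairing f \<gamma> \<in> S}" by auto
  ultimately show "pairing f -` S \<inter> space config_borel \<in> sets config_borel"
    unfolding sets_config_borel by auto
qed

definition hit :: "'a set \<Rightarrow> 'a set set" where
  "hit V = {\<gamma>\<in>configs. \<gamma> \<inter> V \<noteq> {}}"

text \<open>No point in \<open>V\<close> is allowed as well; the conjunction with
  \<open>hit V\<close> expresses exactly one point.\<close>

definition single :: "'a set \<Rightarrow> 'a set set" where
  "single V = {\<gamma>\<in>configs. \<forall>x\<in>\<gamma> \<inter> V. \<forall>y\<in>\<gamma> \<inter> V. x = y}"

text \<open>A configuration meets \<open>V\<close> iff some nonnegative bump function vanishing off
  \<open>V\<close> has positive pairing with it, so the event is a union of subbasic open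
  sets.\<close>

lemma openin_hit:
  assumes "open V" shows "openin vague_topology (hit V)"
proof -
  let ?\<W> = "{{\<gamma>\<in>configs. pairing f \<gamma> \<in> {0<..}} | f. f \<in> C0 \<and> (\<forall>x. 0 \<le> f x) \<and> (\<forall>x. x \<notin> V \<longrightarrow> f x = 0)}"
  have "hit V = \<Union>?\<W>"
  proof (intro equalityI subsetI)
    fix \<gamma> assume "\<gamma> \<in> hit V"
    then obtain p where p: "p \<in> \<gamma>" "p \<in> V" "\<gamma> \<in> configs" by (auto simp: hit_def)
    obtain f where f: "f \<in> C0" "\<And>x. 0 \<le> f x" "0 < f p" "\<And>x. x \<notin> V \<Longrightarrow> f x = 0"
      using bump[OF assms p(2)] by blast
    have "pairing f \<gamma> = sum f (\<gamma> \<inter> {x. f x \<noteq> 0})"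
      using f p configs_finite_support by (intro pairing_eq_sum) auto
    also have "\<dots> > 0" using f p configs_finite_support by (intro sum_pos2[of _ p]) auto
    finally have "\<gamma> \<in> {\<gamma>\<in>configs. pairing f \<gamma> \<in> {0<..}}" using p by simp
    moreover have "{\<gamma>\<in>configs. pairing f \<gamma> \<in> {0<..}} \<in> ?\<W>" using f by blast
    ultimately show "\<gamma> \<in> \<Union>?\<W>" by (rule UnionI[rotated])
  next
    fix \<gamma> assume "\<gamma> \<in> \<Union>?\<W>"
    then obtain f where f: "f \<in> C0" "\<And>x. x \<notin> V \<Longrightarrow> f x = 0" "\<gamma> \<in> configs" "0 < pairing f \<gamma>" by auto
    have "\<gamma> \<inter> V \<noteq> {}"
    proof
      assume e: "\<gamma> \<inter> V = {}"
      have "pairing f \<gamma> = sum f {}"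
        using f e by (intro pairing_eq_sum) auto
      then show False using f by simp
    qed
    then show "\<gamma> \<in> hit V" using f by (auto simp: hit_def)
  qed
  moreover have "openin vague_topology W" if "W \<in> ?\<W>" for W
    using that open_greaterThan[of "0::real"] unfolding vague_topology_def
    by (intro topology_generated_by_Basis) blast
  ultimately show ?thesis by (metis (no_types, lifting) openin_Union)
qed

definition base :: "'a set set" where
  "base = (SOME B. countable B \<and> topological_basis B)"

lemma countable_base: "countable base" and topological_base: "topological_basis base"
  unfolding base_def using someI_ex[OF ex_countable_basis[where 'a='a]] by auto

lemma open_base: "V \<in> base \<Longrightarrow> open V"
  using topological_base topological_basis_open by blast

lemma baseE:
  assumes "open W" "x \<in> W" obtains V where "V \<in> base" "x \<in> V" "V \<subseteq> W"
  using topological_base assms by (meson topological_basisE)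

text \<open>A countable stock of events from which vague neighbourhoods are cut out. The second and
  third kind are complements of open sets; they need not be vaguely open, and it is enough that they
  are measurable.\<close>

definition elementary :: "'a set set set" where
  "elementary = hit ` base \<union> (\<lambda>V. configs - hit V) ` base \<union> single ` base"

text \<open>Each of the finitely many points of \<gamma>0 in the support of \<open>f\<close> gets a
  small basic set on which \<open>f\<close> is nearly constant; the rest of the support is covered
  by finitely many basic sets that miss \<gamma>0. A configuration with exactly one point in each
  set of the first kind and none in those of the second has its terms matched with those of
  \<gamma>0, up to a small error each.\<close>

lemma vague_nbhd_subbasic:
  fixes f :: "'a \<Rightarrow> real"
  assumes f: "f \<in> C0" and U: "open U" and \<gamma>0: "\<gamma>0 \<in> configs" "pairing f \<gamma>0 \<in> U"
  shows "\<exists>\<T>. finite \<T> \<and> \<T> \<subseteq> elementary \<and> \<gamma>0 \<in> \<Inter>\<T> \<and> configs \<inter> \<Inter>\<T> \<subseteq> {\<gamma>\<in>configs. pairing f \<gamma> \<in> U}"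
proof -
  define K where "K = closure {x. f x \<noteq> 0}"
  have K: "compact K" "\<And>x. f x \<noteq> 0 \<Longrightarrow> x \<in> K"
    using f closure_subset[of "{x. f x \<noteq> 0}"] by (auto simp: K_def C0_def)
  define P where "P = \<gamma>0 \<inter> K"
  have finP: "finite P" using \<gamma>0 K by (auto simp: P_def configs_def)
  obtain e where e: "e > 0" "ball (pairing f \<gamma>0) e \<subseteq> U" using U \<gamma>0 openE by blast
  \<comment> \<open>The tolerance per point. The added 1 makes the total error strictly less than
    \<open>e\<close> and covers the case of empty \<open>P\<close>.\<close>
  define d where "d = e / (card P + 1)"
  have d: "d > 0" using e by (simp add: d_def)
  obtain N where N: "\<And>x. x \<in> P \<Longrightarrow> open (N x) \<and> x \<in> N x" "disjoint_family_on N P"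
    using finite_separation[OF finP] by blast
  \<comment> \<open>Avoiding \<gamma>0 - {x} puts \<gamma>0 itself into \<open>single (V x)\<close>;
    staying inside \<open>N x\<close> keeps the sets for different points disjoint.\<close>
  have "\<forall>x\<in>P. \<exists>V\<in>base. x \<in> V \<and> V \<subseteq> N x \<inter> {y. \<bar>f y - f x\<bar> < d} \<inter> - (\<gamma>0 - {x})"
  proof
    fix x assume x: "x \<in> P"
    have "open {y. \<bar>f y - f x\<bar> < d}"
      using f by (intro open_Collect_less) (auto simp: C0_def intro!: continuous_intros)
    moreover have "open (- (\<gamma>0 - {x}))"
      using configs_closed[OF configs_subset[OF \<gamma>0(1)], of "\<gamma>0 - {x}"] by (intro open_Compl) auto
    ultimately have "open (N x \<inter> {y. \<bar>f y - f x\<bar> < d} \<inter> - (\<gamma>0 - {x}))"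
      using N x by (intro open_Int) auto
    moreover have "x \<in> N x \<inter> {y. \<bar>f y - f x\<bar> < d} \<inter> - (\<gamma>0 - {x})" using N(1)[OF x] d by auto
    ultimately show "\<exists>V\<in>base. x \<in> V \<and> V \<subseteq> N x \<inter> {y. \<bar>f y - f x\<bar> < d} \<inter> - (\<gamma>0 - {x})"
      by (rule baseE) auto
  qed
  then obtain V where V: "\<And>x. x \<in> P \<Longrightarrow> V x \<in> base \<and> x \<in> V x \<and> V x \<subseteq> N x \<inter> {y. \<bar>f y - f x\<bar> < d} \<inter> - (\<gamma>0 - {x})"
    by metis
  \<comment> \<open>Removing open sets from \<open>K\<close> leaves a compact set, so finitely many
    basic sets that miss \<gamma>0 cover it.\<close>
  define R where "R = K - (\<Union>x\<in>P. V x)"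
  have "compact R"
    unfolding R_def using K V open_base by (intro compact_diff) auto
  moreover have "R \<subseteq> \<Union>{W\<in>base. W \<inter> \<gamma>0 = {}}"
  proof
    fix q assume q: "q \<in> R"
    have "q \<notin> \<gamma>0"
    proof
      assume "q \<in> \<gamma>0"
      then have "q \<in> P" using q by (auto simp: R_def P_def)
      then show False using q V by (auto simp: R_def)
    qed
    then obtain W where "W \<in> base" "q \<in> W" "W \<subseteq> - \<gamma>0"
      using baseE[of "- \<gamma>0" q] configs_closed[OF \<gamma>0(1)] by (metis ComplI open_Compl)
    then show "q \<in> \<Union>{W\<in>base. W \<inter> \<gamma>0 = {}}" by blast
  qed
  ultimately obtain \<W> where \<W>: "\<W> \<subseteq> {W\<in>base. W \<inter> \<gamma>0 = {}}" "finite \<W>" "R \<subseteq> \<Union>\<W>"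
    by (rule compactE) (use open_base in auto)
  define \<T> where "\<T> = (hit \<circ> V) ` P \<union> (single \<circ> V) ` P \<union> (\<lambda>W. configs - hit W) ` \<W>"
  have "finite \<T>" using finP \<W> by (auto simp: \<T>_def)
  moreover have "\<T> \<subseteq> elementary" using V \<W> by (auto simp: \<T>_def elementary_def)
  moreover have "\<gamma>0 \<in> \<Inter>\<T>"
  proof -
    have "\<gamma>0 \<in> hit (V x) \<and> \<gamma>0 \<in> single (V x)" if "x \<in> P" for x
      using that V[OF that] \<gamma>0 unfolding hit_def single_def P_def by blast
    moreover have "\<gamma>0 \<in> configs - hit W" if "W \<in> \<W>" for W
      using that \<W> \<gamma>0 by (auto simp: hit_def)
    ultimately show ?thesis by (auto simp: \<T>_def)
  qed
  moreover have "pairing f \<gamma> \<in> U" if \<gamma>: "\<gamma> \<in> configs" "\<gamma> \<in> \<Inter>\<T>" for \<gamma>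
  proof -
    have "\<forall>x\<in>P. \<exists>y. \<gamma> \<inter> V x = {y}"
    proof
      fix x assume "x \<in> P"
      then have "\<gamma> \<in> hit (V x)" "\<gamma> \<in> single (V x)" using \<gamma> by (auto simp: \<T>_def)
      then obtain y where "y \<in> \<gamma> \<inter> V x" "\<And>y'. y' \<in> \<gamma> \<inter> V x \<Longrightarrow> y' = y"
        by (auto simp: hit_def single_def)
      then have "\<gamma> \<inter> V x = {y}" by blast
      then show "\<exists>y. \<gamma> \<inter> V x = {y}" ..
    qed
    then obtain y where y: "\<And>x. x \<in> P \<Longrightarrow> \<gamma> \<inter> V x = {y x}" by metis
    have yP: "y x \<in> V x" "y x \<in> \<gamma>" if "x \<in> P" for x using y[OF that] by auto
    have inj: "inj_on y P"
    proof (rule inj_onI)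
      fix a b assume ab: "a \<in> P" "b \<in> P" "y a = y b"
      then have "y a \<in> N a" "y a \<in> N b" using V yP by (metis Int_iff subsetD)+
      then show "a = b" using N(2) ab by (metis IntI disjoint_family_onD empty_iff)
    qed
    have "\<gamma> \<inter> {x. f x \<noteq> 0} \<subseteq> y ` P"
    proof
      fix q assume q: "q \<in> \<gamma> \<inter> {x. f x \<noteq> 0}"
      have "q \<notin> R"
      proof
        assume "q \<in> R"
        then obtain W where "W \<in> \<W>" "q \<in> W" using \<W> by blast
        then have "\<gamma> \<notin> hit W" using \<gamma> by (auto simp: \<T>_def)
        then show False using \<open>q \<in> W\<close> q \<gamma> by (auto simp: hit_def)
      qed
      then obtain x where "x \<in> P" "q \<in> V x" using q K by (auto simp: R_def)
      then show "q \<in> y ` P" using y[of x] q by auto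
    qed
    then have "pairing f \<gamma> = sum f (y ` P)"
      using finP f yP by (intro pairing_eq_sum) auto
    also have "\<dots> = (\<Sum>x\<in>P. f (y x))" using inj by (simp add: sum.reindex)
    finally have 1: "pairing f \<gamma> = (\<Sum>x\<in>P. f (y x))" .
    have 2: "pairing f \<gamma>0 = (\<Sum>x\<in>P. f x)"
      using finP f K by (intro pairing_eq_sum) (auto simp: P_def)
    have "\<bar>f (y x) - f x\<bar> \<le> d" if "x \<in> P" for x
      using V[OF that] yP[OF that] by auto
    then have "\<bar>\<Sum>x\<in>P. f (y x) - f x\<bar> \<le> (\<Sum>x\<in>P. d)"
      by (intro order.trans[OF sum_abs] sum_mono) auto
    also have "\<dots> < e" using e by (simp add: d_def field_simps)
    finally have "\<bar>pairing f \<gamma> - pairing f \<gamma>0\<bar> < e" by (simp add: 1 2 sum_subtractf)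
    then show ?thesis using e by (auto simp: dist_real_def ball_def abs_minus_commute subset_eq)
  qed
  ultimately show ?thesis by (intro exI[of _ \<T>]) auto
qed

lemma vague_nbhd:
  fixes W :: "'a set set"
  assumes "openin vague_topology W" "\<gamma>0 \<in> W"
  shows "\<exists>\<T>. finite \<T> \<and> \<T> \<subseteq> elementary \<and> \<gamma>0 \<in> \<Inter>\<T> \<and> configs \<inter> \<Inter>\<T> \<subseteq> W"
proof -
  have "generate_topology_on {{\<gamma>\<in>configs. pairing f \<gamma> \<in> U} | (f::'a \<Rightarrow> real) U. f \<in> C0 \<and> open U} W"
    using assms(1) unfolding vague_topology_def openin_topology_generated_by_iff .
  then show ?thesis using assms(2)
  proof (induction arbitrary: \<gamma>0)
    case Empty then show ?case by simp
  next
    case (Int a b)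
    from Int.IH(1)[of \<gamma>0] Int.prems obtain \<S> where \<S>: "finite \<S>" "\<S> \<subseteq> elementary" "\<gamma>0 \<in> \<Inter>\<S>" "configs \<inter> \<Inter>\<S> \<subseteq> a" by auto
    from Int.IH(2)[of \<gamma>0] Int.prems obtain \<T> where \<T>: "finite \<T>" "\<T> \<subseteq> elementary" "\<gamma>0 \<in> \<Inter>\<T>" "configs \<inter> \<Inter>\<T> \<subseteq> b" by auto
    show ?case using \<S> \<T> by (intro exI[of _ "\<S> \<union> \<T>"]) auto
  next
    case (UN K)
    then obtain k where "k \<in> K" "\<gamma>0 \<in> k" by auto
    from UN.IH[OF this] show ?case using \<open>k \<in> K\<close> by (meson Sup_upper order_trans)
  next
    case (Basis s)
    then obtain f U where s: "s = {\<gamma>\<in>configs. pairing f \<gamma> \<in> U}" "f \<in> C0" "open U" by auto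
    show ?case using vague_nbhd_subbasic[OF s(2,3), of \<gamma>0] Basis.prems unfolding s by auto
  qed
qed

text \<open>Two different points in \<open>V\<close> are separated by disjoint basic subsets of
  \<open>V\<close>, which the configuration then both hits. This writes \<open>single V\<close>
  through countably many hitting events.\<close>

lemma single_eq:
  fixes V :: "'a set"
  assumes "open V"
  shows "single V = configs - (\<Union>p\<in>{p \<in> base \<times> base. fst p \<subseteq> V \<and> snd p \<subseteq> V \<and> fst p \<inter> snd p = {}}. hit (fst p) \<inter> hit (snd p))"
proof (intro equalityI subsetI)
  fix \<gamma> assume \<gamma>: "\<gamma> \<in> single V"
  have "\<not> (\<gamma> \<in> hit A \<and> \<gamma> \<in> hit B)" if AB: "A \<subseteq> V" "B \<subseteq> V" "A \<inter> B = {}" for A B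
  proof
    assume "\<gamma> \<in> hit A \<and> \<gamma> \<in> hit B"
    then obtain a b where "a \<in> \<gamma>" "a \<in> A" "b \<in> \<gamma>" "b \<in> B" by (auto simp: hit_def)
    moreover from this AB have "a \<in> \<gamma> \<inter> V" "b \<in> \<gamma> \<inter> V" by auto
    then have "a = b" using \<gamma> by (simp add: single_def)
    ultimately show False using AB by auto
  qed
  then show "\<gamma> \<in> configs - (\<Union>p\<in>{p \<in> base \<times> base. fst p \<subseteq> V \<and> snd p \<subseteq> V \<and> fst p \<inter> snd p = {}}. hit (fst p) \<inter> hit (snd p))"
    using \<gamma> by (auto simp: single_def)
next
  fix \<gamma> assume \<gamma>: "\<gamma> \<in> configs - (\<Union>p\<in>{p \<in> base \<times> base. fst p \<subseteq> V \<and> snd p \<subseteq> V \<and> fst p \<inter> snd p = {}}. hit (fst p) \<inter> hit (snd p))"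
  have "x = y" if xy: "x \<in> \<gamma> \<inter> V" "y \<in> \<gamma> \<inter> V" for x y
  proof (rule ccontr)
    assume "x \<noteq> y"
    then obtain A B where AB: "open A" "open B" "x \<in> A" "y \<in> B" "A \<inter> B = {}" using hausdorff by metis
    obtain A' where A': "A' \<in> base" "x \<in> A'" "A' \<subseteq> A \<inter> V" using baseE[of "A \<inter> V" x] AB xy assms by blast
    obtain B' where B': "B' \<in> base" "y \<in> B'" "B' \<subseteq> B \<inter> V" using baseE[of "B \<inter> V" y] AB xy assms by blast
    have "(A', B') \<in> {p \<in> base \<times> base. fst p \<subseteq> V \<and> snd p \<subseteq> V \<and> fst p \<inter> snd p = {}}"
      using A' B' AB by auto
    moreover have "\<gamma> \<in> hit A' \<inter> hit B'" using A' B' xy \<gamma> unfolding hit_def by blast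
    ultimately have "\<gamma> \<in> (\<Union>p\<in>{p \<in> base \<times> base. fst p \<subseteq> V \<and> snd p \<subseteq> V \<and> fst p \<inter> snd p = {}}. hit (fst p) \<inter> hit (snd p))"
      by (intro UN_I[of "(A', B')"]) auto
    then show False using \<gamma> by blast
  qed
  then show "\<gamma> \<in> single V" using \<gamma> by (auto simp: single_def)
qed

text \<open>A vaguely open set is the union of the finite intersections of elementary events that it
  contains, and there are only countably many such intersections. Although the pieces need not be
  open, this does the work of a countable base.\<close>

lemma sets_config_borel_hit: "sets config_borel = sigma_sets configs (hit ` (base :: 'a set set))"
proof (intro equalityI)
  interpret \<G>: sigma_algebra "configs :: 'a set set" "sigma_sets configs (hit ` base)"
    by (intro sigma_algebra_sigma_sets) (auto simp: hit_def)
  have hit: "hit V \<in> sigma_sets configs (hit ` base)" if "V \<in> base" for V :: "'a set"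
    using that by (intro sigma_sets.Basic imageI)
  have "single V \<in> sigma_sets configs (hit ` base)" if "V \<in> base" for V :: "'a set"
    unfolding single_eq[OF open_base[OF that]] using countable_base
    by (intro \<G>.Diff \<G>.top \<G>.countable_UN' \<G>.Int hit) (auto intro: countable_subset[of _ "base \<times> base"])
  then have el: "\<T> \<subseteq> elementary \<Longrightarrow> \<T> \<subseteq> sigma_sets configs (hit ` base)" for \<T> :: "'a set set set"
    using hit \<G>.compl_sets unfolding elementary_def by blast
  have fin: "configs \<inter> \<Inter>\<T> \<in> sigma_sets configs (hit ` base)" if "finite \<T>" "\<T> \<subseteq> elementary"
    for \<T> :: "'a set set set"
    using that
  proof (induction \<T>)
    case empty then show ?case using \<G>.top by simp
  next
    case (insert T \<T>)
    then have "T \<inter> (configs \<inter> \<Inter>\<T>) \<in> sigma_sets configs (hit ` base)"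
      using el[of "{T}"] insert.IH insert.prems by (intro \<G>.Int[of T]) blast+
    moreover have "T \<inter> (configs \<inter> \<Inter>\<T>) = configs \<inter> \<Inter>(insert T \<T>)" by blast
    ultimately show ?case by simp
  qed
  have "W \<in> sigma_sets configs (hit ` base)" if W: "openin vague_topology W" for W
  proof -
    let ?I = "{\<T>. finite \<T> \<and> \<T> \<subseteq> elementary \<and> configs \<inter> \<Inter>\<T> \<subseteq> W}"
    have "W = (\<Union>\<T>\<in>?I. configs \<inter> \<Inter>\<T>)"
    proof (intro equalityI subsetI)
      fix \<gamma> assume \<gamma>: "\<gamma> \<in> W"
      then obtain \<T> where "\<T> \<in> ?I" "\<gamma> \<in> \<Inter>\<T>" using vague_nbhd[OF W \<gamma>] by auto
      moreover have "\<gamma> \<in> configs" using \<gamma> openin_vague_subset[OF W] by auto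
      ultimately show "\<gamma> \<in> (\<Union>\<T>\<in>?I. configs \<inter> \<Inter>\<T>)" by (intro UN_I IntI)
    qed auto
    moreover have "countable ?I"
      using countable_base
      by (intro countable_subset[OF _ countable_Collect_finite_subset[of elementary]]) (auto simp: elementary_def)
    moreover have "(\<Union>\<T>\<in>?I. configs \<inter> \<Inter>\<T>) \<in> sigma_sets configs (hit ` base)"
      using \<open>countable ?I\<close> fin by (intro \<G>.countable_UN') auto
    ultimately show ?thesis by simp
  qed
  then show "sets config_borel \<subseteq> sigma_sets configs (hit ` base)"
    unfolding sets_config_borel by (intro sigma_sets_mono) auto
  show "sigma_sets configs (hit ` base) \<subseteq> sets config_borel"
    unfolding sets_config_borel using openin_hit open_base by (intro sigma_sets_mono) auto
qed

lemma hit_measurable: "open (V :: 'a set) \<Longrightarrow> hit V \<in> sets config_borel"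
  using openin_hit unfolding sets_config_borel by auto

section \<open>Measurability of adding and removing a point\<close>

lemma measurable_config_borelI:
  assumes "f \<in> space M \<rightarrow> (configs :: 'a set set)"
    and "\<And>V. V \<in> base \<Longrightarrow> {w \<in> space M. f w \<inter> V \<noteq> {}} \<in> sets M"
  shows "f \<in> measurable M config_borel"
proof -
  have "f -` A \<inter> space M \<in> sets M" if "A \<in> hit ` (base :: 'a set set)" for A
  proof -
    from that obtain V where V: "V \<in> base" "A = hit V" by blast
    then have "f -` A \<inter> space M = {w \<in> space M. f w \<inter> V \<noteq> {}}" using assms(1) by (auto simp: hit_def)
    then show ?thesis using assms(2)[OF V(1)] by simp
  qed
  then have "f \<in> measurable M (sigma configs (hit ` base))"
    using assms(1) by (intro measurable_measure_of) (auto simp: hit_def)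
  moreover have "sets (sigma configs (hit ` base)) = sets config_borel"
    unfolding sets_config_borel_hit by (intro sets_measure_of) (auto simp: hit_def)
  ultimately show ?thesis using measurable_cong_sets by blast
qed

lemma hit_pred[measurable]: "open (V :: 'a set) \<Longrightarrow> Measurable.pred config_borel (\<lambda>\<gamma>. \<gamma> \<inter> V \<noteq> {})"
  using hit_measurable[of V] unfolding pred_def by (simp add: hit_def)

lemma measurable_insert[measurable]:
  "(\<lambda>(x, \<gamma>). insert x \<gamma>) \<in> measurable (borel \<Otimes>\<^sub>M config_borel) (config_borel :: 'a set measure)"
proof (rule measurable_config_borelI)
  show "(\<lambda>(x, \<gamma>). insert x \<gamma>) \<in> space (borel \<Otimes>\<^sub>M config_borel) \<rightarrow> (configs :: 'a set set)"
    by (auto simp: space_pair_measure intro: configs_insert)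
  fix V :: "'a set" assume "V \<in> base"
  then have [measurable]: "open V" "V \<in> sets borel" using open_base by auto
  have "{w \<in> space (borel \<Otimes>\<^sub>M config_borel). (case w of (x, \<gamma>) \<Rightarrow> insert x \<gamma>) \<inter> V \<noteq> {}} =
     {w \<in> space (borel \<Otimes>\<^sub>M config_borel). fst w \<in> V \<or> snd w \<inter> V \<noteq> {}}" by auto
  also have "\<dots> \<in> sets (borel \<Otimes>\<^sub>M config_borel)" by measurable
  finally show "{w \<in> space (borel \<Otimes>\<^sub>M config_borel). (case w of (x, \<gamma>) \<Rightarrow> insert x \<gamma>) \<inter> V \<noteq> {}} \<in> sets (borel \<Otimes>\<^sub>M config_borel)" .
qed

text \<open>A point of \<gamma> in \<open>V\<close> other than x lies in a basic set inside the open
  set V - {x}. Hence the event is a countable union, over basic subsets of \<open>V\<close>, of the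
  events that x is outside and \<gamma> meets the subset.\<close>

lemma measurable_remove[measurable]:
  "(\<lambda>(x, \<gamma>). \<gamma> - {x}) \<in> measurable (borel \<Otimes>\<^sub>M config_borel) (config_borel :: 'a set measure)"
proof (rule measurable_config_borelI)
  show "(\<lambda>(x, \<gamma>). \<gamma> - {x}) \<in> space (borel \<Otimes>\<^sub>M config_borel) \<rightarrow> (configs :: 'a set set)"
    by (auto simp: space_pair_measure intro: configs_subset)
  fix V :: "'a set" assume V: "V \<in> base"
  let ?B = "{V' \<in> base. V' \<subseteq> V}"
  have [measurable]: "\<And>V'. V' \<in> ?B \<Longrightarrow> open V'" "\<And>V'. V' \<in> ?B \<Longrightarrow> V' \<in> sets borel" using open_base by auto
  have [simp]: "countable ?B" using countable_base by (auto intro: countable_subset)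
  have "{w \<in> space (borel \<Otimes>\<^sub>M config_borel). (case w of (x, \<gamma>) \<Rightarrow> \<gamma> - {x}) \<inter> V \<noteq> {}} =
     {w \<in> space (borel \<Otimes>\<^sub>M config_borel). \<exists>V'\<in>?B. fst w \<notin> V' \<and> snd w \<inter> V' \<noteq> {}}"
  proof -
    have "(\<gamma> - {x}) \<inter> V \<noteq> {} \<longleftrightarrow> (\<exists>V'\<in>?B. x \<notin> V' \<and> \<gamma> \<inter> V' \<noteq> {})" for x and \<gamma> :: "'a set"
    proof
      assume "(\<gamma> - {x}) \<inter> V \<noteq> {}"
      then obtain y where y: "y \<in> \<gamma>" "y \<noteq> x" "y \<in> V" by auto
      moreover have "open (V - {x})" using open_base[OF V] by (intro open_Diff) auto
      ultimately obtain V' where "V' \<in> base" "y \<in> V'" "V' \<subseteq> V - {x}"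
        using baseE[of "V - {x}" y] by blast
      then show "\<exists>V'\<in>?B. x \<notin> V' \<and> \<gamma> \<inter> V' \<noteq> {}" using y by blast
    qed auto
    then show ?thesis unfolding case_prod_beta by simp
  qed
  also have "\<dots> \<in> sets (borel \<Otimes>\<^sub>M config_borel)" by measurable
  finally show "{w \<in> space (borel \<Otimes>\<^sub>M config_borel). (case w of (x, \<gamma>) \<Rightarrow> \<gamma> - {x}) \<inter> V \<noteq> {}} \<in> sets (borel \<Otimes>\<^sub>M config_borel)" .
qed

lemma measurable_insert'[measurable (raw)]:
  assumes "f \<in> borel_measurable M" "h \<in> measurable M config_borel"
  shows "(\<lambda>w. insert (f w :: 'a) (h w)) \<in> measurable M config_borel"
  using measurable_compose[OF measurable_Pair[OF assms] measurable_insert] by simp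

lemma measurable_remove'[measurable (raw)]:
  assumes "f \<in> borel_measurable M" "h \<in> measurable M config_borel"
  shows "(\<lambda>w. h w - {f w :: 'a}) \<in> measurable M config_borel"
  using measurable_compose[OF measurable_Pair[OF assms] measurable_remove] by simp

lemma measurable_move[measurable (raw)]:
  assumes "f \<in> borel_measurable M" "f' \<in> borel_measurable M" "h \<in> measurable M config_borel"
  shows "(\<lambda>w. move (f w :: 'a) (f' w) (h w)) \<in> measurable M config_borel"
  unfolding move_def using assms by measurable

section \<open>Integration against a configuration\<close>

lemma configs_finite_Int:
  assumes "\<gamma> \<in> configs" "compact K" "U \<subseteq> (K :: 'a set)" shows "finite (\<gamma> \<inter> U)"
proof -
  have "finite (\<gamma> \<inter> K)" using assms by (simp add: configs_def)
  then show ?thesis by (rule rev_finite_subset) (use assms(3) in blast)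
qed

lemma nn_integral_config:
  fixes f :: "'a \<Rightarrow> ennreal"
  assumes "f \<in> borel_measurable borel"
  shows "(\<integral>\<^sup>+x. f x \<partial>config_measure \<gamma>) = (\<integral>\<^sup>+x. f x \<partial>count_space \<gamma>)"
  unfolding config_measure_def using assms by (subst nn_integral_distr) auto

lemma space_config_measure[simp]: "space (config_measure \<gamma>) = (UNIV :: 'a set)"
  and sets_config_measure[simp, measurable_cong]: "sets (config_measure \<gamma>) = sets (borel :: 'a measure)"
  by (simp_all add: config_measure_def)

lemma emeasure_config_measure:
  "B \<in> sets borel \<Longrightarrow> emeasure (config_measure \<gamma>) B = emeasure (count_space \<gamma>) (\<gamma> \<inter> (B :: 'a set))"
  unfolding config_measure_def by (subst emeasure_distr) (auto simp: Int_commute)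

lemma sigma_finite_config:
  assumes "\<gamma> \<in> configs" shows "sigma_finite_measure (config_measure \<gamma> :: 'a measure)"
proof -
  obtain U :: "nat \<Rightarrow> 'a set" where U: "\<And>n. open (U n)" "\<And>n. \<exists>K. compact K \<and> U n \<subseteq> K" "(\<Union>n. U n) = UNIV"
    using exhaustion by metis
  have "emeasure (config_measure \<gamma>) (U n) \<noteq> \<infinity>" for n
  proof -
    obtain K where "compact K" "U n \<subseteq> K" using U(2) by blast
    then have "finite (\<gamma> \<inter> U n)" using assms configs_finite_Int by blast
    then show ?thesis using U(1) by (subst emeasure_config_measure) auto
  qed
  then show ?thesis using U by (intro sigma_finite_measure.intro exI[of _ "range U"]) auto
qed

text \<open>Points of a finite set can be separated by disjoint basic sets; conversely, one point
  chosen from each of k disjoint sets gives k different points. Counting thereby becomes a countable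
  union of finite intersections of hitting events.\<close>

lemma card_ge_iff_hit:
  assumes "open U" "\<gamma> \<in> configs" "finite (\<gamma> \<inter> U)"
  shows "k \<le> card (\<gamma> \<inter> U) \<longleftrightarrow>
    (\<exists>\<A>\<in>{\<A>. finite \<A> \<and> \<A> \<subseteq> (base :: 'a set set) \<and> disjoint \<A> \<and> card \<A> = k \<and> \<Union>\<A> \<subseteq> U}. \<forall>V\<in>\<A>. \<gamma> \<in> hit V)"
proof
  assume "k \<le> card (\<gamma> \<inter> U)"
  then obtain P where P: "P \<subseteq> \<gamma> \<inter> U" "card P = k" "finite P"
    using assms(3) by (metis obtain_subset_with_card_n)
  obtain N where N: "\<And>x. x \<in> P \<Longrightarrow> open (N x) \<and> x \<in> N x" "disjoint_family_on N P"
    using finite_separation[OF P(3)] by blast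
  have "\<exists>V\<in>base. x \<in> V \<and> V \<subseteq> N x \<inter> U" if "x \<in> P" for x
  proof -
    have "open (N x \<inter> U)" "x \<in> N x \<inter> U" using N(1)[OF that] that P assms(1) by auto
    then show ?thesis by (rule baseE) auto
  qed
  then obtain V where V: "\<And>x. x \<in> P \<Longrightarrow> V x \<in> base \<and> x \<in> V x \<and> V x \<subseteq> N x \<inter> U" by metis
  have disj: "V x \<inter> V y = {}" if "x \<in> P" "y \<in> P" "x \<noteq> y" for x y
    using disjoint_family_onD[OF N(2) that] V[OF that(1)] V[OF that(2)] by blast
  have "inj_on V P"
  proof (rule inj_onI, rule ccontr)
    fix x y assume xy: "x \<in> P" "y \<in> P" "V x = V y" "x \<noteq> y"
    then show False using disj[of x y] V[of x] by auto
  qed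
  then have "card (V ` P) = k" using P by (simp add: card_image)
  moreover have "disjoint (V ` P)" using disj by (fastforce simp: disjoint_def)
  moreover have "\<gamma> \<in> hit (V x)" if "x \<in> P" for x
    using V[OF that] P(1) that assms(2) by (auto simp: hit_def)
  then have "\<forall>W\<in>V ` P. \<gamma> \<in> hit W" by auto
  moreover have "V ` P \<subseteq> base" "\<Union>(V ` P) \<subseteq> U" using V by blast+
  ultimately show "\<exists>\<A>\<in>{\<A>. finite \<A> \<and> \<A> \<subseteq> base \<and> disjoint \<A> \<and> card \<A> = k \<and> \<Union>\<A> \<subseteq> U}. \<forall>V\<in>\<A>. \<gamma> \<in> hit V"
    using P(3) by (intro bexI[of _ "V ` P"]) simp_all
next
  assume "\<exists>\<A>\<in>{\<A>. finite \<A> \<and> \<A> \<subseteq> base \<and> disjoint \<A> \<and> card \<A> = k \<and> \<Union>\<A> \<subseteq> U}. \<forall>V\<in>\<A>. \<gamma> \<in> hit V"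
  then obtain \<A> where \<A>: "finite \<A>" "disjoint \<A>" "card \<A> = k" "\<Union>\<A> \<subseteq> U" "\<And>V. V \<in> \<A> \<Longrightarrow> \<gamma> \<inter> V \<noteq> {}"
    by (auto simp: hit_def)
  then have "\<forall>V\<in>\<A>. \<exists>x. x \<in> \<gamma> \<inter> V" by blast
  then obtain x where x: "\<And>V. V \<in> \<A> \<Longrightarrow> x V \<in> \<gamma> \<inter> V" by metis
  have "inj_on x \<A>"
  proof (rule inj_onI, rule ccontr)
    fix V W assume VW: "V \<in> \<A>" "W \<in> \<A>" "x V = x W" "V \<noteq> W"
    then have "V \<inter> W = {}" using \<A>(2) by (auto simp: disjoint_def)
    then show False using x[of V] x[of W] VW by auto
  qed
  then have "k = card (x ` \<A>)" using \<A> by (simp add: card_image)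
  also have "\<dots> \<le> card (\<gamma> \<inter> U)"
  proof (intro card_mono assms(3) image_subsetI)
    show "x V \<in> \<gamma> \<inter> U" if "V \<in> \<A>" for V using x[OF that] \<A>(4) that by auto
  qed
  finally show "k \<le> card (\<gamma> \<inter> U)" .
qed

lemma measurable_card:
  assumes U: "open U" "\<And>\<gamma>. \<gamma> \<in> configs \<Longrightarrow> finite (\<gamma> \<inter> (U :: 'a set))"
  shows "(\<lambda>\<gamma>. card (\<gamma> \<inter> U)) \<in> measurable config_borel (count_space UNIV)"
proof -
  have ge[measurable]: "Measurable.pred config_borel (\<lambda>\<gamma>. k \<le> card (\<gamma> \<inter> U))" for k
  proof -
    let ?I = "{\<A>. finite \<A> \<and> \<A> \<subseteq> (base :: 'a set set) \<and> disjoint \<A> \<and> card \<A> = k \<and> \<Union>\<A> \<subseteq> U}"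
    have "?I \<subseteq> {\<A>. finite \<A> \<and> \<A> \<subseteq> (base :: 'a set set)}" by auto
    then have [simp]: "countable ?I"
      using countable_Collect_finite_subset[OF countable_base] countable_subset by blast
    have [measurable]: "hit V \<in> sets config_borel" if "\<A> \<in> ?I" "V \<in> \<A>" for \<A> and V :: "'a set"
      using that by (intro hit_measurable open_base) auto
    have "Measurable.pred config_borel (\<lambda>\<gamma>. \<forall>V\<in>\<A>. \<gamma> \<in> hit V)" if "\<A> \<in> ?I" for \<A>
      using that by (intro pred_intros_finite) measurable
    then have "Measurable.pred config_borel (\<lambda>\<gamma>. \<exists>\<A>\<in>?I. \<forall>V\<in>\<A>. \<gamma> \<in> hit V)"
      unfolding pred_def using \<open>countable ?I\<close> by (intro sets.sets_Collect_countable_Ex')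
    moreover have "k \<le> card (\<gamma> \<inter> U) \<longleftrightarrow> (\<exists>\<A>\<in>?I. \<forall>V\<in>\<A>. \<gamma> \<in> hit V)" if "\<gamma> \<in> space config_borel" for \<gamma>
      using that U by (intro card_ge_iff_hit) auto
    ultimately show ?thesis by (subst measurable_cong)
  qed
  show ?thesis
  proof (rule measurable_count_space_eq2_countable[THEN iffD2], intro conjI ballI)
    fix k :: nat
    have "(\<lambda>\<gamma>. card (\<gamma> \<inter> U)) -` {k} \<inter> space config_borel =
       {\<gamma> \<in> space config_borel. k \<le> card (\<gamma> \<inter> U) \<and> \<not> Suc k \<le> card (\<gamma> \<inter> U)}" by auto
    also have "\<dots> \<in> sets config_borel" by measurable
    finally show "(\<lambda>\<gamma>. card (\<gamma> \<inter> U)) -` {k} \<inter> space config_borel \<in> sets config_borel" .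
  qed auto
qed

text \<open>The normalisation makes this a subprobability kernel, so that the Giry monad applies.\<close>

definition window_kernel :: "'a set \<Rightarrow> 'a set \<Rightarrow> 'a measure" where
  "window_kernel U \<gamma> = scale_measure (1 / (1 + of_nat (card (\<gamma> \<inter> U)))) (distr (count_space (\<gamma> \<inter> U)) borel (\<lambda>x. x))"

lemma emeasure_window_kernel:
  assumes "finite (\<gamma> \<inter> U)" "B \<in> sets borel"
  shows "emeasure (window_kernel U \<gamma>) B = ennreal (card (\<gamma> \<inter> U \<inter> B) / (1 + card (\<gamma> \<inter> U)))"
proof -
  have "emeasure (distr (count_space (\<gamma> \<inter> U)) borel (\<lambda>x. x)) B = of_nat (card (\<gamma> \<inter> U \<inter> B))"
  proof -
    have "emeasure (count_space (\<gamma> \<inter> U)) (\<gamma> \<inter> U \<inter> B) = of_nat (card (\<gamma> \<inter> U \<inter> B))"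
      using assms by (intro emeasure_count_space_finite) auto
    then show ?thesis using assms by (simp add: emeasure_distr Int_commute[of B])
  qed
  moreover have "1 / (1 + of_nat (card (\<gamma> \<inter> U))) = ennreal (1 / (1 + real (card (\<gamma> \<inter> U))))"
    using divide_ennreal[of 1 "1 + real (card (\<gamma> \<inter> U))"]
    by (simp add: ennreal_of_nat_eq_real_of_nat add_pos_nonneg)
  ultimately show ?thesis unfolding window_kernel_def
    by (simp add: ennreal_of_nat_eq_real_of_nat ennreal_mult'[symmetric])
qed

text \<open>Open sets form an intersection-stable generator, and the mass of an open set is a
  quotient of two point counts in open windows, which are measurable.\<close>

lemma window_kernel_measurable:
  assumes U: "open U" "\<And>\<gamma>. \<gamma> \<in> configs \<Longrightarrow> finite (\<gamma> \<inter> (U :: 'a set))"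
  shows "window_kernel U \<in> measurable config_borel (subprob_algebra borel)"
proof (rule measurable_subprob_algebra_generated[where G="{S. open S}" and \<Omega>=UNIV])
  show "sets borel = sigma_sets UNIV {S::'a set. open S}" by (simp add: borel_def)
  show "Int_stable {S::'a set. open S}" by (auto simp: Int_stable_def)
  fix \<gamma> :: "'a set" assume "\<gamma> \<in> space config_borel"
  then have "finite (\<gamma> \<inter> U)" using U by auto
  then show "subprob_space (window_kernel U \<gamma>)"
    by (intro subprob_spaceI) (auto simp: emeasure_window_kernel space_scale_measure window_kernel_def[of U \<gamma>, THEN arg_cong[of _ _ space]])
  show "sets (window_kernel U \<gamma>) = sets borel" by (simp add: window_kernel_def)
next
  have em: "(\<lambda>\<gamma>. emeasure (window_kernel U \<gamma>) A) \<in> borel_measurable config_borel" if "open A" for A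
  proof -
    have [measurable]: "(\<lambda>\<gamma>. card (\<gamma> \<inter> (U \<inter> A))) \<in> measurable config_borel (count_space UNIV)"
      "(\<lambda>\<gamma>. card (\<gamma> \<inter> U)) \<in> measurable config_borel (count_space UNIV)"
      using U that by (auto intro!: measurable_card finite_subset[of "_ \<inter> (U \<inter> A)" "_ \<inter> U"])
    have "(\<lambda>\<gamma>. ennreal (card (\<gamma> \<inter> (U \<inter> A)) / (1 + card (\<gamma> \<inter> U)))) \<in> borel_measurable config_borel"
      by measurable
    moreover have "emeasure (window_kernel U \<gamma>) A = ennreal (card (\<gamma> \<inter> (U \<inter> A)) / (1 + card (\<gamma> \<inter> U)))"
      if "\<gamma> \<in> space config_borel" for \<gamma>
      using that U \<open>open A\<close> by (simp add: emeasure_window_kernel Int_assoc)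
    ultimately show ?thesis by (subst measurable_cong)
  qed
  then show "\<And>A. A \<in> {S. open S} \<Longrightarrow> (\<lambda>\<gamma>. emeasure (window_kernel U \<gamma>) A) \<in> borel_measurable config_borel"
    by auto
  show "(\<lambda>\<gamma>. emeasure (window_kernel U \<gamma>) UNIV) \<in> borel_measurable config_borel"
    using em by auto
qed auto

text \<open>A configuration may have infinite total mass, so the integral is written as a supremum
  over the exhausting windows. In each window it is a measurable count times an integral against the
  normalised kernel.\<close>

lemma nn_integral_config_measurable[measurable (raw)]:
  fixes f :: "'b \<Rightarrow> 'a \<Rightarrow> ennreal"
  assumes f: "(\<lambda>(w, x). f w x) \<in> borel_measurable (M \<Otimes>\<^sub>M borel)"
    and h[measurable]: "h \<in> measurable M config_borel"
  shows "(\<lambda>w. \<integral>\<^sup>+x. f w x \<partial>config_measure (h w)) \<in> borel_measurable M"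
proof -
  obtain U :: "nat \<Rightarrow> 'a set" where U: "\<And>n. open (U n)" "\<And>n. \<exists>K. compact K \<and> U n \<subseteq> K"
    "incseq U" "(\<Union>n. U n) = UNIV"
    using exhaustion by metis
  have fin: "finite (\<gamma> \<inter> U n)" if "\<gamma> \<in> configs" for \<gamma> n
  proof -
    obtain K where "compact K" "U n \<subseteq> K" using U(2) by blast
    then show ?thesis using that configs_finite_Int by blast
  qed
  have [measurable]: "U n \<in> sets borel" for n using U(1) by auto
  have "(\<integral>\<^sup>+x. f w x \<partial>config_measure (h w)) =
      (SUP n. (1 + of_nat (card (h w \<inter> U n))) * (\<integral>\<^sup>+x. f w x \<partial>window_kernel (U n) (h w)))" if w: "w \<in> space M" for w
  proof -
    have [measurable]: "(\<lambda>x. f w x) \<in> borel_measurable borel"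
      using measurable_compose[OF measurable_Pair1'[OF w] f] by simp
    have window: "(\<integral>\<^sup>+x. f w x * indicator (U n) x \<partial>config_measure (h w)) =
      (1 + of_nat (card (h w \<inter> U n))) * (\<integral>\<^sup>+x. f w x \<partial>window_kernel (U n) (h w))" for n
    proof -
      have "(\<integral>\<^sup>+x. f w x * indicator (U n) x \<partial>config_measure (h w)) = (\<integral>\<^sup>+x. f w x * indicator (U n) x \<partial>count_space (h w))"
        by (intro nn_integral_config) auto
      also have "\<dots> = (\<integral>\<^sup>+x. f w x \<partial>count_space (h w \<inter> U n))"
        by (subst (1 2) nn_integral_count_space_indicator) (auto intro!: nn_integral_cong simp: indicator_def)
      also have "\<dots> = (\<integral>\<^sup>+x. f w x \<partial>distr (count_space (h w \<inter> U n)) borel (\<lambda>x. x))"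
        by (subst nn_integral_distr) auto
      finally have 1: "(\<integral>\<^sup>+x. f w x * indicator (U n) x \<partial>config_measure (h w)) = \<dots>" .
      let ?c = "1 + of_nat (card (h w \<inter> U n)) :: ennreal"
      \<comment> \<open>The normalising factor is nonzero and finite, so it cancels in the extended
        nonnegative numbers.\<close>
      have "?c \<noteq> 0" "?c \<noteq> \<top>" by (auto simp: ennreal_of_nat_eq_real_of_nat)
      then have "?c / ?c = 1" by (intro ennreal_divide_self) (simp_all add: less_top ennreal_of_nat_eq_real_of_nat)
      then have "?c * (1 / ?c) = 1" by (simp add: ennreal_times_divide)
      then show ?thesis unfolding 1 window_kernel_def
        by (subst nn_integral_scale_measure) (auto simp: mult.assoc[symmetric])
    qed
    have "(\<integral>\<^sup>+x. f w x \<partial>config_measure (h w)) = (\<integral>\<^sup>+x. (SUP n. f w x * indicator (U n) x) \<partial>config_measure (h w))"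
    proof (intro nn_integral_cong)
      fix x
      have "x \<in> (\<Union>n. U n)" using U by auto
      then obtain n where "x \<in> U n" by auto
      then show "f w x = (SUP n. f w x * indicator (U n) x)"
        by (intro antisym SUP_upper2[of n] SUP_least) (auto simp: indicator_def)
    qed
    also have "\<dots> = (SUP n. (\<integral>\<^sup>+x. f w x * indicator (U n) x \<partial>config_measure (h w)))"
      using U(3) by (intro nn_integral_monotone_convergence_SUP)
        (auto simp: incseq_def le_fun_def indicator_def)
    also have "\<dots> = (SUP n. (1 + of_nat (card (h w \<inter> U n))) * (\<integral>\<^sup>+x. f w x \<partial>window_kernel (U n) (h w)))"
      by (simp only: window)
    finally show ?thesis .
  qed
  moreover have "(\<lambda>w. SUP n. (1 + of_nat (card (h w \<inter> U n))) * (\<integral>\<^sup>+x. f w x \<partial>window_kernel (U n) (h w))) \<in> borel_measurable M"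
  proof -
    have [measurable]: "(\<lambda>w. card (h w \<inter> U n)) \<in> measurable M (count_space UNIV)" for n
      using measurable_compose[OF h measurable_card[OF U(1) fin]] by simp
    have [measurable]: "(\<lambda>w. \<integral>\<^sup>+x. f w x \<partial>window_kernel (U n) (h w)) \<in> borel_measurable M" for n
      using measurable_compose[OF h window_kernel_measurable[OF U(1) fin]]
      by (intro nn_integral_measurable_subprob_algebra2[OF f]) simp
    show ?thesis by measurable
  qed
  ultimately show ?thesis by (subst measurable_cong) auto
qed

end

section \<open>Consequences of the Gibbs identity\<close>

locale kawasaki = bump_space m
  for m :: "'a::{t2_space, second_countable_topology} measure" +
  fixes E :: "'a \<Rightarrow> 'a set \<Rightarrow> ereal"
    and z :: real
    and \<mu> :: "'a set measure"
    and c :: "'a \<Rightarrow> 'a \<Rightarrow> 'a set \<Rightarrow> real"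
  assumes sets_m[measurable_cong]: "sets m = sets borel"
    and sf_m: "sigma_finite_measure m"
    and null_point: "\<And>x. emeasure m {x} = 0"
    and E_measurable: "(\<lambda>(x, \<gamma>). E x \<gamma>) \<in> borel_measurable (borel \<Otimes>\<^sub>M config_borel)"
    and z_pos: "z > 0"
    and prob_\<mu>: "prob_space \<mu>"
    and sets_\<mu>[measurable_cong]: "sets \<mu> = sets config_borel"
    and gibbs: "gibbs_identity m z E \<mu>"
    and E_finite: "AE (x, \<gamma>) in m \<Otimes>\<^sub>M \<mu>. \<bar>E x \<gamma>\<bar> \<noteq> \<infinity>"
    and c_measurable: "(\<lambda>(x, y, \<gamma>). c x y \<gamma>) \<in> borel_measurable (borel \<Otimes>\<^sub>M borel \<Otimes>\<^sub>M config_borel)"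
    and c_nonneg: "\<And>x y \<gamma>. \<gamma> \<in> configs \<Longrightarrow> 0 \<le> c x y \<gamma>"
begin

sublocale m: sigma_finite_measure m by (rule sf_m)
sublocale \<mu>: prob_space \<mu> by (rule prob_\<mu>)
sublocale mm: pair_sigma_finite m m ..

lemma space_m[simp]: "space m = UNIV" and space_\<mu>[simp]: "space \<mu> = configs"
  using sets_eq_imp_space_eq[OF sets_m] sets_eq_imp_space_eq[OF sets_\<mu>] by simp_all

lemma triple_measurableD:
  assumes "(\<lambda>(x, y, \<gamma>). K x y \<gamma>) \<in> measurable (borel \<Otimes>\<^sub>M borel \<Otimes>\<^sub>M config_borel) N"
    and "a \<in> borel_measurable M" "b \<in> borel_measurable M" "h \<in> measurable M config_borel"
  shows "(\<lambda>w. K (a w :: 'a) (b w :: 'a) (h w)) \<in> measurable M N"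
  using measurable_compose[OF measurable_Pair[OF assms(2) measurable_Pair[OF assms(3,4)]] assms(1)] by simp

lemma E_measurable'[measurable (raw)]:
  assumes "a \<in> borel_measurable M" "h \<in> measurable M config_borel"
  shows "(\<lambda>w. E (a w) (h w)) \<in> borel_measurable M"
  using measurable_compose[OF measurable_Pair[OF assms] E_measurable] by simp

lemmas c_measurable'[measurable (raw)] = triple_measurableD[OF c_measurable]

lemma exp_neg_measurable[measurable]: "exp_neg \<in> borel_measurable borel"
  unfolding exp_neg_def[abs_def] by measurable

section \<open>Boltzmann weights and Campbell integrals\<close>

abbreviation w :: "'a \<Rightarrow> 'a set \<Rightarrow> ennreal" where
  "w x \<gamma> \<equiv> exp_neg (E x \<gamma>)"

text \<open>The factor in \<open>csym\<close>. With \<eta> = \<gamma> \<setminus> x it will turn out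
  to be the quotient of \<open>w y \<eta>\<close> by \<open>w x \<eta>\<close> almost everywhere,
  that is, the density of the reversed move.\<close>

abbreviation rho :: "'a \<Rightarrow> 'a \<Rightarrow> 'a set \<Rightarrow> real" where
  "rho x y \<gamma> \<equiv> exp (- real_of_ereal (E y \<gamma>) + real_of_ereal (E x (move x y \<gamma>)))"

definition inner_integral :: "('a \<Rightarrow> 'a \<Rightarrow> 'a set \<Rightarrow> ennreal) \<Rightarrow> 'a set \<Rightarrow> ennreal" where
  "inner_integral K \<gamma> = (\<integral>\<^sup>+x. (\<integral>\<^sup>+y. K x y \<gamma> \<partial>m) \<partial>config_measure \<gamma>)"

definition campbell :: "('a \<Rightarrow> 'a \<Rightarrow> 'a set \<Rightarrow> ennreal) \<Rightarrow> ennreal" where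
  "campbell K = (\<integral>\<^sup>+\<gamma>. inner_integral K \<gamma> \<partial>\<mu>)"

text \<open>What remains of a Campbell integral once the Gibbs identity has detached x from the
  configuration: both points are then integrated against \<open>m\<close>, and Fubini can exchange
  them.\<close>

definition reduced :: "('a \<Rightarrow> 'a \<Rightarrow> 'a set \<Rightarrow> ennreal) \<Rightarrow> ennreal" where
  "reduced K = (\<integral>\<^sup>+\<gamma>. (\<integral>\<^sup>+x. (\<integral>\<^sup>+y. K x y \<gamma> \<partial>m) \<partial>m) \<partial>\<mu>)"

lemma AE_not_in: "\<gamma> \<in> configs \<Longrightarrow> AE x in m. x \<notin> \<gamma>"
proof -
  assume \<gamma>: "\<gamma> \<in> configs"
  have "AE x in m. x \<noteq> y" for y :: 'a
    by (rule AE_I[of _ _ "{y}"]) (auto simp: null_point sets_m)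
  then have "AE x in m. \<forall>y\<in>\<gamma>. x \<noteq> y" using configs_countable[OF \<gamma>] by (subst AE_ball_countable) auto
  then show ?thesis by (rule AE_mp) auto
qed

lemma AE_config: "\<gamma> \<in> configs \<Longrightarrow> AE x in config_measure \<gamma>. x \<in> (\<gamma> :: 'a set)"
  unfolding config_measure_def using borel_closed[OF configs_closed, of \<gamma>]
  by (subst AE_distr_iff) auto

text \<open>Configurations are closed, hence carry their own measure, and they are countable, hence
  null for \<open>m\<close>. So only moves from an occupied to an empty site count, and these are
  the ones that \<open>move\<close> can undo.\<close>

lemma inner_integral_cong:
  assumes "\<gamma> \<in> configs" "\<And>x y. x \<in> \<gamma> \<Longrightarrow> y \<notin> \<gamma> \<Longrightarrow> K x y \<gamma> = L x y \<gamma>"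
  shows "inner_integral K \<gamma> = inner_integral L \<gamma>"
  unfolding inner_integral_def
  using AE_config[OF assms(1)]
proof (intro nn_integral_cong_AE, eventually_elim)
  fix x assume "x \<in> \<gamma>"
  then show "(\<integral>\<^sup>+y. K x y \<gamma> \<partial>m) = (\<integral>\<^sup>+y. L x y \<gamma> \<partial>m)"
    using AE_not_in[OF assms(1)] assms(2) by (intro nn_integral_cong_AE) (auto elim!: eventually_mono)
qed

lemma campbell_cong:
  assumes "\<And>x y \<gamma>. \<gamma> \<in> configs \<Longrightarrow> x \<in> \<gamma> \<Longrightarrow> y \<notin> \<gamma> \<Longrightarrow> K x y \<gamma> = L x y \<gamma>"
  shows "campbell K = campbell L"
  unfolding campbell_def using assms by (intro nn_integral_cong inner_integral_cong) auto

lemma inner_integral_measurable: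
  assumes K: "(\<lambda>(x, y, \<gamma>). K x y \<gamma>) \<in> borel_measurable (borel \<Otimes>\<^sub>M borel \<Otimes>\<^sub>M config_borel)"
  shows "inner_integral K \<in> borel_measurable config_borel"
proof -
  note [measurable (raw)] = triple_measurableD[OF K]
  show ?thesis unfolding inner_integral_def by measurable
qed

lemma gibbs':
  assumes [measurable]: "(\<lambda>(x, \<gamma>). F x \<gamma>) \<in> borel_measurable (borel \<Otimes>\<^sub>M config_borel)"
  shows "(\<integral>\<^sup>+\<gamma>. (\<integral>\<^sup>+x. F x \<gamma> \<partial>config_measure \<gamma>) \<partial>\<mu>) =
     ennreal z * (\<integral>\<^sup>+\<gamma>. (\<integral>\<^sup>+x. w x \<gamma> * F x (insert x \<gamma>) \<partial>m) \<partial>\<mu>)"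
proof -
  have [measurable (raw)]: "(\<lambda>u. F (a u) (h u)) \<in> borel_measurable M"
    if "a \<in> borel_measurable M" "h \<in> measurable M config_borel" for a h and M :: "'c measure"
    using measurable_compose[OF measurable_Pair[OF that] assms] by simp
  have "(\<integral>\<^sup>+\<gamma>. (\<integral>\<^sup>+x. F x \<gamma> \<partial>config_measure \<gamma>) \<partial>\<mu>) =
     (\<integral>\<^sup>+\<gamma>. (\<integral>\<^sup>+x. ennreal z * w x \<gamma> * F x (insert x \<gamma>) \<partial>m) \<partial>\<mu>)"
    using gibbs[unfolded gibbs_identity_def, rule_format, of "\<lambda>(x, \<gamma>). F x \<gamma>"] by simp
  also have "\<dots> = (\<integral>\<^sup>+\<gamma>. ennreal z * (\<integral>\<^sup>+x. w x \<gamma> * F x (insert x \<gamma>) \<partial>m) \<partial>\<mu>)"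
    by (intro nn_integral_cong, subst nn_integral_cmult[symmetric]) (simp_all add: mult.assoc)
  also have "\<dots> = ennreal z * (\<integral>\<^sup>+\<gamma>. (\<integral>\<^sup>+x. w x \<gamma> * F x (insert x \<gamma>) \<partial>m) \<partial>\<mu>)"
    by (intro nn_integral_cmult) measurable
  finally show ?thesis .
qed

lemma campbell_reduced:
  assumes K: "(\<lambda>(x, y, \<gamma>). K x y \<gamma>) \<in> borel_measurable (borel \<Otimes>\<^sub>M borel \<Otimes>\<^sub>M config_borel)"
  shows "campbell K = ennreal z * reduced (\<lambda>x y \<gamma>. w x \<gamma> * K x y (insert x \<gamma>))"
proof -
  note [measurable (raw)] = triple_measurableD[OF K]
  have "campbell K = ennreal z * (\<integral>\<^sup>+\<gamma>. (\<integral>\<^sup>+x. w x \<gamma> * (\<integral>\<^sup>+y. K x y (insert x \<gamma>) \<partial>m) \<partial>m) \<partial>\<mu>)"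
    unfolding campbell_def inner_integral_def by (rule gibbs') measurable
  also have "\<dots> = ennreal z * reduced (\<lambda>x y \<gamma>. w x \<gamma> * K x y (insert x \<gamma>))"
    unfolding reduced_def
  proof (intro arg_cong[where f="(*) _"] nn_integral_cong)
    fix x \<gamma> assume "\<gamma> \<in> space \<mu>"
    then have "insert x \<gamma> \<in> space config_borel" by (simp add: configs_insert)
    then have "(\<lambda>y. K x y (insert x \<gamma>)) \<in> borel_measurable m" by measurable
    then show "w x \<gamma> * (\<integral>\<^sup>+y. K x y (insert x \<gamma>) \<partial>m) = (\<integral>\<^sup>+y. w x \<gamma> * K x y (insert x \<gamma>) \<partial>m)"
      by (rule nn_integral_cmult[symmetric])
  qed
  finally show ?thesis .
qed

lemma reduced_swap:
  assumes K: "(\<lambda>(x, y, \<gamma>). K x y \<gamma>) \<in> borel_measurable (borel \<Otimes>\<^sub>M borel \<Otimes>\<^sub>M config_borel)"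
  shows "reduced K = reduced (\<lambda>x y \<gamma>. K y x \<gamma>)"
  unfolding reduced_def
proof (rule nn_integral_cong)
  note [measurable (raw)] = triple_measurableD[OF K]
  fix \<gamma> assume [measurable]: "\<gamma> \<in> space \<mu>"
  then have [measurable]: "\<gamma> \<in> space config_borel" by simp
  show "(\<integral>\<^sup>+x. (\<integral>\<^sup>+y. K x y \<gamma> \<partial>m) \<partial>m) = (\<integral>\<^sup>+x. (\<integral>\<^sup>+y. K y x \<gamma> \<partial>m) \<partial>m)"
    by (rule mm.Fubini'[symmetric]) measurable
qed

lemma reduced_cong_AE:
  assumes "AE \<gamma> in \<mu>. AE x in m. AE y in m. K x y \<gamma> = L x y \<gamma>"
  shows "reduced K = reduced L"
  unfolding reduced_def
  by (intro nn_integral_cong_AE eventually_mono[OF assms] eventually_mono[OF _ nn_integral_cong_AE])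

section \<open>Finiteness of energies and the cocycle identity\<close>

lemma AE_energy_finite: "AE \<gamma> in \<mu>. AE x in m. \<bar>E x \<gamma>\<bar> \<noteq> \<infinity>"
proof -
  interpret m\<mu>: pair_sigma_finite m \<mu> ..
  have "AE x in m. AE \<gamma> in \<mu>. \<bar>E x \<gamma>\<bar> \<noteq> \<infinity>"
    using m\<mu>.AE_pair[OF E_finite] by simp
  then show ?thesis by (rule m\<mu>.AE_commute[THEN iffD1, rotated]) measurable
qed

lemma w_pos: "\<bar>E x \<gamma>\<bar> \<noteq> \<infinity> \<Longrightarrow> w x \<gamma> = ennreal (exp (- real_of_ereal (E x \<gamma>)))"
  by (auto simp: exp_neg_def)

text \<open>The event that E(y, \<gamma>) is infinite has Campbell integral zero. The Gibbs identity
  turns this into a vanishing integral of the same event at \<gamma> \<union> x with weight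
  \<open>w x \<gamma>\<close>, which is positive wherever E(x, \<gamma>) is finite.\<close>

lemma AE_energy_insert_finite: "AE \<gamma> in \<mu>. AE x in m. AE y in m. \<bar>E y (insert x \<gamma>)\<bar> \<noteq> \<infinity>"
proof -
  let ?K = "\<lambda>x y \<gamma>. indicator {\<infinity>, -\<infinity>} (E y \<gamma>) :: ennreal"
  have [measurable]: "{\<infinity>, -\<infinity> :: ereal} \<in> sets borel" by (auto intro: borel_closed)
  have "AE \<gamma> in \<mu>. inner_integral ?K \<gamma> = 0"
    using AE_energy_finite
  proof eventually_elim
    fix \<gamma> assume "AE x in m. \<bar>E x \<gamma>\<bar> \<noteq> \<infinity>"
    then have "(\<integral>\<^sup>+y. ?K x y \<gamma> \<partial>m) = (\<integral>\<^sup>+y. 0 \<partial>m)" for x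
      by (intro nn_integral_cong_AE) (auto elim!: eventually_mono)
    then show "inner_integral ?K \<gamma> = 0" unfolding inner_integral_def by simp
  qed
  then have "campbell ?K = (\<integral>\<^sup>+\<gamma>. 0 \<partial>\<mu>)" unfolding campbell_def by (rule nn_integral_cong_AE)
  then have "ennreal z * reduced (\<lambda>x y \<gamma>. w x \<gamma> * ?K x y (insert x \<gamma>)) = 0"
    by (subst campbell_reduced[symmetric]) simp_all
  then have "(\<integral>\<^sup>+\<gamma>. (\<integral>\<^sup>+x. (\<integral>\<^sup>+y. w x \<gamma> * ?K x y (insert x \<gamma>) \<partial>m) \<partial>m) \<partial>\<mu>) = 0"
    using z_pos by (simp add: reduced_def)
  then have "AE \<gamma> in \<mu>. (\<integral>\<^sup>+x. (\<integral>\<^sup>+y. w x \<gamma> * ?K x y (insert x \<gamma>) \<partial>m) \<partial>m) = 0"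
    by (subst (asm) nn_integral_0_iff_AE) measurable
  then show ?thesis using AE_energy_finite AE_space
  proof eventually_elim
    fix \<gamma> assume 0: "(\<integral>\<^sup>+x. (\<integral>\<^sup>+y. w x \<gamma> * ?K x y (insert x \<gamma>) \<partial>m) \<partial>m) = 0"
      and fin: "AE x in m. \<bar>E x \<gamma>\<bar> \<noteq> \<infinity>" and "\<gamma> \<in> space \<mu>"
    then have [measurable]: "\<gamma> \<in> space config_borel" by simp
    have "AE x in m. (\<integral>\<^sup>+y. w x \<gamma> * ?K x y (insert x \<gamma>) \<partial>m) = 0"
      using 0 by (subst (asm) nn_integral_0_iff_AE) measurable
    then show "AE x in m. AE y in m. \<bar>E y (insert x \<gamma>)\<bar> \<noteq> \<infinity>"
      using fin
    proof eventually_elim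
      fix x assume 0: "(\<integral>\<^sup>+y. w x \<gamma> * ?K x y (insert x \<gamma>) \<partial>m) = 0" and fin: "\<bar>E x \<gamma>\<bar> \<noteq> \<infinity>"
      have "AE y in m. w x \<gamma> * ?K x y (insert x \<gamma>) = 0"
        using 0 by (subst (asm) nn_integral_0_iff_AE) measurable
      then show "AE y in m. \<bar>E y (insert x \<gamma>)\<bar> \<noteq> \<infinity>"
      proof eventually_elim
        fix y assume "w x \<gamma> * ?K x y (insert x \<gamma>) = 0"
        then have "E y (insert x \<gamma>) \<notin> {\<infinity>, -\<infinity>}" using w_pos[OF fin] by (auto simp: indicator_def)
        then show "\<bar>E y (insert x \<gamma>)\<bar> \<noteq> \<infinity>" by auto
      qed
    qed
  qed
qed

lemma AE_commute_m:
  assumes "AE \<gamma> in \<mu>. AE x in m. AE y in m. P x y \<gamma>"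
    and "Measurable.pred (borel \<Otimes>\<^sub>M borel \<Otimes>\<^sub>M config_borel) (\<lambda>(x, y, \<gamma>). P x y \<gamma>)"
  shows "AE \<gamma> in \<mu>. AE y in m. AE x in m. P x y \<gamma>"
  using assms(1) AE_space
proof eventually_elim
  note [measurable (raw)] = triple_measurableD[OF assms(2)]
  fix \<gamma> assume "AE x in m. AE y in m. P x y \<gamma>" "\<gamma> \<in> space \<mu>"
  then have [measurable]: "\<gamma> \<in> space config_borel" by simp
  show "AE y in m. AE x in m. P x y \<gamma>"
    using \<open>AE x in m. AE y in m. P x y \<gamma>\<close> by (rule mm.AE_commute[THEN iffD1, rotated]) measurable
qed

text \<open>Twice the Gibbs identity, read in both orders of the two points.\<close>

lemma reduced_pair_swap:
  assumes f: "(\<lambda>(x, y, \<gamma>). f x y \<gamma>) \<in> borel_measurable (borel \<Otimes>\<^sub>M borel \<Otimes>\<^sub>M config_borel)"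
  shows "reduced (\<lambda>x y \<gamma>. w y \<gamma> * w x (insert y \<gamma>) * f x y \<gamma>) =
    reduced (\<lambda>x y \<gamma>. w x \<gamma> * w y (insert x \<gamma>) * f x y \<gamma>)"
proof -
  \<comment> \<open>The sum over ordered pairs of distinct points of \<gamma>, with both points
    deleted from the configuration. It does not change when the arguments of \<open>f\<close> are
    exchanged, while peeling off x and then y yields the weights in one definite order.\<close>
  define T where "T f = (\<integral>\<^sup>+\<gamma>. (\<integral>\<^sup>+x. (\<integral>\<^sup>+y. of_bool (x \<noteq> y) * f x y (\<gamma> - {x} - {y})
      \<partial>config_measure \<gamma>) \<partial>config_measure \<gamma>) \<partial>\<mu>)" for f :: "'a \<Rightarrow> 'a \<Rightarrow> 'a set \<Rightarrow> ennreal"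
  have T: "T f = ennreal z * (ennreal z * reduced (\<lambda>x y \<gamma>. w y \<gamma> * w x (insert y \<gamma>) * f x y \<gamma>))"
    if f: "(\<lambda>(x, y, \<gamma>). f x y \<gamma>) \<in> borel_measurable (borel \<Otimes>\<^sub>M borel \<Otimes>\<^sub>M config_borel)"
    for f :: "'a \<Rightarrow> 'a \<Rightarrow> 'a set \<Rightarrow> ennreal"
  proof -
    note [measurable (raw)] = triple_measurableD[OF f]
    have "T f = ennreal z * (\<integral>\<^sup>+\<gamma>. (\<integral>\<^sup>+x. w x \<gamma> * (\<integral>\<^sup>+y. of_bool (x \<noteq> y) * f x y (insert x \<gamma> - {x} - {y})
        \<partial>config_measure (insert x \<gamma>)) \<partial>m) \<partial>\<mu>)"
      unfolding T_def by (rule gibbs') measurable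
    also have "(\<integral>\<^sup>+\<gamma>. (\<integral>\<^sup>+x. w x \<gamma> * (\<integral>\<^sup>+y. of_bool (x \<noteq> y) * f x y (insert x \<gamma> - {x} - {y})
        \<partial>config_measure (insert x \<gamma>)) \<partial>m) \<partial>\<mu>) =
       (\<integral>\<^sup>+\<gamma>. (\<integral>\<^sup>+x. (\<integral>\<^sup>+y. w x \<gamma> * f x y (\<gamma> - {y}) \<partial>config_measure \<gamma>) \<partial>m) \<partial>\<mu>)"
    proof (rule nn_integral_cong)
      fix \<gamma> assume \<gamma>: "\<gamma> \<in> space \<mu>"
      then have [measurable]: "\<gamma> \<in> space config_borel" by simp
      show "(\<integral>\<^sup>+x. w x \<gamma> * (\<integral>\<^sup>+y. of_bool (x \<noteq> y) * f x y (insert x \<gamma> - {x} - {y})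
          \<partial>config_measure (insert x \<gamma>)) \<partial>m) = (\<integral>\<^sup>+x. (\<integral>\<^sup>+y. w x \<gamma> * f x y (\<gamma> - {y}) \<partial>config_measure \<gamma>) \<partial>m)"
      proof (rule nn_integral_cong_AE)
        have "AE x in m. x \<notin> \<gamma>" using AE_not_in \<gamma> by simp
        then show "AE x in m. w x \<gamma> * (\<integral>\<^sup>+y. of_bool (x \<noteq> y) * f x y (insert x \<gamma> - {x} - {y})
          \<partial>config_measure (insert x \<gamma>)) = (\<integral>\<^sup>+y. w x \<gamma> * f x y (\<gamma> - {y}) \<partial>config_measure \<gamma>)"
        proof eventually_elim
          fix x assume x: "x \<notin> \<gamma>"
          have [measurable]: "insert x \<gamma> \<in> space config_borel" using \<gamma> configs_insert by simp
          have "(\<integral>\<^sup>+y. of_bool (x \<noteq> y) * f x y (insert x \<gamma> - {x} - {y}) \<partial>config_measure (insert x \<gamma>)) =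
              (\<integral>\<^sup>+y. of_bool (x \<noteq> y) * f x y (insert x \<gamma> - {x} - {y}) \<partial>count_space (insert x \<gamma>))"
            by (rule nn_integral_config) measurable
          \<comment> \<open>Inserting x adds the single term y = x, which \<open>of_bool\<close>
            removes; in the other terms x \<notin> \<gamma> makes deleting x restore
            \<gamma>.\<close>
          also have "\<dots> = (\<integral>\<^sup>+y. f x y (\<gamma> - {y}) \<partial>count_space \<gamma>)"
            using x by (subst (1 2) nn_integral_count_space_indicator)
              (auto intro!: nn_integral_cong simp: indicator_def)
          also have "\<dots> = (\<integral>\<^sup>+y. f x y (\<gamma> - {y}) \<partial>config_measure \<gamma>)"
            by (rule nn_integral_config[symmetric]) measurable
          finally have eq: "(\<integral>\<^sup>+y. of_bool (x \<noteq> y) * f x y (insert x \<gamma> - {x} - {y}) \<partial>config_measure (insert x \<gamma>)) =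
            (\<integral>\<^sup>+y. f x y (\<gamma> - {y}) \<partial>config_measure \<gamma>)" .
          have "(\<lambda>y. f x y (\<gamma> - {y})) \<in> borel_measurable (config_measure \<gamma>)" by measurable
          then show "w x \<gamma> * (\<integral>\<^sup>+y. of_bool (x \<noteq> y) * f x y (insert x \<gamma> - {x} - {y})
            \<partial>config_measure (insert x \<gamma>)) = (\<integral>\<^sup>+y. w x \<gamma> * f x y (\<gamma> - {y}) \<partial>config_measure \<gamma>)"
            unfolding eq by (rule nn_integral_cmult[symmetric])
        qed
      qed
    qed
    also have "\<dots> = (\<integral>\<^sup>+\<gamma>. (\<integral>\<^sup>+y. (\<integral>\<^sup>+x. w x \<gamma> * f x y (\<gamma> - {y}) \<partial>m) \<partial>config_measure \<gamma>) \<partial>\<mu>)"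
    proof (rule nn_integral_cong)
      fix \<gamma> assume \<gamma>: "\<gamma> \<in> space \<mu>"
      then have [measurable]: "\<gamma> \<in> space config_borel" by simp
      interpret \<gamma>: sigma_finite_measure "config_measure \<gamma>" using \<gamma> by (intro sigma_finite_config) simp
      interpret \<gamma>m: pair_sigma_finite "config_measure \<gamma>" m ..
      show "(\<integral>\<^sup>+x. (\<integral>\<^sup>+y. w x \<gamma> * f x y (\<gamma> - {y}) \<partial>config_measure \<gamma>) \<partial>m) =
        (\<integral>\<^sup>+y. (\<integral>\<^sup>+x. w x \<gamma> * f x y (\<gamma> - {y}) \<partial>m) \<partial>config_measure \<gamma>)"
        by (rule \<gamma>m.Fubini') measurable
    qed
    also have "\<dots> = ennreal z * (\<integral>\<^sup>+\<gamma>. (\<integral>\<^sup>+y. w y \<gamma> * (\<integral>\<^sup>+x. w x (insert y \<gamma>) * f x y (insert y \<gamma> - {y}) \<partial>m) \<partial>m) \<partial>\<mu>)"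
      by (rule gibbs') measurable
    also have "(\<integral>\<^sup>+\<gamma>. (\<integral>\<^sup>+y. w y \<gamma> * (\<integral>\<^sup>+x. w x (insert y \<gamma>) * f x y (insert y \<gamma> - {y}) \<partial>m) \<partial>m) \<partial>\<mu>) =
      reduced (\<lambda>y x \<gamma>. w y \<gamma> * w x (insert y \<gamma>) * f x y \<gamma>)"
      unfolding reduced_def
    proof (rule nn_integral_cong, rule nn_integral_cong_AE)
      fix \<gamma> assume \<gamma>: "\<gamma> \<in> space \<mu>"
      then have [measurable]: "\<gamma> \<in> space config_borel" by simp
      have "AE y in m. y \<notin> \<gamma>" using AE_not_in \<gamma> by simp
      then show "AE y in m. w y \<gamma> * (\<integral>\<^sup>+x. w x (insert y \<gamma>) * f x y (insert y \<gamma> - {y}) \<partial>m) =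
         (\<integral>\<^sup>+x. w y \<gamma> * w x (insert y \<gamma>) * f x y \<gamma> \<partial>m)"
      proof eventually_elim
        fix y assume y: "y \<notin> \<gamma>"
        have [measurable]: "insert y \<gamma> \<in> space config_borel" using \<gamma> configs_insert by simp
        have "(\<lambda>x. w x (insert y \<gamma>) * f x y \<gamma>) \<in> borel_measurable m" by measurable
        then show "w y \<gamma> * (\<integral>\<^sup>+x. w x (insert y \<gamma>) * f x y (insert y \<gamma> - {y}) \<partial>m) =
         (\<integral>\<^sup>+x. w y \<gamma> * w x (insert y \<gamma>) * f x y \<gamma> \<partial>m)"
          using y by (simp add: nn_integral_cmult[symmetric] mult.assoc)
      qed
    qed
    also have "\<dots> = reduced (\<lambda>x y \<gamma>. w y \<gamma> * w x (insert y \<gamma>) * f x y \<gamma>)"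
      by (rule reduced_swap) measurable
    finally show ?thesis .
  qed
  note [measurable (raw)] = triple_measurableD[OF f]
  have "T f = T (\<lambda>x y \<gamma>. f y x \<gamma>)"
    unfolding T_def
  proof (rule nn_integral_cong)
    fix \<gamma> assume \<gamma>: "\<gamma> \<in> space \<mu>"
    then have [measurable]: "\<gamma> \<in> space config_borel" by simp
    interpret \<gamma>: sigma_finite_measure "config_measure \<gamma>" using \<gamma> by (intro sigma_finite_config) simp
    interpret \<gamma>\<gamma>: pair_sigma_finite "config_measure \<gamma>" "config_measure \<gamma>" ..
    have "(\<integral>\<^sup>+x. (\<integral>\<^sup>+y. of_bool (x \<noteq> y) * f x y (\<gamma> - {x} - {y}) \<partial>config_measure \<gamma>) \<partial>config_measure \<gamma>) =
      (\<integral>\<^sup>+y. (\<integral>\<^sup>+x. of_bool (x \<noteq> y) * f x y (\<gamma> - {x} - {y}) \<partial>config_measure \<gamma>) \<partial>config_measure \<gamma>)"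
      by (rule \<gamma>\<gamma>.Fubini'[symmetric]) measurable
    also have "\<dots> = (\<integral>\<^sup>+x. (\<integral>\<^sup>+y. of_bool (x \<noteq> y) * f y x (\<gamma> - {x} - {y}) \<partial>config_measure \<gamma>) \<partial>config_measure \<gamma>)"
      by (simp add: eq_commute Diff_insert2[symmetric] insert_commute)
    finally show "(\<integral>\<^sup>+x. (\<integral>\<^sup>+y. of_bool (x \<noteq> y) * f x y (\<gamma> - {x} - {y}) \<partial>config_measure \<gamma>) \<partial>config_measure \<gamma>) =
      (\<integral>\<^sup>+x. (\<integral>\<^sup>+y. of_bool (x \<noteq> y) * f y x (\<gamma> - {x} - {y}) \<partial>config_measure \<gamma>) \<partial>config_measure \<gamma>)" .
  qed
  then have "ennreal z * (ennreal z * reduced (\<lambda>x y \<gamma>. w y \<gamma> * w x (insert y \<gamma>) * f x y \<gamma>)) =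
    ennreal z * (ennreal z * reduced (\<lambda>x y \<gamma>. w y \<gamma> * w x (insert y \<gamma>) * f y x \<gamma>))"
    by (subst (asm) (1 2) T) measurable
  then have "reduced (\<lambda>x y \<gamma>. w y \<gamma> * w x (insert y \<gamma>) * f x y \<gamma>) =
    reduced (\<lambda>x y \<gamma>. w y \<gamma> * w x (insert y \<gamma>) * f y x \<gamma>)"
    using z_pos by (simp add: ennreal_mult_cancel_left)
  also have "\<dots> = reduced (\<lambda>x y \<gamma>. w x \<gamma> * w y (insert x \<gamma>) * f x y \<gamma>)"
    by (rule reduced_swap) measurable
  finally show ?thesis .
qed

text \<open>Testing the exchanged weights with indicators of all measurable sets shows that they
  define the same measure. Since \<mu> \<otimes> m \<otimes> m is \<sigma>-finite, the densities
  agree almost everywhere.\<close>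

lemma cocycle:
  "AE \<gamma> in \<mu>. AE x in m. AE y in m. w y \<gamma> * w x (insert y \<gamma>) = w x \<gamma> * w y (insert x \<gamma>)"
proof -
  interpret \<mu>mm: pair_sigma_finite \<mu> "m \<Otimes>\<^sub>M m" ..
  let ?P = "\<mu> \<Otimes>\<^sub>M (m \<Otimes>\<^sub>M m)"
  let ?\<Phi> = "\<lambda>(\<gamma>, x, y). w y \<gamma> * w x (insert y \<gamma>)" and ?\<Psi> = "\<lambda>(\<gamma>, x, y). w x \<gamma> * w y (insert x \<gamma>)"
  have red: "reduced K = (\<integral>\<^sup>+p. (case p of (\<gamma>, x, y) \<Rightarrow> K x y \<gamma>) \<partial>?P)"
    if K: "(\<lambda>(x, y, \<gamma>). K x y \<gamma>) \<in> borel_measurable (borel \<Otimes>\<^sub>M borel \<Otimes>\<^sub>M config_borel)" for K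
  proof -
    note [measurable (raw)] = triple_measurableD[OF K]
    have "(\<integral>\<^sup>+p. (case p of (\<gamma>, x, y) \<Rightarrow> K x y \<gamma>) \<partial>?P) =
      (\<integral>\<^sup>+\<gamma>. (\<integral>\<^sup>+q. (case q of (x, y) \<Rightarrow> K x y \<gamma>) \<partial>(m \<Otimes>\<^sub>M m)) \<partial>\<mu>)"
      by (subst mm.nn_integral_fst[symmetric]) simp_all
    also have "\<dots> = reduced K"
      unfolding reduced_def
    proof (rule nn_integral_cong)
      fix \<gamma> assume "\<gamma> \<in> space \<mu>"
      then have [measurable]: "\<gamma> \<in> space config_borel" by simp
      have "(\<lambda>q. case q of (x, y) \<Rightarrow> K x y \<gamma>) \<in> borel_measurable (m \<Otimes>\<^sub>M m)" by measurable
      from m.nn_integral_fst[OF this]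
      show "(\<integral>\<^sup>+q. (case q of (x, y) \<Rightarrow> K x y \<gamma>) \<partial>(m \<Otimes>\<^sub>M m)) = (\<integral>\<^sup>+x. (\<integral>\<^sup>+y. K x y \<gamma> \<partial>m) \<partial>m)" by simp
    qed
    finally show ?thesis ..
  qed
  have "density ?P ?\<Phi> = density ?P ?\<Psi>"
  proof (rule measure_eqI)
    fix A assume A: "A \<in> sets (density ?P ?\<Phi>)"
    then have [measurable]: "A \<in> sets (config_borel \<Otimes>\<^sub>M (borel \<Otimes>\<^sub>M borel))"
      by (simp cong: sets_pair_measure_cong add: sets_m sets_\<mu>)
    have A': "A \<in> sets ?P" using A by simp
    let ?f = "\<lambda>x y \<gamma>. indicator A (\<gamma>, x, y) :: ennreal"
    have "emeasure (density ?P ?\<Phi>) A = (\<integral>\<^sup>+p. (case p of (\<gamma>, x, y) \<Rightarrow> w y \<gamma> * w x (insert y \<gamma>) * ?f x y \<gamma>) \<partial>?P)"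
      using A' by (subst emeasure_density) (auto intro!: nn_integral_cong)
    also have "\<dots> = reduced (\<lambda>x y \<gamma>. w y \<gamma> * w x (insert y \<gamma>) * ?f x y \<gamma>)"
      by (rule red[symmetric]) measurable
    also have "\<dots> = reduced (\<lambda>x y \<gamma>. w x \<gamma> * w y (insert x \<gamma>) * ?f x y \<gamma>)"
      by (rule reduced_pair_swap) measurable
    also have "\<dots> = (\<integral>\<^sup>+p. (case p of (\<gamma>, x, y) \<Rightarrow> w x \<gamma> * w y (insert x \<gamma>) * ?f x y \<gamma>) \<partial>?P)"
      by (rule red) measurable
    also have "\<dots> = emeasure (density ?P ?\<Psi>) A"
      using A' by (subst emeasure_density) (auto intro!: nn_integral_cong)
    finally show "emeasure (density ?P ?\<Phi>) A = emeasure (density ?P ?\<Psi>) A" .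
  qed simp
  then have "AE p in ?P. ?\<Phi> p = ?\<Psi> p"
    by (intro \<mu>mm.density_unique) measurable
  then have "AE \<gamma> in \<mu>. AE q in m \<Otimes>\<^sub>M m. ?\<Phi> (\<gamma>, q) = ?\<Psi> (\<gamma>, q)"
    by (rule \<mu>mm.AE_pair)
  then show ?thesis
  proof eventually_elim
    fix \<gamma> assume "AE q in m \<Otimes>\<^sub>M m. ?\<Phi> (\<gamma>, q) = ?\<Psi> (\<gamma>, q)"
    from mm.AE_pair[OF this] show "AE x in m. AE y in m. w y \<gamma> * w x (insert y \<gamma>) = w x \<gamma> * w y (insert x \<gamma>)"
      by simp
  qed
qed

text \<open>Almost everywhere the four energies in the cocycle identity are finite, so it may be
  rewritten as an equation between real exponents. The condition x \<notin> \<gamma> is recorded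
  because it identifies \<open>move x y (insert x \<gamma>)\<close> with
  \<open>insert y \<gamma>\<close>.\<close>

lemma AE_rho:
  "AE \<gamma> in \<mu>. AE x in m. AE y in m. x \<notin> \<gamma> \<and> w x \<gamma> * ennreal (rho x y (insert x \<gamma>)) = w y \<gamma>"
proof -
  have swapped: "AE \<gamma> in \<mu>. AE x in m. AE y in m. \<bar>E x (insert y \<gamma>)\<bar> \<noteq> \<infinity>"
    by (rule AE_commute_m[OF AE_energy_insert_finite]) measurable
  show ?thesis
    using cocycle AE_energy_finite AE_energy_insert_finite swapped AE_space
  proof eventually_elim
    fix \<gamma> assume coc: "AE x in m. AE y in m. w y \<gamma> * w x (insert y \<gamma>) = w x \<gamma> * w y (insert x \<gamma>)"
      and fin: "AE x in m. \<bar>E x \<gamma>\<bar> \<noteq> \<infinity>"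
      and ins: "AE x in m. AE y in m. \<bar>E y (insert x \<gamma>)\<bar> \<noteq> \<infinity>"
      and ins': "AE x in m. AE y in m. \<bar>E x (insert y \<gamma>)\<bar> \<noteq> \<infinity>"
      and "\<gamma> \<in> space \<mu>"
    then have "AE x in m. x \<notin> \<gamma>" by (intro AE_not_in) simp
    with coc fin ins ins' show "AE x in m. AE y in m. x \<notin> \<gamma> \<and> w x \<gamma> * ennreal (rho x y (insert x \<gamma>)) = w y \<gamma>"
    proof eventually_elim
      fix x assume coc: "AE y in m. w y \<gamma> * w x (insert y \<gamma>) = w x \<gamma> * w y (insert x \<gamma>)"
        and ins: "AE y in m. \<bar>E y (insert x \<gamma>)\<bar> \<noteq> \<infinity>"
        and ins': "AE y in m. \<bar>E x (insert y \<gamma>)\<bar> \<noteq> \<infinity>"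
        and x: "\<bar>E x \<gamma>\<bar> \<noteq> \<infinity>" "x \<notin> \<gamma>"
      show "AE y in m. x \<notin> \<gamma> \<and> w x \<gamma> * ennreal (rho x y (insert x \<gamma>)) = w y \<gamma>"
        using coc ins ins' fin
      proof eventually_elim
        fix y assume y: "w y \<gamma> * w x (insert y \<gamma>) = w x \<gamma> * w y (insert x \<gamma>)"
          "\<bar>E y (insert x \<gamma>)\<bar> \<noteq> \<infinity>" "\<bar>E x (insert y \<gamma>)\<bar> \<noteq> \<infinity>" "\<bar>E y \<gamma>\<bar> \<noteq> \<infinity>"
        have mv: "move x y (insert x \<gamma>) = insert y \<gamma>" using x by (auto simp: move_def)
        have "exp (- real_of_ereal (E y \<gamma>) - real_of_ereal (E x (insert y \<gamma>))) =
          exp (- real_of_ereal (E x \<gamma>) - real_of_ereal (E y (insert x \<gamma>)))"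
          using y x by (simp add: w_pos ennreal_mult'[symmetric] exp_add[symmetric] del: exp_inj_iff)
        then have "- real_of_ereal (E y \<gamma>) = - real_of_ereal (E x \<gamma>) + (- real_of_ereal (E y (insert x \<gamma>)) + real_of_ereal (E x (insert y \<gamma>)))"
          by simp
        then show "x \<notin> \<gamma> \<and> w x \<gamma> * ennreal (rho x y (insert x \<gamma>)) = w y \<gamma>"
          using x y by (simp add: mv w_pos ennreal_mult'[symmetric] exp_add[symmetric])
      qed
    qed
  qed
qed

text \<open>Detailed balance for the measure \<open>\<gamma>(dx) m(dy) \<mu>(d\<gamma>)\<close>.\<close>

lemma campbell_reversal:
  assumes L: "(\<lambda>(x, y, \<gamma>). L x y \<gamma>) \<in> borel_measurable (borel \<Otimes>\<^sub>M borel \<Otimes>\<^sub>M config_borel)"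
  shows "campbell (\<lambda>x y \<gamma>. ennreal (rho x y \<gamma>) * L y x (move x y \<gamma>)) = campbell L"
proof -
  note [measurable (raw)] = triple_measurableD[OF L]
  have "campbell (\<lambda>x y \<gamma>. ennreal (rho x y \<gamma>) * L y x (move x y \<gamma>)) =
    ennreal z * reduced (\<lambda>x y \<gamma>. w x \<gamma> * (ennreal (rho x y (insert x \<gamma>)) * L y x (move x y (insert x \<gamma>))))"
    by (rule campbell_reduced) measurable
  also have "reduced (\<lambda>x y \<gamma>. w x \<gamma> * (ennreal (rho x y (insert x \<gamma>)) * L y x (move x y (insert x \<gamma>)))) =
    reduced (\<lambda>x y \<gamma>. w y \<gamma> * L y x (insert y \<gamma>))"
  proof (rule reduced_cong_AE)
    show "AE \<gamma> in \<mu>. AE x in m. AE y in m. w x \<gamma> * (ennreal (rho x y (insert x \<gamma>)) * L y x (move x y (insert x \<gamma>))) =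
      w y \<gamma> * L y x (insert y \<gamma>)"
      using AE_rho
      by (elim eventually_mono) (auto simp: mult.assoc[symmetric] move_def)
  qed
  also have "\<dots> = reduced (\<lambda>x y \<gamma>. w x \<gamma> * L x y (insert x \<gamma>))"
    by (rule reduced_swap) measurable
  also have "ennreal z * \<dots> = campbell L"
    by (rule campbell_reduced[OF L, symmetric])
  finally show ?thesis .
qed

end

section \<open>Closures of forms given by operators\<close>

text \<open>Covers both the inner product on square integrable functions and the Kawasaki form.
  Functions are not identified almost everywhere and no definiteness is assumed, so
  \<open>B f f = 0\<close> need not force \<open>f\<close> to vanish.\<close>

locale semi_inner =
  fixes V :: "('b \<Rightarrow> real) set" and B :: "('b \<Rightarrow> real) \<Rightarrow> ('b \<Rightarrow> real) \<Rightarrow> real"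
  assumes lin: "f \<in> V \<Longrightarrow> g \<in> V \<Longrightarrow> (\<lambda>w. a * f w + b * g w) \<in> V"
    and nonneg: "f \<in> V \<Longrightarrow> 0 \<le> B f f"
    and sym: "f \<in> V \<Longrightarrow> g \<in> V \<Longrightarrow> B f g = B g f"
    and linear: "f \<in> V \<Longrightarrow> g \<in> V \<Longrightarrow> h \<in> V \<Longrightarrow> B f (\<lambda>w. a * g w + b * h w) = a * B f g + b * B f h"
begin

lemma diff_mem: "f \<in> V \<Longrightarrow> g \<in> V \<Longrightarrow> (\<lambda>w. f w - g w) \<in> V"
  using lin[of f g 1 "-1"] by simp

lemma diff_right: "f \<in> V \<Longrightarrow> g \<in> V \<Longrightarrow> h \<in> V \<Longrightarrow> B f (\<lambda>w. g w - h w) = B f g - B f h"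
  using linear[of f g h 1 "-1"] by simp

text \<open>The factor \<open>1 *\<close> keeps the exact shape in which \<open>lin\<close> and
  \<open>linear\<close> produce linear combinations.\<close>

lemma quadratic:
  assumes "f \<in> V" "g \<in> V"
  shows "B (\<lambda>w. 1 * f w + t * g w) (\<lambda>w. 1 * f w + t * g w) = B f f + 2 * t * B f g + t\<^sup>2 * B g g"
proof -
  let ?h = "\<lambda>w. 1 * f w + t * g w"
  have h: "?h \<in> V" using lin[OF assms] .
  have "B ?h ?h = B f ?h + t * B g ?h"
    using linear[OF h assms, of 1 t] sym[OF h assms(1)] sym[OF h assms(2)] by simp
  also have "\<dots> = B f f + 2 * t * B f g + t\<^sup>2 * B g g"
    using linear[OF assms(1) assms, of 1 t] linear[OF assms(2) assms, of 1 t] sym[OF assms]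
    by (simp add: algebra_simps power2_eq_square)
  finally show ?thesis .
qed

lemma cauchy_schwarz:
  assumes "f \<in> V" "g \<in> V" shows "\<bar>B f g\<bar> \<le> sqrt (B f f) * sqrt (B g g)"
proof -
  have q: "0 \<le> B f f + 2 * t * B f g + t\<^sup>2 * B g g" for t
    using nonneg[OF lin[OF assms, of 1 t]] quadratic[OF assms] by simp
  have "(B f g)\<^sup>2 \<le> B f f * B g g"
  proof (cases "B g g = 0")
    case True
    have "B f g = 0"
    proof (rule ccontr)
      assume "B f g \<noteq> 0"
      \<comment> \<open>If \<open>B g g = 0\<close>, the polynomial is affine in t, and this t gives
        it the value -1.\<close>
      then show False using q[of "- (B f f + 1) / (2 * B f g)"] True by (simp add: field_simps)
    qed
    then show ?thesis using True by simp
  next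
    case False
    then have pos: "B g g > 0" using nonneg[OF assms(2)] by simp
    \<comment> \<open>The chosen t minimises the quadratic polynomial; multiplying by
      \<open>B g g\<close> clears the denominator.\<close>
    have "0 \<le> (B f f + 2 * (- B f g / B g g) * B f g + (- B f g / B g g)\<^sup>2 * B g g) * B g g"
      using q[of "- B f g / B g g"] pos by (intro mult_nonneg_nonneg) auto
    also have "\<dots> = B f f * B g g - (B f g)\<^sup>2"
      using pos by (simp add: field_simps power2_eq_square)
    finally show ?thesis by simp
  qed
  then show ?thesis by (metis real_sqrt_abs real_sqrt_le_mono real_sqrt_mult)
qed

lemma triangle:
  assumes "f \<in> V" "g \<in> V"
  shows "sqrt (B (\<lambda>w. f w + g w) (\<lambda>w. f w + g w)) \<le> sqrt (B f f) + sqrt (B g g)"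
proof (rule real_le_lsqrt)
  show "0 \<le> sqrt (B f f) + sqrt (B g g)" using nonneg assms by auto
  have "B (\<lambda>w. f w + g w) (\<lambda>w. f w + g w) = B f f + 2 * B f g + B g g"
    using quadratic[OF assms, of 1] by simp
  also have "\<dots> \<le> (sqrt (B f f) + sqrt (B g g))\<^sup>2"
    using cauchy_schwarz[OF assms] nonneg assms by (simp add: power2_sum)
  finally show "B (\<lambda>w. f w + g w) (\<lambda>w. f w + g w) \<le> (sqrt (B f f) + sqrt (B g g))\<^sup>2" .
qed

end

section \<open>Square integrable functions\<close>

lemma L2_integrable_mult:
  assumes "f \<in> L2 M" "g \<in> L2 M" shows "integrable M (\<lambda>w. f w * g w :: real)"
proof (rule Bochner_Integration.integrable_bound)
  show "integrable M (\<lambda>w. (f w)\<^sup>2 + (g w)\<^sup>2)" using assms by (simp add: L2_def)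
  show "(\<lambda>w. f w * g w) \<in> borel_measurable M" using assms by (auto simp: L2_def)
  have "\<bar>a * b\<bar> \<le> a\<^sup>2 + b\<^sup>2" for a b :: real
    using sum_squares_bound[of "\<bar>a\<bar>" "\<bar>b\<bar>"] mult_nonneg_nonneg[of "\<bar>a\<bar>" "\<bar>b\<bar>"]
    unfolding abs_mult power2_abs by linarith
  then show "AE w in M. norm (f w * g w) \<le> norm ((f w)\<^sup>2 + (g w)\<^sup>2)" by simp
qed

lemma L2_lin:
  assumes "f \<in> L2 M" "g \<in> L2 M" shows "(\<lambda>w. a * f w + b * g w) \<in> L2 M"
proof -
  have "integrable M (\<lambda>w. a\<^sup>2 * (f w)\<^sup>2 + b\<^sup>2 * (g w)\<^sup>2 + 2 * a * b * (f w * g w))"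
    using assms L2_integrable_mult[OF assms] by (simp add: L2_def)
  then have "integrable M (\<lambda>w. (a * f w + b * g w)\<^sup>2)"
    by (rule Bochner_Integration.integrable_cong[THEN iffD1, OF refl, rotated]) (simp add: power2_eq_square algebra_simps)
  then show ?thesis using assms by (auto simp: L2_def)
qed

interpretation L2: semi_inner "L2 M" "L2_inner M" for M
proof
  fix f g h :: "'a \<Rightarrow> real" and a b :: real
  assume "f \<in> L2 M" "g \<in> L2 M" "h \<in> L2 M"
  then show "L2_inner M f (\<lambda>w. a * g w + b * h w) = a * L2_inner M f g + b * L2_inner M f h"
    using L2_integrable_mult[of f M g] L2_integrable_mult[of f M h]
    by (simp add: L2_inner_def algebra_simps)
qed (auto simp: L2_lin L2_inner_def mult.commute)

lemma L2_dist_eq: "L2_dist M f g = sqrt (L2_inner M (\<lambda>w. f w - g w) (\<lambda>w. f w - g w))"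
  by (simp add: L2_dist_def L2_inner_def power2_eq_square)

lemma L2_inner_tendsto:
  assumes "\<And>n. s n \<in> L2 M" "f \<in> L2 M" "h \<in> L2 M" "(\<lambda>n. L2_dist M (s n) f) \<longlonglongrightarrow> 0"
  shows "(\<lambda>n. L2_inner M h (s n)) \<longlonglongrightarrow> L2_inner M h f"
proof -
  have "(\<lambda>n. L2_inner M h (s n) - L2_inner M h f) \<longlonglongrightarrow> 0"
  proof (rule Lim_null_comparison)
    show "\<forall>\<^sub>F n in sequentially. norm (L2_inner M h (s n) - L2_inner M h f) \<le> sqrt (L2_inner M h h) * L2_dist M (s n) f"
      using L2.cauchy_schwarz[OF assms(3) L2.diff_mem[OF assms(1,2)]] L2.diff_right[OF assms(3,1,2)]
      by (simp add: L2_dist_eq)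
    show "(\<lambda>n. sqrt (L2_inner M h h) * L2_dist M (s n) f) \<longlonglongrightarrow> 0"
      using tendsto_mult_left[OF assms(4)] by simp
  qed
  then show ?thesis by (simp add: LIM_zero_cancel)
qed

text \<open>Elements of the form domain are by definition limits of elements of \<open>D\<close> in
  mean square, so density passes from \<open>D'\<close> to \<open>D\<close>. The intended
  \<open>D'\<close> is the domain of a self-adjoint generator.\<close>

lemma L2_dense_form_core:
  assumes "L2_dense M D'" "D' \<subseteq> closure_domain M D q" "D \<subseteq> L2 M"
  shows "L2_dense M D"
  unfolding L2_dense_def
proof (intro ballI allI impI)
  fix f and e :: real assume f: "f \<in> L2 M" and e: "e > 0"
  then obtain g where g: "g \<in> D'" "L2_dist M f g < e / 2"
    using assms(1) unfolding L2_dense_def by (metis half_gt_zero)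
  then obtain s where "form_approx M D q s g" using assms(2) by (auto simp: closure_domain_def)
  then have s: "\<And>n. s n \<in> D" "g \<in> L2 M" "(\<lambda>n. L2_dist M (s n) g) \<longlonglongrightarrow> 0" by (auto simp: form_approx_def)
  have "\<forall>\<^sub>F n in sequentially. L2_dist M (s n) g < e / 2"
    using order_tendstoD(2)[OF s(3), of "e / 2"] e by simp
  then obtain n where n: "L2_dist M (s n) g < e / 2" by (meson eventually_sequentially order_refl)
  have "L2_dist M g (s n) = L2_dist M (s n) g" by (simp add: L2_dist_def power2_commute)
  moreover have "L2_dist M f (s n) \<le> L2_dist M f g + L2_dist M g (s n)"
    using L2.triangle[OF L2.diff_mem[OF f s(2)] L2.diff_mem[OF s(2)], of "s n"] s(1) assms(3)
    by (auto simp: L2_dist_eq)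
  ultimately show "\<exists>g\<in>D. L2_dist M f g < e" using g n s(1) by (intro bexI[of _ "s n"]) auto
qed

section \<open>Closability and the generator of the closure\<close>

text \<open>Form and operator are separate data because the form is given by the original
  coefficient and the operator by the symmetrised one; \<open>q_eq\<close> links them on the
  core.\<close>

locale operator_form = semi_inner D q
  for D :: "('b \<Rightarrow> real) set" and q +
  fixes M :: "'b measure" and A :: "('b \<Rightarrow> real) \<Rightarrow> 'b \<Rightarrow> real"
  assumes D_L2: "D \<subseteq> L2 M" and A_L2: "\<And>f. f \<in> D \<Longrightarrow> A f \<in> L2 M"
    and q_eq: "\<And>f g. f \<in> D \<Longrightarrow> g \<in> D \<Longrightarrow> q f g = L2_inner M (A f) g"
begin

text \<open>Symmetry lets the operator act on the fixed argument, and (A g, f) is continuous in f.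
  So convergence in mean square suffices, without control of \<open>q\<close> along the
  sequence.\<close>

lemma q_tendsto:
  assumes "\<And>n. s n \<in> D" "f \<in> L2 M" "(\<lambda>n. L2_dist M (s n) f) \<longlonglongrightarrow> 0" "g \<in> D"
  shows "(\<lambda>n. q (s n) g) \<longlonglongrightarrow> L2_inner M f (A g)"
proof -
  have "L2_inner M (A g) (s n) = q (s n) g" for n
    using assms(1,4) by (simp add: q_eq[symmetric] sym)
  then show ?thesis
    using L2_inner_tendsto[of s M f "A g"] assms D_L2 A_L2
    by (simp add: L2.sym[OF assms(2)] subset_iff)
qed

lemma cauchy_bounded:
  assumes "\<And>n. s n \<in> D" "\<forall>e>0. \<exists>N. \<forall>i\<ge>N. \<forall>j\<ge>N. q (\<lambda>w. s i w - s j w) (\<lambda>w. s i w - s j w) < e"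
  obtains C where "C > 0" "\<forall>\<^sub>F n in sequentially. sqrt (q (s n) (s n)) \<le> C"
proof -
  obtain N where N: "\<And>i. i \<ge> N \<Longrightarrow> q (\<lambda>w. s i w - s N w) (\<lambda>w. s i w - s N w) < 1"
    using assms(2) by (metis order_refl zero_less_one)
  have "sqrt (q (s n) (s n)) \<le> 1 + sqrt (q (s N) (s N))" if "n \<ge> N" for n
  proof -
    have "sqrt (q (s n) (s n)) \<le> sqrt (q (\<lambda>w. s n w - s N w) (\<lambda>w. s n w - s N w)) + sqrt (q (s N) (s N))"
      using triangle[OF diff_mem[OF assms(1,1)] assms(1), of n N N] by simp
    also have "sqrt (q (\<lambda>w. s n w - s N w) (\<lambda>w. s n w - s N w)) \<le> 1"
      using N[OF that] by simp
    finally show ?thesis by simp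
  qed
  then have "\<forall>\<^sub>F n in sequentially. sqrt (q (s n) (s n)) \<le> 1 + sqrt (q (s N) (s N))"
    by (auto simp: eventually_sequentially)
  moreover have "1 + sqrt (q (s N) (s N)) > 0" using nonneg[OF assms(1)] by (smt (verit) real_sqrt_ge_zero)
  ultimately show thesis using that by blast
qed

text \<open>Split q(s n, s n) as q(s n, s n - s N) + q(s n, s N). By Cauchy-Schwarz the first term
  is small for large N, uniformly in n \<ge> N; for fixed N the second tends to 0 by
  \<open>q_tendsto\<close> with limit 0.\<close>

lemma closable:
  assumes s: "\<And>n. s n \<in> D" "(\<lambda>n. L2_dist M (s n) (\<lambda>_. 0)) \<longlonglongrightarrow> 0"
    and cauchy: "\<forall>e>0. \<exists>N. \<forall>i\<ge>N. \<forall>j\<ge>N. q (\<lambda>w. s i w - s j w) (\<lambda>w. s i w - s j w) < e"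
  shows "(\<lambda>n. sqrt (q (s n) (s n))) \<longlonglongrightarrow> 0"
proof -
  obtain C where C: "C > 0" "\<forall>\<^sub>F n in sequentially. sqrt (q (s n) (s n)) \<le> C"
    using cauchy_bounded[OF s(1) cauchy] .
  have "(\<lambda>n. q (s n) (s n)) \<longlonglongrightarrow> 0"
  proof (rule tendstoI)
    fix e :: real assume e: "e > 0"
    \<comment> \<open>Chosen so that \<open>C * sqrt d\<close> is e/2, with \<open>C\<close> the
      eventual bound on the form norms.\<close>
    define d where "d = (e / (2 * C))\<^sup>2"
    have "d > 0" using e C by (simp add: d_def)
    then obtain N where N: "\<And>i j. i \<ge> N \<Longrightarrow> j \<ge> N \<Longrightarrow> q (\<lambda>w. s i w - s j w) (\<lambda>w. s i w - s j w) < d"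
      using cauchy by blast
    have "(\<lambda>_. 0) \<in> L2 M" by (simp add: L2_def)
    then have "(\<lambda>n. q (s n) (s N)) \<longlonglongrightarrow> 0"
      using q_tendsto[OF s(1) _ s(2) s(1), of N] by (simp add: L2_inner_def)
    then have "\<forall>\<^sub>F n in sequentially. q (s n) (s N) < e / 2"
      using e by (intro order_tendstoD) auto
    with C(2) eventually_ge_at_top[of N] show "\<forall>\<^sub>F n in sequentially. dist (q (s n) (s n)) 0 < e"
    proof eventually_elim
      fix n assume n: "sqrt (q (s n) (s n)) \<le> C" "N \<le> n" "q (s n) (s N) < e / 2"
      let ?h = "\<lambda>w. s n w - s N w"
      have "q (s n) (s n) = q (s n) ?h + q (s n) (s N)"
        using diff_right[OF s(1) s(1) s(1), of n n N] by simp
      also have "q (s n) ?h \<le> sqrt (q (s n) (s n)) * sqrt (q ?h ?h)"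
        using cauchy_schwarz[OF s(1) diff_mem[OF s(1) s(1)], of n n N] by simp
      also have "\<dots> \<le> C * sqrt d"
        using n C N[of n N] nonneg[OF diff_mem[OF s(1) s(1)], of n N] by (intro mult_mono) auto
      also have "\<dots> = e / 2" using C e by (simp add: d_def)
      finally show "dist (q (s n) (s n)) 0 < e" using n(3) nonneg[OF s(1), of n] by simp
    qed
  qed
  then show ?thesis using tendsto_real_sqrt by fastforce
qed

text \<open>With g in the core, write t n = g + u n. Then u n tends to 0 in mean square and is
  Cauchy for \<open>q\<close>, so closability makes its form norm vanish, and the bounded form norms
  of s n remove the cross term. What remains is q(s n, g).\<close>

lemma form_limit:
  assumes s: "form_approx M D q s f" and t: "form_approx M D q t g" and g: "g \<in> D"
  shows "(\<lambda>n. q (s n) (t n)) \<longlonglongrightarrow> L2_inner M f (A g)"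
proof -
  have s': "\<And>n. s n \<in> D" "f \<in> L2 M" "(\<lambda>n. L2_dist M (s n) f) \<longlonglongrightarrow> 0"
    "\<forall>e>0. \<exists>N. \<forall>i\<ge>N. \<forall>j\<ge>N. q (\<lambda>w. s i w - s j w) (\<lambda>w. s i w - s j w) < e"
    using s by (auto simp: form_approx_def)
  have t': "\<And>n. t n \<in> D" "(\<lambda>n. L2_dist M (t n) g) \<longlonglongrightarrow> 0"
    "\<forall>e>0. \<exists>N. \<forall>i\<ge>N. \<forall>j\<ge>N. q (\<lambda>w. t i w - t j w) (\<lambda>w. t i w - t j w) < e"
    using t by (auto simp: form_approx_def)
  define u where "u n = (\<lambda>w. t n w - g w)" for n
  have u: "u n \<in> D" for n unfolding u_def using diff_mem[OF t'(1) g] .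
  have "(\<lambda>n. sqrt (q (u n) (u n))) \<longlonglongrightarrow> 0"
  proof (rule closable[OF u])
    show "(\<lambda>n. L2_dist M (u n) (\<lambda>_. 0)) \<longlonglongrightarrow> 0" using t'(2) by (simp add: u_def L2_dist_def)
    show "\<forall>e>0. \<exists>N. \<forall>i\<ge>N. \<forall>j\<ge>N. q (\<lambda>w. u i w - u j w) (\<lambda>w. u i w - u j w) < e"
      using t'(3) by (simp add: u_def)
  qed
  moreover obtain C where C: "C > 0" "\<forall>\<^sub>F n in sequentially. sqrt (q (s n) (s n)) \<le> C"
    using cauchy_bounded[OF s'(1,4)] .
  ultimately have "(\<lambda>n. C * sqrt (q (u n) (u n))) \<longlonglongrightarrow> 0"
    using tendsto_mult_left by fastforce
  moreover have "\<forall>\<^sub>F n in sequentially. norm (q (s n) (u n)) \<le> C * sqrt (q (u n) (u n))"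
    using C(2)
  proof eventually_elim
    fix n assume "sqrt (q (s n) (s n)) \<le> C"
    then have "sqrt (q (s n) (s n)) * sqrt (q (u n) (u n)) \<le> C * sqrt (q (u n) (u n))"
      using nonneg[OF u] by (intro mult_right_mono) auto
    then show "norm (q (s n) (u n)) \<le> C * sqrt (q (u n) (u n))"
      using cauchy_schwarz[OF s'(1) u, of n n] by simp
  qed
  ultimately have "(\<lambda>n. q (s n) (u n)) \<longlonglongrightarrow> 0"
    by (rule Lim_null_comparison[rotated])
  from tendsto_add[OF this q_tendsto[OF s'(1-3) g]]
  show ?thesis using diff_right[OF s'(1) t'(1) g] by (simp add: u_def)
qed

lemma D_closure_domain: "D \<subseteq> closure_domain M D q"
proof
  fix g assume g: "g \<in> D"
  then have "q (\<lambda>_. 0) (\<lambda>_. 0) = 0" using diff_mem[OF g g] by (simp add: q_eq L2_inner_def)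
  then have "form_approx M D q (\<lambda>_. g) g"
    using g D_L2 by (auto simp: form_approx_def L2_dist_def)
  then show "g \<in> closure_domain M D q" by (auto simp: closure_domain_def)
qed

lemma closure_form_eq:
  assumes "f \<in> closure_domain M D q" "g \<in> D"
  shows "closure_form M D q f g = L2_inner M f (A g)"
proof -
  \<comment> \<open>Such sequences must exist for the description to be unique: otherwise every
    number would satisfy the condition under \<open>THE\<close> vacuously.\<close>
  obtain s t where st: "form_approx M D q s f" "form_approx M D q t g"
    using assms D_closure_domain by (auto simp: closure_domain_def)
  show ?thesis
    unfolding closure_form_def
  proof (rule the_equality)
    show "\<forall>s t. form_approx M D q s f \<longrightarrow> form_approx M D q t g \<longrightarrow> (\<lambda>n. q (s n) (t n)) \<longlonglongrightarrow> L2_inner M f (A g)"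
      using form_limit assms(2) by blast
    fix l assume "\<forall>s t. form_approx M D q s f \<longrightarrow> form_approx M D q t g \<longrightarrow> (\<lambda>n. q (s n) (t n)) \<longlonglongrightarrow> l"
    then have "(\<lambda>n. q (s n) (t n)) \<longlonglongrightarrow> l" using st by blast
    then show "l = L2_inner M f (A g)" using form_limit[OF st assms(2)] LIMSEQ_unique by blast
  qed
qed

text \<open>For f in the domain of \<open>H\<close>, both (H f, g) and (f, A g) are values of the
  closed form at (f, g). Hence (g, A g) lies in the graph of the adjoint of \<open>H\<close>, which
  is the graph of \<open>H\<close>.\<close>

lemma generator_extends:
  assumes gen: "generator_of_form M (closure_domain M D q) (closure_form M D q) DH H" and g: "g \<in> D"
  shows "g \<in> DH" "AE w in M. H g w = A g w"
proof -
  have sa: "self_adjoint_operator M DH H" using gen by (simp add: generator_of_form_def)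
  have "L2_inner M (H f) g = L2_inner M f (A g)" if "f \<in> DH" for f
  proof -
    have "closure_form M D q f g = L2_inner M (H f) g" "f \<in> closure_domain M D q"
      using gen that g D_closure_domain unfolding generator_of_form_def by blast+
    then show ?thesis using closure_form_eq g by simp
  qed
  then have "g \<in> DH \<and> (AE w in M. H g w = A g w)"
    using sa g D_L2 A_L2[OF g] unfolding self_adjoint_operator_def by blast
  then show "g \<in> DH" "AE w in M. H g w = A g w" by auto
qed

end

section \<open>The Friedrichs extension\<close>

lemma form_approx_cong:
  assumes "\<And>f g. f \<in> D \<Longrightarrow> g \<in> D \<Longrightarrow> (\<lambda>w. f w - g w) \<in> D"
    and "\<And>f g. f \<in> D \<Longrightarrow> g \<in> D \<Longrightarrow> q f g = q' f g"
  shows "form_approx M D q s f = form_approx M D q' s f"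
proof (cases "\<forall>n. s n \<in> D")
  case True
  then have "q (\<lambda>w. s i w - s j w) (\<lambda>w. s i w - s j w) = q' (\<lambda>w. s i w - s j w) (\<lambda>w. s i w - s j w)" for i j
    using assms by auto
  then show ?thesis by (simp add: form_approx_def)
qed (auto simp: form_approx_def)

text \<open>Approximating sequences and their differences stay in \<open>D\<close>, so the closure
  sees only the values of the form there. This matters because a form defined through an operator is
  meaningful only on the domain of that operator.\<close>

lemma closure_cong:
  assumes "\<And>f g. f \<in> D \<Longrightarrow> g \<in> D \<Longrightarrow> (\<lambda>w. f w - g w) \<in> D"
    and "\<And>f g. f \<in> D \<Longrightarrow> g \<in> D \<Longrightarrow> q f g = q' f g"
  shows "closure_domain M D q = closure_domain M D q'" "closure_form M D q = closure_form M D q'"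
proof -
  show "closure_domain M D q = closure_domain M D q'"
    unfolding closure_domain_def using form_approx_cong[of D q q'] assms by simp
  have "(\<lambda>n. q (s n) (t n)) = (\<lambda>n. q' (s n) (t n))"
    if "form_approx M D q' s f" "form_approx M D q' t g" for s t f g
    using that assms(2) by (auto simp: form_approx_def)
  then show "closure_form M D q = closure_form M D q'"
    unfolding closure_form_def[abs_def] using form_approx_cong[of D q q'] assms
    by (intro ext arg_cong[where f=The]) (auto cong: imp_cong)
qed

text \<open>The restriction of \<open>H\<close> to \<open>D\<close> agrees with \<open>A\<close> up
  to null sets, so (H f, g) is \<open>q\<close> on \<open>D\<close> and has the same closure;
  \<open>gen\<close> then already states that \<open>H\<close> generates it. What is left is that
  the restriction is densely defined, symmetric and non-negative.\<close>

lemma friedrichs_extension_of_generator: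
  assumes "operator_form D q M A"
    and gen: "generator_of_form M (closure_domain M D q) (closure_form M D q) DH H"
  shows "friedrichs_extension M D H DH H"
proof -
  interpret operator_form D q M A by fact
  have sa: "self_adjoint_operator M DH H" "nonneg_operator M DH H" "DH \<subseteq> closure_domain M D q"
    using gen by (auto simp: generator_of_form_def)
  have H_op: "L2_operator M DH H" "L2_dense M DH" using sa by (auto simp: self_adjoint_operator_def)
  note DH = generator_extends(1)[OF gen] and HA = generator_extends(2)[OF gen]
  have H_L2: "H f \<in> L2 M" if "f \<in> D" for f using H_op DH[OF that] by (auto simp: L2_operator_def)
  have inner: "L2_inner M (H f) g = q f g" if "f \<in> D" "g \<in> D" for f g
    unfolding q_eq[OF that] L2_inner_def
    using H_L2[OF that(1)] A_L2[OF that(1)] that D_L2 HA[OF that(1)]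
    by (intro integral_cong_AE) (auto simp: L2_def)
  have "L2_operator M D H"
    using H_op(1) DH D_L2 lin unfolding L2_operator_def by (auto simp: image_subset_iff)
  moreover have "L2_dense M D" using L2_dense_form_core[OF H_op(2) sa(3) D_L2] .
  moreover have "L2_inner M (H f) g = L2_inner M f (H g)" if "f \<in> D" "g \<in> D" for f g
    using inner[OF that] inner[OF that(2,1)] sym[OF that] L2.sym[of f M "H g"] H_L2 that D_L2 by auto
  ultimately have "symmetric_operator M D H" by (auto simp: symmetric_operator_def)
  moreover have "nonneg_operator M D H" using sa(2) DH by (auto simp: nonneg_operator_def)
  moreover have "closure_domain M D (\<lambda>f g. L2_inner M (H f) g) = closure_domain M D q"
    "closure_form M D (\<lambda>f g. L2_inner M (H f) g) = closure_form M D q"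
    by (rule closure_cong; simp add: diff_mem inner)+
  ultimately show ?thesis using gen by (simp add: friedrichs_extension_def)
qed

section \<open>Riemannian manifolds\<close>

context
  fixes \<A> :: "('a::{t2_space, second_countable_topology}, 'n::finite) chart set"
    and g :: "('a, 'n) chart \<Rightarrow> 'a \<Rightarrow> real^'n^'n"
    and m :: "'a measure"
  assumes atlas: "smooth_atlas \<A>"
begin

lemma chartE:
  obtains \<kappa> where "\<kappa> \<in> \<A>" "p \<in> fst \<kappa>" "open (fst \<kappa>)" "open (snd \<kappa> ` fst \<kappa>)"
    "homeomorphism (fst \<kappa>) (snd \<kappa> ` fst \<kappa>) (snd \<kappa>) (chart_inv \<kappa>)"
proof -
  obtain \<kappa> where "\<kappa> \<in> \<A>" "p \<in> fst \<kappa>" using atlas unfolding smooth_atlas_def by blast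
  then show thesis using that atlas unfolding smooth_atlas_def by blast
qed

text \<open>In a chart around \<open>p\<close> the tent function of radius \<open>r\<close> has support in a compact coordinate ball.\<close>

lemma manifold_bump:
  assumes "open V" "p \<in> V"
  shows "\<exists>f\<in>C0. (\<forall>x::'a. 0 \<le> f x) \<and> 0 < f p \<and> (\<forall>x. x \<notin> V \<longrightarrow> f x = 0)"
proof -
  obtain \<kappa> where \<kappa>: "\<kappa> \<in> \<A>" "p \<in> fst \<kappa>" "open (fst \<kappa>)" "open (snd \<kappa> ` fst \<kappa>)"
    "homeomorphism (fst \<kappa>) (snd \<kappa> ` fst \<kappa>) (snd \<kappa>) (chart_inv \<kappa>)" using chartE[of p] .
  define U \<phi> \<psi> where "U = fst \<kappa>" and "\<phi> = snd \<kappa>" and "\<psi> = chart_inv \<kappa>"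
  have hom: "homeomorphism U (\<phi> ` U) \<phi> \<psi>" and U: "open U" "p \<in> U" "open (\<phi> ` U)"
    using \<kappa> by (auto simp: U_def \<phi>_def \<psi>_def)
  have "openin (top_of_set (\<phi> ` U)) (\<phi> ` (U \<inter> V))"
    using homeomorphism_imp_open_map[OF hom] U assms by (simp add: openin_open_Int)
  then have "open (\<phi> ` (U \<inter> V))" using U(3) openin_open_trans by blast
  then obtain r where r: "r > 0" "cball (\<phi> p) r \<subseteq> \<phi> ` (U \<inter> V)"
    using open_contains_cball[of "\<phi> ` (U \<inter> V)"] U assms by blast
  define K where "K = \<psi> ` cball (\<phi> p) r"
  have KU: "K \<subseteq> U \<inter> V"
    using r hom unfolding K_def homeomorphism_def by force
  have "compact K" unfolding K_def
    using r hom by (intro compact_continuous_image) (auto simp: homeomorphism_def intro: continuous_on_subset)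
  then have "closed K" by (rule compact_imp_closed)
  define f where "f x = (if x \<in> U then max 0 (r - dist (\<phi> x) (\<phi> p)) else 0)" for x
  have fK: "x \<in> K" if "f x \<noteq> 0" for x
  proof -
    have "x \<in> U" "dist (\<phi> x) (\<phi> p) \<le> r" using that by (auto simp: f_def max_def split: if_splits)
    then have "x = \<psi> (\<phi> x)" "\<phi> x \<in> cball (\<phi> p) r" using hom by (auto simp: homeomorphism_def dist_commute)
    then show ?thesis unfolding K_def by blast
  qed
  \<comment> \<open>The compact set \<open>K\<close> is closed, so \<open>U\<close> and the
    complement of \<open>K\<close> form an open cover; \<open>f\<close> is the tent function on the
    first and 0 on the second.\<close>
  have "continuous_on UNIV f"
  proof -
    have "continuous_on U (\<lambda>x. max 0 (r - dist (\<phi> x) (\<phi> p)))"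
      using hom by (intro continuous_intros) (auto simp: homeomorphism_def)
    then have "continuous_on U f" by (rule continuous_on_eq) (simp add: f_def)
    moreover have "continuous_on (- K) f"
      by (rule continuous_on_eq[OF continuous_on_const[of _ 0]]) (use fK in force)
    ultimately have "continuous_on (U \<union> - K) f"
      using U \<open>closed K\<close> by (intro continuous_on_open_Un) auto
    moreover have "U \<union> - K = UNIV" using KU by auto
    ultimately show ?thesis by simp
  qed
  moreover have "compact (closure {x. f x \<noteq> 0})"
  proof (rule compact_Int_closed[OF \<open>compact K\<close>, of "closure {x. f x \<noteq> 0}", simplified, THEN back_subst[of compact]])
    have "closure {x. f x \<noteq> 0} \<subseteq> K" using fK \<open>closed K\<close> by (intro closure_minimal) auto
    then show "K \<inter> closure {x. f x \<noteq> 0} = closure {x. f x \<noteq> 0}" by auto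
  qed
  moreover have "f p > 0" using r U by (simp add: f_def)
  moreover have "f x = 0" if "x \<notin> V" for x using fK[of x] KU that by auto
  ultimately show ?thesis by (intro bexI[of _ f]) (auto simp: C0_def f_def)
qed

lemma volume_point:
  assumes "riemannian_volume \<A> g m" shows "emeasure m {p :: 'a} = 0"
proof -
  obtain \<kappa> where \<kappa>: "\<kappa> \<in> \<A>" "p \<in> fst \<kappa>" using chartE[of p] .
  then have "emeasure m {p} = (\<integral>\<^sup>+u. ennreal (sqrt (det (g \<kappa> (chart_inv \<kappa> u)))) * indicator (snd \<kappa> ` {p}) u \<partial>lborel)"
    using assms unfolding riemannian_volume_def by simp
  also have "\<dots> = 0"
  proof -
    have "AE u in lborel. u \<noteq> snd \<kappa> p" by (rule AE_lborel_singleton)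
    then have "(\<integral>\<^sup>+u. ennreal (sqrt (det (g \<kappa> (chart_inv \<kappa> u)))) * indicator (snd \<kappa> ` {p}) u \<partial>lborel) = (\<integral>\<^sup>+(u::real^'n). 0 \<partial>lborel)"
      by (intro nn_integral_cong_AE) (auto elim!: eventually_mono)
    then show ?thesis by simp
  qed
  finally show ?thesis .
qed

text \<open>Smoothness of order 0 makes the Riemannian density continuous in coordinates, hence
  bounded on a closed coordinate ball, and that ball has finite Lebesgue measure.\<close>

lemma volume_locally_finite:
  assumes "riemannian_volume \<A> g m" "riemannian_metric \<A> g"
  shows "\<exists>W. open W \<and> (p :: 'a) \<in> W \<and> emeasure m W < \<infinity>"
proof -
  obtain \<kappa> where \<kappa>: "\<kappa> \<in> \<A>" "p \<in> fst \<kappa>" "open (fst \<kappa>)" "open (snd \<kappa> ` fst \<kappa>)"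
    "homeomorphism (fst \<kappa>) (snd \<kappa> ` fst \<kappa>) (snd \<kappa>) (chart_inv \<kappa>)" using chartE[of p] .
  define U \<phi> \<psi> where "U = fst \<kappa>" and "\<phi> = snd \<kappa>" and "\<psi> = chart_inv \<kappa>"
  have hom: "homeomorphism U (\<phi> ` U) \<phi> \<psi>" and U: "open U" "p \<in> U" "open (\<phi> ` U)"
    using \<kappa> by (auto simp: U_def \<phi>_def \<psi>_def)
  obtain r where r: "r > 0" "cball (\<phi> p) r \<subseteq> \<phi> ` U"
    using open_contains_cball[of "\<phi> ` U"] U by blast
  define W where "W = U \<inter> \<phi> -` ball (\<phi> p) r"
  have "open W" unfolding W_def
    using hom U by (intro continuous_open_preimage) (auto simp: homeomorphism_def)
  have "Ck_on 0 (\<phi> ` U) (g \<kappa> \<circ> \<psi>)"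
    using assms(2) \<kappa>(1) unfolding riemannian_metric_def smooth_on_def U_def \<phi>_def \<psi>_def by blast
  then have "continuous_on (cball (\<phi> p) r) (g \<kappa> \<circ> \<psi>)" using r by (auto intro: continuous_on_subset)
  then have "continuous_on (cball (\<phi> p) r) (\<lambda>u. sqrt (det (g \<kappa> (\<psi> u))))"
    unfolding det_def o_def by (intro continuous_intros)
  then have "bounded ((\<lambda>u. sqrt (det (g \<kappa> (\<psi> u)))) ` cball (\<phi> p) r)"
    by (intro compact_imp_bounded compact_continuous_image) auto
  then obtain B where B: "\<And>u. u \<in> cball (\<phi> p) r \<Longrightarrow> \<bar>sqrt (det (g \<kappa> (\<psi> u)))\<bar> \<le> B"
    unfolding bounded_iff by (metis imageI real_norm_def)
  have "emeasure m W = (\<integral>\<^sup>+u. ennreal (sqrt (det (g \<kappa> (\<psi> u)))) * indicator (\<phi> ` W) u \<partial>lborel)"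
    using assms(1) \<kappa>(1) \<open>open W\<close> unfolding riemannian_volume_def \<phi>_def \<psi>_def
    by (auto simp: W_def U_def)
  also have "\<dots> \<le> (\<integral>\<^sup>+u. ennreal B * indicator (ball (\<phi> p) r) u \<partial>lborel)"
  proof (rule nn_integral_mono)
    fix u
    show "ennreal (sqrt (det (g \<kappa> (\<psi> u)))) * indicator (\<phi> ` W) u \<le> ennreal B * indicator (ball (\<phi> p) r) u"
      using B[of u] by (auto simp: indicator_def W_def intro!: ennreal_leI)
  qed
  also have "\<dots> = ennreal B * emeasure lborel (ball (\<phi> p) r)" by (simp add: nn_integral_cmult_indicator)
  also have "\<dots> < \<infinity>" using emeasure_lborel_ball_finite by (auto simp: ennreal_mult_less_top)
  finally show ?thesis using \<open>open W\<close> U r by (intro exI[of _ W]) (auto simp: W_def)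
qed

lemma volume_sigma_finite:
  assumes "riemannian_volume \<A> g m" "riemannian_metric \<A> g"
  shows "sigma_finite_measure (m :: 'a measure)"
proof
  obtain \<W> where \<W>: "\<W> \<subseteq> {W. open W \<and> emeasure m W < \<infinity>}" "countable \<W>" "\<Union>\<W> = \<Union>{W. open W \<and> emeasure m W < \<infinity>}"
    using Lindelof[of "{W. open W \<and> emeasure m W < \<infinity>}"] by blast
  have s: "sets m = sets borel" using assms(1) by (simp add: riemannian_volume_def)
  have "p \<in> \<Union>{W. open W \<and> emeasure m W < \<infinity>}" for p
    using volume_locally_finite[OF assms, of p] by blast
  then have "\<Union>\<W> = space m" using \<W>(3) sets_eq_imp_space_eq[OF s] by auto
  then show "\<exists>A. countable A \<and> A \<subseteq> sets m \<and> \<Union>A = space m \<and> (\<forall>a\<in>A. emeasure m a \<noteq> \<infinity>)"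
    using \<W> s by (intro exI[of _ \<W>]) (auto simp: less_top)
qed

end

section \<open>Cylinder functions\<close>

text \<open>The carrier of \<open>Euclidean_space N\<close>: real sequences that vanish from index N
  on. \<open>FCb_iff\<close> uses it to pass from abstract topologies to
  \<open>continuous_on\<close>.\<close>

abbreviation padded :: "nat \<Rightarrow> (nat \<Rightarrow> real) set" where
  "padded N \<equiv> {x. \<forall>i\<ge>N. x i = 0}"

lemma FCb_iff:
  "F \<in> FCb \<longleftrightarrow> (\<exists>N \<phi> g. (\<forall>i<N. \<phi> i \<in> C0) \<and> continuous_on (padded N) g \<and> bounded (g ` padded N) \<and>
     (\<forall>\<gamma>\<in>configs. F \<gamma> = g (\<lambda>i. if i < N then pairing (\<phi> i) \<gamma> else 0)))"
  unfolding FCb_def topspace_Euclidean_space Euclidean_space_def euclidean_product_topology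
    continuous_map_iff_continuous mem_Collect_eq by simp

lemma FCbE:
  assumes "F \<in> FCb"
  obtains N \<phi> g where "\<forall>i<N. \<phi> i \<in> C0" "continuous_on (padded N) g" "bounded (g ` padded N)"
    "\<forall>\<gamma>\<in>configs. F \<gamma> = g (\<lambda>i. if i < N then pairing (\<phi> i) \<gamma> else 0)"
  using assms unfolding FCb_iff by (elim exE conjE)

context bump_space
begin

lemma FCb_measurable:
  fixes F :: "'a set \<Rightarrow> real"
  assumes "F \<in> FCb" shows "F \<in> borel_measurable config_borel"
proof -
  obtain N \<phi> g where F: "\<forall>i<N. \<phi> i \<in> C0" "continuous_on (padded N) g" "bounded (g ` padded N)"
    "\<forall>\<gamma>\<in>configs. F \<gamma> = g (\<lambda>i. if i < N then pairing (\<phi> i) \<gamma> else 0)"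
    using FCbE[OF assms] .
  let ?p = "\<lambda>\<gamma> i. if i < N then pairing (\<phi> i) \<gamma> else 0"
  have "?p \<in> borel_measurable config_borel"
  proof (rule measurable_coordinatewise_then_product)
    show "(\<lambda>\<gamma>. if i < N then pairing (\<phi> i) \<gamma> else 0) \<in> borel_measurable config_borel" for i
      using F(1) by (cases "i < N") auto
  qed
  \<comment> \<open>The function \<open>g\<close> is continuous only on \<open>padded N\<close>, so
    the composition runs through the restricted space.\<close>
  then have "?p \<in> measurable config_borel (restrict_space borel (padded N))"
    by (intro measurable_restrict_space2) auto
  moreover have "g \<in> borel_measurable (restrict_space borel (padded N))"
    using F(2) by (rule borel_measurable_continuous_on_restrict)
  ultimately have "(\<lambda>\<gamma>. g (?p \<gamma>)) \<in> borel_measurable config_borel" by (rule measurable_compose)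
  then show ?thesis using F(4) by (subst measurable_cong[where g="\<lambda>\<gamma>. g (?p \<gamma>)"]) auto
qed

lemma FCb_bounded:
  fixes F :: "'a set \<Rightarrow> real"
  assumes "F \<in> FCb" shows "\<exists>B>0. \<forall>\<gamma>\<in>configs. \<bar>F \<gamma>\<bar> \<le> B"
proof -
  obtain N \<phi> g where F: "\<forall>i<N. \<phi> i \<in> C0" "continuous_on (padded N) g" "bounded (g ` padded N)"
    "\<forall>\<gamma>\<in>configs. F \<gamma> = g (\<lambda>i. if i < N then pairing (\<phi> i) \<gamma> else 0)"
    using FCbE[OF assms] .
  obtain B where "B > 0" "\<And>u. u \<in> g ` padded N \<Longrightarrow> norm u \<le> B"
    using F(3) unfolding bounded_pos by blast
  then show ?thesis using F(4) by (intro exI[of _ B]) auto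
qed

text \<open>Take for \<open>\<Lambda>\<close> the union of the supports of the finitely many test
  functions. A move between points outside it leaves every pairing unchanged, since the same finite
  set carries its nonzero terms before and after.\<close>

lemma FCb_local:
  fixes F :: "'a set \<Rightarrow> real"
  assumes "F \<in> FCb"
  shows "\<exists>\<Lambda>. compact \<Lambda> \<and> (\<forall>\<gamma>\<in>configs. \<forall>x y. x \<notin> \<Lambda> \<longrightarrow> y \<notin> \<Lambda> \<longrightarrow> F (move x y \<gamma>) = F \<gamma>)"
proof -
  obtain N \<phi> g where F: "\<forall>i<N. \<phi> i \<in> C0" "continuous_on (padded N) g" "bounded (g ` padded N)"
    "\<forall>\<gamma>\<in>configs. F \<gamma> = g (\<lambda>i. if i < N then pairing (\<phi> i) \<gamma> else 0)"
    using FCbE[OF assms] .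
  define \<Lambda> where "\<Lambda> = (\<Union>i<N. closure {x. \<phi> i x \<noteq> 0})"
  have "compact \<Lambda>" unfolding \<Lambda>_def using F(1) by (intro compact_UN) (auto simp: C0_def)
  moreover have "F (move x y \<gamma>) = F \<gamma>" if \<gamma>: "\<gamma> \<in> configs" and xy: "x \<notin> \<Lambda>" "y \<notin> \<Lambda>" for x y \<gamma>
  proof -
    have "pairing (\<phi> i) (move x y \<gamma>) = pairing (\<phi> i) \<gamma>" if i: "i < N" for i
    proof -
      let ?T = "\<gamma> \<inter> {x. \<phi> i x \<noteq> 0}"
      have 0: "\<phi> i x = 0" "\<phi> i y = 0" using xy i unfolding \<Lambda>_def by (auto intro: subsetD[OF closure_subset])
      have fin: "finite ?T" using F(1) i \<gamma> by (intro configs_finite_support) auto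
      have "pairing (\<phi> i) (move x y \<gamma>) = sum (\<phi> i) ?T"
        using F(1) i fin 0 by (intro pairing_eq_sum) (auto simp: move_def)
      also have "\<dots> = pairing (\<phi> i) \<gamma>"
        using F(1) i fin by (intro pairing_eq_sum[symmetric]) auto
      finally show ?thesis .
    qed
    moreover have "move x y \<gamma> \<in> configs"
      unfolding move_def using \<gamma> by (intro configs_insert configs_subset[OF \<gamma>]) auto
    ultimately show ?thesis using F(4) \<gamma> by (auto cong: if_cong)
  qed
  ultimately show ?thesis by (intro exI[of _ \<Lambda>]) auto
qed

text \<open>The two lists of test functions are concatenated: \<open>p\<close> recovers the
  coordinates for \<open>F\<close> and \<open>r\<close>, which shifts by \<open>N\<close>, those for
  \<open>G\<close>.\<close>

lemma FCb_lin:
  fixes F G :: "'a set \<Rightarrow> real"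
  assumes "F \<in> FCb" "G \<in> FCb" shows "(\<lambda>\<gamma>. a * F \<gamma> + b * G \<gamma>) \<in> FCb"
proof -
  obtain N \<phi> f where F: "\<forall>i<N. \<phi> i \<in> C0" "continuous_on (padded N) f" "bounded (f ` padded N)"
    "\<forall>\<gamma>\<in>configs. F \<gamma> = f (\<lambda>i. if i < N then pairing (\<phi> i) \<gamma> else 0)"
    using FCbE[OF assms(1)] .
  obtain M \<psi> g where G: "\<forall>i<M. \<psi> i \<in> C0" "continuous_on (padded M) g" "bounded (g ` padded M)"
    "\<forall>\<gamma>\<in>configs. G \<gamma> = g (\<lambda>i. if i < M then pairing (\<psi> i) \<gamma> else 0)"
    using FCbE[OF assms(2)] .
  define \<eta> where "\<eta> i = (if i < N then \<phi> i else \<psi> (i - N))" for i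
  \<comment> \<open>Filling up with zeros puts the values of \<open>p\<close> and \<open>r\<close>
    into the domains of \<open>f\<close> and \<open>g\<close> for every sequence, so the combined
    function is continuous everywhere.\<close>
  define p where "p x i = (if i < N then x i else 0)" for x :: "nat \<Rightarrow> real" and i
  define r where "r x i = (if i < M then x (i + N) else 0)" for x :: "nat \<Rightarrow> real" and i
  define h where "h x = a * f (p x) + b * g (r x)" for x
  have coord: "continuous_on S (\<lambda>x :: nat \<Rightarrow> real. x i)" for S i
    by (intro continuous_on_product_coordinates[THEN continuous_on_subset]) auto
  have "continuous_on UNIV (\<lambda>x. p x i)" for i
    unfolding p_def by (cases "i < N") (simp_all add: coord)
  moreover have "continuous_on UNIV (\<lambda>x. r x i)" for i
    unfolding r_def by (cases "i < M") (simp_all add: coord)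
  ultimately have pr: "continuous_on UNIV p" "continuous_on UNIV r"
    by (auto intro: continuous_on_coordinatewise_then_product)
  have pr': "p x \<in> padded N" "r x \<in> padded M" for x by (auto simp: p_def r_def)
  have "\<eta> i \<in> C0" if "i < N + M" for i using that F(1) G(1) by (auto simp: \<eta>_def)
  moreover have "continuous_on (padded (N + M)) h"
  proof -
    have "continuous_on UNIV (\<lambda>x. f (p x))" "continuous_on UNIV (\<lambda>x. g (r x))"
      using pr' by (auto intro!: continuous_on_compose2[OF F(2) pr(1)] continuous_on_compose2[OF G(2) pr(2)])
    then have "continuous_on UNIV h" unfolding h_def by (intro continuous_intros)
    then show ?thesis by (rule continuous_on_subset) simp
  qed
  moreover have "bounded (h ` padded (N + M))"
  proof -
    obtain A where "\<forall>u\<in>f ` padded N. norm u \<le> A" using F(3) unfolding bounded_iff ..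
    then have A: "\<bar>f u\<bar> \<le> A" if "u \<in> padded N" for u using that by auto
    obtain B where "\<forall>u\<in>g ` padded M. norm u \<le> B" using G(3) unfolding bounded_iff ..
    then have B: "\<bar>g u\<bar> \<le> B" if "u \<in> padded M" for u using that by auto
    have "\<bar>h x\<bar> \<le> \<bar>a\<bar> * A + \<bar>b\<bar> * B" for x
      unfolding h_def using A[OF pr'(1)] B[OF pr'(2)]
      by (intro order.trans[OF abs_triangle_ineq] add_mono) (auto simp: abs_mult intro: mult_left_mono)
    then have "\<forall>u\<in>h ` padded (N + M). norm u \<le> \<bar>a\<bar> * A + \<bar>b\<bar> * B" by auto
    then show ?thesis unfolding bounded_iff ..
  qed
  moreover have "a * F \<gamma> + b * G \<gamma> = h (\<lambda>i. if i < N + M then pairing (\<eta> i) \<gamma> else 0)" if "\<gamma> \<in> configs" for \<gamma>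
  proof -
    have "p (\<lambda>i. if i < N + M then pairing (\<eta> i) \<gamma> else 0) = (\<lambda>i. if i < N then pairing (\<phi> i) \<gamma> else 0)"
      "r (\<lambda>i. if i < N + M then pairing (\<eta> i) \<gamma> else 0) = (\<lambda>i. if i < M then pairing (\<psi> i) \<gamma> else 0)"
      by (auto simp: p_def r_def \<eta>_def fun_eq_iff)
    then show ?thesis using F(4) G(4) that by (simp add: h_def)
  qed
  ultimately show ?thesis unfolding FCb_iff by (intro exI[of _ "N + M"] exI[of _ \<eta>] exI[of _ h]) auto
qed

end

section \<open>The generator on cylinder functions\<close>

text \<open>The value is 0 when the integral does not exist, so the formula splits according to
  finiteness of the absolute integral; every piece is a nonnegative integral, whose measurability is
  known.\<close>

lemma (in bump_space) integral_config_measurable[measurable (raw)]: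
  fixes f :: "'b \<Rightarrow> 'a \<Rightarrow> real"
  assumes f: "(\<lambda>(w, x). f w x) \<in> borel_measurable (M \<Otimes>\<^sub>M borel)"
    and h[measurable]: "h \<in> measurable M config_borel"
  shows "(\<lambda>w. LINT x|config_measure (h w). f w x) \<in> borel_measurable M"
proof -
  have [measurable (raw)]: "(\<lambda>u. f (a u) (b u)) \<in> borel_measurable N"
    if "a \<in> measurable N M" "b \<in> borel_measurable N" for a b and N :: "'c measure"
    using measurable_compose[OF measurable_Pair[OF that] f] by simp
  have "(LINT x|config_measure (h w). f w x) =
      (if (\<integral>\<^sup>+x. ennreal \<bar>f w x\<bar> \<partial>config_measure (h w)) < \<infinity>
       then enn2real (\<integral>\<^sup>+x. ennreal (f w x) \<partial>config_measure (h w)) - enn2real (\<integral>\<^sup>+x. ennreal (- f w x) \<partial>config_measure (h w))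
       else 0)" if "w \<in> space M" for w
  proof -
    have "(\<lambda>x. f w x) \<in> borel_measurable (config_measure (h w))" using that by measurable
    then have "integrable (config_measure (h w)) (f w) \<longleftrightarrow> (\<integral>\<^sup>+x. ennreal \<bar>f w x\<bar> \<partial>config_measure (h w)) < \<infinity>"
      by (simp add: integrable_iff_bounded)
    then show ?thesis by (auto simp: real_lebesgue_integral_def not_integrable_integral_eq)
  qed
  then show ?thesis by (rule measurable_cong[THEN iffD2]) measurable
qed

locale kawasaki_generator = kawasaki m E z \<mu> c for m :: "'a::{t2_space, second_countable_topology} measure" and E z \<mu> c +
  assumes c_integrable: "integrable_coefficient m \<mu> c"
    and weight: "\<And>\<Lambda>. compact \<Lambda> \<Longrightarrow> csym_weight m z E c \<Lambda> \<in> borel_measurable \<mu> \<and>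
           (\<integral>\<^sup>+\<gamma>. (csym_weight m z E c \<Lambda> \<gamma>)\<^sup>2 \<partial>\<mu>) < \<infinity>"
begin

abbreviation cs :: "'a \<Rightarrow> 'a \<Rightarrow> 'a set \<Rightarrow> real" where "cs \<equiv> csym E c"

abbreviation jointly_measurable :: "('a \<Rightarrow> 'a \<Rightarrow> 'a set \<Rightarrow> real) \<Rightarrow> bool" where
  "jointly_measurable K \<equiv> (\<lambda>(x, y, \<gamma>). K x y \<gamma>) \<in> borel_measurable (borel \<Otimes>\<^sub>M borel \<Otimes>\<^sub>M config_borel)"

lemma cs_measurable'[measurable (raw)]:
  assumes [measurable]: "a \<in> borel_measurable M" "b \<in> borel_measurable M" "h \<in> measurable M config_borel"
  shows "(\<lambda>w. cs (a w) (b w) (h w)) \<in> borel_measurable M"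
  unfolding csym_def by measurable

lemma configs_move: "\<gamma> \<in> configs \<Longrightarrow> move x y (\<gamma> :: 'a set) \<in> configs"
  unfolding move_def by (intro configs_insert) (auto intro: configs_subset)

lemma cs_nonneg: "\<gamma> \<in> configs \<Longrightarrow> 0 \<le> cs x y \<gamma>"
  unfolding csym_def using c_nonneg configs_move by (intro mult_nonneg_nonneg add_nonneg_nonneg) auto

section \<open>Signed integrals over occupied and target sites\<close>

definition pair_integral :: "('a \<Rightarrow> 'a \<Rightarrow> 'a set \<Rightarrow> real) \<Rightarrow> 'a set \<Rightarrow> real" where
  "pair_integral K \<gamma> = (LINT x|config_measure \<gamma>. (LINT y|m. K x y \<gamma>))"

definition absint :: "('a \<Rightarrow> 'a \<Rightarrow> 'a set \<Rightarrow> real) \<Rightarrow> bool" where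
  "absint K \<longleftrightarrow> jointly_measurable K \<and> campbell (\<lambda>x y \<gamma>. ennreal \<bar>K x y \<gamma>\<bar>) < \<infinity>"

lemma pair_integral_measurable: "jointly_measurable K \<Longrightarrow> pair_integral K \<in> borel_measurable config_borel"
proof -
  assume K: "jointly_measurable K"
  note [measurable (raw)] = triple_measurableD[OF K]
  show ?thesis unfolding pair_integral_def by measurable
qed

text \<open>Fubini on the product of the configuration and \<open>m\<close>. The product measure
  gives additivity, and the last equation expresses the iterated integral by two nonnegative ones,
  to which the balance identities apply.\<close>

lemma pair_integral_product:
  assumes K: "jointly_measurable K" and \<gamma>: "\<gamma> \<in> configs"
    and fin: "inner_integral (\<lambda>x y \<gamma>. ennreal \<bar>K x y \<gamma>\<bar>) \<gamma> < \<infinity>"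
  shows "integrable (config_measure \<gamma> \<Otimes>\<^sub>M m) (\<lambda>(x, y). K x y \<gamma>)"
    and "pair_integral K \<gamma> = (LINT p|(config_measure \<gamma> \<Otimes>\<^sub>M m). (case p of (x, y) \<Rightarrow> K x y \<gamma>))"
    and "pair_integral K \<gamma> = enn2real (inner_integral (\<lambda>x y \<gamma>. ennreal (K x y \<gamma>)) \<gamma>) -
      enn2real (inner_integral (\<lambda>x y \<gamma>. ennreal (- K x y \<gamma>)) \<gamma>)"
proof -
  note [measurable (raw)] = triple_measurableD[OF K]
  have [measurable]: "\<gamma> \<in> space config_borel" using \<gamma> by simp
  interpret \<gamma>: sigma_finite_measure "config_measure \<gamma>" using \<gamma> by (rule sigma_finite_config)
  interpret \<gamma>m: pair_sigma_finite "config_measure \<gamma>" m ..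
  let ?N = "config_measure \<gamma> \<Otimes>\<^sub>M m"
  have N: "(\<integral>\<^sup>+p. (case p of (x, y) \<Rightarrow> \<phi> (K x y \<gamma>)) \<partial>?N) = inner_integral (\<lambda>x y \<gamma>. \<phi> (K x y \<gamma>)) \<gamma>"
    if [measurable]: "\<phi> \<in> borel_measurable borel" for \<phi> :: "real \<Rightarrow> ennreal"
  proof -
    have "(\<lambda>p. case p of (x, y) \<Rightarrow> \<phi> (K x y \<gamma>)) \<in> borel_measurable ?N" by measurable
    from m.nn_integral_fst[OF this] show ?thesis by (simp add: inner_integral_def)
  qed
  have meas: "(\<lambda>(x, y). K x y \<gamma>) \<in> borel_measurable ?N" by measurable
  have "(\<integral>\<^sup>+p. ennreal (norm (case p of (x, y) \<Rightarrow> K x y \<gamma>)) \<partial>?N) = (\<integral>\<^sup>+p. (case p of (x, y) \<Rightarrow> ennreal \<bar>K x y \<gamma>\<bar>) \<partial>?N)"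
    by (intro nn_integral_cong) auto
  then show int: "integrable ?N (\<lambda>(x, y). K x y \<gamma>)"
    using meas fin N[of "\<lambda>r. ennreal \<bar>r\<bar>"] by (simp add: integrable_iff_bounded)
  show eq: "pair_integral K \<gamma> = (LINT p|?N. (case p of (x, y) \<Rightarrow> K x y \<gamma>))"
    unfolding pair_integral_def using \<gamma>m.integral_fst'[OF int] by simp
  have "(\<integral>\<^sup>+p. ennreal (case p of (x, y) \<Rightarrow> K x y \<gamma>) \<partial>?N) = inner_integral (\<lambda>x y \<gamma>. ennreal (K x y \<gamma>)) \<gamma>"
    "(\<integral>\<^sup>+p. ennreal (- (case p of (x, y) \<Rightarrow> K x y \<gamma>)) \<partial>?N) = inner_integral (\<lambda>x y \<gamma>. ennreal (- K x y \<gamma>)) \<gamma>"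
    using N[of ennreal] N[of "\<lambda>r. ennreal (- r)"] by (auto simp: case_prod_beta)
  then show "pair_integral K \<gamma> = enn2real (inner_integral (\<lambda>x y \<gamma>. ennreal (K x y \<gamma>)) \<gamma>) -
      enn2real (inner_integral (\<lambda>x y \<gamma>. ennreal (- K x y \<gamma>)) \<gamma>)"
    unfolding eq using real_lebesgue_integral_def[OF int] by simp
qed

lemma inner_integral_mono:
  "(\<And>x y. K x y \<gamma> \<le> L x y \<gamma>) \<Longrightarrow> inner_integral K \<gamma> \<le> inner_integral L \<gamma>"
  unfolding inner_integral_def by (intro nn_integral_mono)

lemma campbell_mono:
  "(\<And>x y \<gamma>. \<gamma> \<in> configs \<Longrightarrow> K x y \<gamma> \<le> L x y \<gamma>) \<Longrightarrow> campbell K \<le> campbell L"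
  unfolding campbell_def by (intro nn_integral_mono inner_integral_mono) simp

lemma absintD:
  assumes "absint K"
  shows "AE \<gamma> in \<mu>. inner_integral (\<lambda>x y \<gamma>. ennreal \<bar>K x y \<gamma>\<bar>) \<gamma> < \<infinity>"
proof -
  have K: "jointly_measurable K" using assms by (simp add: absint_def)
  note [measurable (raw)] = triple_measurableD[OF K]
  have [measurable]: "inner_integral (\<lambda>x y \<gamma>. ennreal \<bar>K x y \<gamma>\<bar>) \<in> borel_measurable \<mu>"
    using inner_integral_measurable[of "\<lambda>x y \<gamma>. ennreal \<bar>K x y \<gamma>\<bar>"] by measurable
  have "(\<integral>\<^sup>+\<gamma>. inner_integral (\<lambda>x y \<gamma>. ennreal \<bar>K x y \<gamma>\<bar>) \<gamma> \<partial>\<mu>) \<noteq> \<infinity>"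
    using assms by (simp add: absint_def campbell_def)
  then have "AE \<gamma> in \<mu>. inner_integral (\<lambda>x y \<gamma>. ennreal \<bar>K x y \<gamma>\<bar>) \<gamma> \<noteq> \<infinity>"
    by (rule nn_integral_PInf_AE[rotated]) measurable
  then show ?thesis by (simp add: less_top)
qed

lemma absint_integral:
  assumes K: "absint K"
  shows "integrable \<mu> (pair_integral K)"
    and "(LINT \<gamma>|\<mu>. pair_integral K \<gamma>) = enn2real (campbell (\<lambda>x y \<gamma>. ennreal (K x y \<gamma>))) - enn2real (campbell (\<lambda>x y \<gamma>. ennreal (- K x y \<gamma>)))"
proof -
  have jm: "jointly_measurable K" using K by (simp add: absint_def)
  note [measurable (raw)] = triple_measurableD[OF jm]
  \<comment> \<open>Used for the identity and for negation: \<open>ennreal\<close> sends negative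
    reals to 0, so these give the positive and the negative part.\<close>
  have part: "integrable \<mu> (\<lambda>\<gamma>. enn2real (inner_integral (\<lambda>x y \<gamma>. ennreal (\<phi> (K x y \<gamma>))) \<gamma>)) \<and>
     (LINT \<gamma>|\<mu>. enn2real (inner_integral (\<lambda>x y \<gamma>. ennreal (\<phi> (K x y \<gamma>))) \<gamma>)) = enn2real (campbell (\<lambda>x y \<gamma>. ennreal (\<phi> (K x y \<gamma>))))"
    if [measurable]: "\<phi> \<in> borel_measurable borel" and le: "\<And>r. \<phi> r \<le> \<bar>r\<bar>" for \<phi> :: "real \<Rightarrow> real"
  proof -
    let ?I = "inner_integral (\<lambda>x y \<gamma>. ennreal (\<phi> (K x y \<gamma>)))"
    have [measurable]: "?I \<in> borel_measurable \<mu>"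
      using inner_integral_measurable[of "\<lambda>x y \<gamma>. ennreal (\<phi> (K x y \<gamma>))"] by measurable
    have "AE \<gamma> in \<mu>. ?I \<gamma> < \<infinity>"
      using absintD[OF K] by eventually_elim (rule le_less_trans[OF inner_integral_mono], auto intro: ennreal_leI le)
    then have eq: "(\<integral>\<^sup>+\<gamma>. ennreal (enn2real (?I \<gamma>)) \<partial>\<mu>) = campbell (\<lambda>x y \<gamma>. ennreal (\<phi> (K x y \<gamma>)))"
      unfolding campbell_def by (intro nn_integral_cong_AE) (auto elim!: eventually_mono)
    have "campbell (\<lambda>x y \<gamma>. ennreal (\<phi> (K x y \<gamma>))) \<le> campbell (\<lambda>x y \<gamma>. ennreal \<bar>K x y \<gamma>\<bar>)"
      by (intro campbell_mono ennreal_leI le)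
    also have "\<dots> < \<infinity>" using K by (simp add: absint_def)
    finally have fin: "campbell (\<lambda>x y \<gamma>. ennreal (\<phi> (K x y \<gamma>))) < \<infinity>" .
    have "integrable \<mu> (\<lambda>\<gamma>. enn2real (?I \<gamma>))"
      using fin eq by (intro integrableI_nonneg) auto
    moreover have "(LINT \<gamma>|\<mu>. enn2real (?I \<gamma>)) = enn2real (campbell (\<lambda>x y \<gamma>. ennreal (\<phi> (K x y \<gamma>))))"
      by (subst integral_eq_nn_integral) (auto simp: eq)
    ultimately show ?thesis by simp
  qed
  note pos = part[of "\<lambda>r. r", simplified] and neg = part[of uminus, simplified]
  let ?d = "\<lambda>\<gamma>. enn2real (inner_integral (\<lambda>x y \<gamma>. ennreal (K x y \<gamma>)) \<gamma>) - enn2real (inner_integral (\<lambda>x y \<gamma>. ennreal (- K x y \<gamma>)) \<gamma>)"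
  have d: "integrable \<mu> ?d" using pos neg by (intro Bochner_Integration.integrable_diff) auto
  have ae: "AE \<gamma> in \<mu>. pair_integral K \<gamma> = ?d \<gamma>"
    using absintD[OF K] AE_space by eventually_elim (simp add: pair_integral_product(3)[OF jm])
  have pair_integral: "pair_integral K \<in> borel_measurable \<mu>" using pair_integral_measurable[OF jm] by measurable
  show "integrable \<mu> (pair_integral K)"
    by (rule integrable_cong_AE[OF pair_integral borel_measurable_integrable[OF d] ae, THEN iffD2, OF d])
  have "(LINT \<gamma>|\<mu>. pair_integral K \<gamma>) = (LINT \<gamma>|\<mu>. ?d \<gamma>)"
    by (rule integral_cong_AE[OF pair_integral borel_measurable_integrable[OF d] ae])
  also have "\<dots> = enn2real (campbell (\<lambda>x y \<gamma>. ennreal (K x y \<gamma>))) - enn2real (campbell (\<lambda>x y \<gamma>. ennreal (- K x y \<gamma>)))"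
    using pos neg by (subst Bochner_Integration.integral_diff) auto
  finally show "(LINT \<gamma>|\<mu>. pair_integral K \<gamma>) = enn2real (campbell (\<lambda>x y \<gamma>. ennreal (K x y \<gamma>))) - enn2real (campbell (\<lambda>x y \<gamma>. ennreal (- K x y \<gamma>)))" .
qed

text \<open>Iterated integrals with default value 0 are not additive as such. For almost every
  \<gamma> both integrands are integrable on the product, where subtraction is legitimate.\<close>

lemma integral_pair_integral_diff:
  assumes "absint K" "absint L"
  shows "(LINT \<gamma>|\<mu>. pair_integral (\<lambda>x y \<gamma>. K x y \<gamma> - L x y \<gamma>) \<gamma>) = (LINT \<gamma>|\<mu>. pair_integral K \<gamma>) - (LINT \<gamma>|\<mu>. pair_integral L \<gamma>)"
proof -
  have jm: "jointly_measurable K" "jointly_measurable L" using assms by (auto simp: absint_def)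
  note [measurable (raw)] = triple_measurableD[OF jm(1)] triple_measurableD[OF jm(2)]
  have jm': "jointly_measurable (\<lambda>x y \<gamma>. K x y \<gamma> - L x y \<gamma>)" by measurable
  have "AE \<gamma> in \<mu>. pair_integral (\<lambda>x y \<gamma>. K x y \<gamma> - L x y \<gamma>) \<gamma> = pair_integral K \<gamma> - pair_integral L \<gamma>"
    using absintD[OF assms(1)] absintD[OF assms(2)] AE_space
  proof eventually_elim
    fix \<gamma> assume fin: "inner_integral (\<lambda>x y \<gamma>. ennreal \<bar>K x y \<gamma>\<bar>) \<gamma> < \<infinity>"
      "inner_integral (\<lambda>x y \<gamma>. ennreal \<bar>L x y \<gamma>\<bar>) \<gamma> < \<infinity>" and "\<gamma> \<in> space \<mu>"
    then have \<gamma>: "\<gamma> \<in> configs" by simp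
    interpret \<gamma>: sigma_finite_measure "config_measure \<gamma>" using \<gamma> by (rule sigma_finite_config)
    interpret \<gamma>m: pair_sigma_finite "config_measure \<gamma>" m ..
    have "integrable (config_measure \<gamma> \<Otimes>\<^sub>M m) (\<lambda>p. (case p of (x, y) \<Rightarrow> K x y \<gamma>) - (case p of (x, y) \<Rightarrow> L x y \<gamma>))"
      using pair_integral_product(1)[OF jm(1) \<gamma> fin(1)] pair_integral_product(1)[OF jm(2) \<gamma> fin(2)] by (rule Bochner_Integration.integrable_diff)
    from \<gamma>m.integral_fst'[OF this]
    have "pair_integral (\<lambda>x y \<gamma>. K x y \<gamma> - L x y \<gamma>) \<gamma> = (LINT p|(config_measure \<gamma> \<Otimes>\<^sub>M m). (case p of (x, y) \<Rightarrow> K x y \<gamma>) - (case p of (x, y) \<Rightarrow> L x y \<gamma>))"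
      by (simp add: pair_integral_def)
    also have "\<dots> = pair_integral K \<gamma> - pair_integral L \<gamma>"
      unfolding pair_integral_product(2)[OF jm(1) \<gamma> fin(1)] pair_integral_product(2)[OF jm(2) \<gamma> fin(2)]
      using pair_integral_product(1)[OF jm(1) \<gamma> fin(1)] pair_integral_product(1)[OF jm(2) \<gamma> fin(2)] by (rule Bochner_Integration.integral_diff)
    finally show "pair_integral (\<lambda>x y \<gamma>. K x y \<gamma> - L x y \<gamma>) \<gamma> = pair_integral K \<gamma> - pair_integral L \<gamma>" .
  qed
  moreover have "pair_integral (\<lambda>x y \<gamma>. K x y \<gamma> - L x y \<gamma>) \<in> borel_measurable \<mu>" "pair_integral K \<in> borel_measurable \<mu>" "pair_integral L \<in> borel_measurable \<mu>"
    using pair_integral_measurable[OF jm'] pair_integral_measurable[OF jm(1)] pair_integral_measurable[OF jm(2)] by measurable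
  ultimately have "(LINT \<gamma>|\<mu>. pair_integral (\<lambda>x y \<gamma>. K x y \<gamma> - L x y \<gamma>) \<gamma>) = (LINT \<gamma>|\<mu>. pair_integral K \<gamma> - pair_integral L \<gamma>)"
    by (intro integral_cong_AE) auto
  then show ?thesis using absint_integral(1)[OF assms(1)] absint_integral(1)[OF assms(2)] by simp
qed

section \<open>Balance identities for the symmetrised coefficient\<close>

lemma move_back: "x \<in> \<gamma> \<Longrightarrow> y \<notin> \<gamma> \<Longrightarrow> move y x (move x y \<gamma>) = (\<gamma> :: 'a set)"
  by (auto simp: move_def)

text \<open>The second half of \<open>csym\<close> is \<open>rho\<close> times the coefficient of
  the reversed move. Reversing the Campbell measure absorbs \<open>rho\<close> and transfers the
  reversal to the test function \<open>k\<close>.\<close>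

lemma campbell_cs:
  assumes k: "(\<lambda>(x, y, \<gamma>). k x y \<gamma>) \<in> borel_measurable (borel \<Otimes>\<^sub>M borel \<Otimes>\<^sub>M config_borel)"
  shows "campbell (\<lambda>x y \<gamma>. ennreal (cs x y \<gamma>) * k x y \<gamma>) = ennreal (1/2) *
    (campbell (\<lambda>x y \<gamma>. ennreal (c x y \<gamma>) * k x y \<gamma>) + campbell (\<lambda>x y \<gamma>. ennreal (c x y \<gamma>) * k y x (move x y \<gamma>)))"
proof -
  note [measurable (raw)] = triple_measurableD[OF k]
  define A where "A x y \<gamma> = ennreal (c x y \<gamma>) * k x y \<gamma>" for x y \<gamma>
  \<comment> \<open>The test function is reversed here so that a second reversal, inside
    \<open>R\<close>, restores it by \<open>move_back\<close>.\<close>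
  define L where "L x y \<gamma> = ennreal (c x y \<gamma>) * k y x (move x y \<gamma>)" for x y \<gamma>
  define R where "R x y \<gamma> = ennreal (rho x y \<gamma>) * L y x (move x y \<gamma>)" for x y \<gamma>
  have jm: "(\<lambda>(x, y, \<gamma>). A x y \<gamma>) \<in> borel_measurable (borel \<Otimes>\<^sub>M borel \<Otimes>\<^sub>M config_borel)"
    "(\<lambda>(x, y, \<gamma>). L x y \<gamma>) \<in> borel_measurable (borel \<Otimes>\<^sub>M borel \<Otimes>\<^sub>M config_borel)"
    unfolding A_def L_def by measurable
  note [measurable (raw)] = triple_measurableD[OF jm(1)] triple_measurableD[OF jm(2)]
  have jmR: "(\<lambda>(x, y, \<gamma>). R x y \<gamma>) \<in> borel_measurable (borel \<Otimes>\<^sub>M borel \<Otimes>\<^sub>M config_borel)"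
    unfolding R_def by measurable
  note [measurable (raw)] = triple_measurableD[OF jmR]
  have "campbell (\<lambda>x y \<gamma>. ennreal (cs x y \<gamma>) * k x y \<gamma>) = campbell (\<lambda>x y \<gamma>. ennreal (1/2) * (A x y \<gamma> + R x y \<gamma>))"
  proof (rule campbell_cong)
    fix x y :: 'a and \<gamma> :: "'a set" assume \<gamma>: "\<gamma> \<in> configs" "x \<in> \<gamma>" "y \<notin> \<gamma>"
    have "ennreal (cs x y \<gamma>) = ennreal (1/2) * (ennreal (c x y \<gamma>) + ennreal (rho x y \<gamma>) * ennreal (c y x (move x y \<gamma>)))"
    proof -
      have nn: "0 \<le> c x y \<gamma>" "0 \<le> c y x (move x y \<gamma>)" using \<gamma> c_nonneg configs_move by auto
      have "ennreal (cs x y \<gamma>) = ennreal (1/2) * ennreal (c x y \<gamma> + c y x (move x y \<gamma>) * rho x y \<gamma>)"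
        unfolding csym_def using nn by (intro ennreal_mult) auto
      also have "ennreal (c x y \<gamma> + c y x (move x y \<gamma>) * rho x y \<gamma>) =
          ennreal (c x y \<gamma>) + ennreal (c y x (move x y \<gamma>) * rho x y \<gamma>)"
        using nn by (intro ennreal_plus) auto
      also have "ennreal (c y x (move x y \<gamma>) * rho x y \<gamma>) = ennreal (rho x y \<gamma>) * ennreal (c y x (move x y \<gamma>))"
        using nn by (subst mult.commute) (intro ennreal_mult, auto)
      finally show ?thesis .
    qed
    then show "ennreal (cs x y \<gamma>) * k x y \<gamma> = ennreal (1/2) * (A x y \<gamma> + R x y \<gamma>)"
      using \<gamma> by (simp add: A_def R_def L_def move_back distrib_left distrib_right mult.assoc)
  qed
  also have "\<dots> = ennreal (1/2) * (campbell A + campbell R)"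
  proof -
    have "inner_integral (\<lambda>x y \<gamma>. ennreal (1/2) * (A x y \<gamma> + R x y \<gamma>)) \<gamma> = ennreal (1/2) * (inner_integral A \<gamma> + inner_integral R \<gamma>)"
      if "\<gamma> \<in> configs" for \<gamma>
    proof -
      have [measurable]: "\<gamma> \<in> space config_borel" using that by simp
      have "(\<integral>\<^sup>+y. ennreal (1/2) * (A x y \<gamma> + R x y \<gamma>) \<partial>m) = ennreal (1/2) * ((\<integral>\<^sup>+y. A x y \<gamma> \<partial>m) + (\<integral>\<^sup>+y. R x y \<gamma> \<partial>m))" for x
      proof -
        have "(\<lambda>y. A x y \<gamma>) \<in> borel_measurable m" "(\<lambda>y. R x y \<gamma>) \<in> borel_measurable m" by measurable
        then show ?thesis by (simp add: nn_integral_cmult nn_integral_add del: ennreal_half)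
      qed
      moreover have "(\<lambda>x. \<integral>\<^sup>+y. A x y \<gamma> \<partial>m) \<in> borel_measurable (config_measure \<gamma>)"
        "(\<lambda>x. \<integral>\<^sup>+y. R x y \<gamma> \<partial>m) \<in> borel_measurable (config_measure \<gamma>)" by measurable
      ultimately show ?thesis unfolding inner_integral_def
        by (simp add: nn_integral_cmult nn_integral_add del: ennreal_half)
    qed
    then have "campbell (\<lambda>x y \<gamma>. ennreal (1/2) * (A x y \<gamma> + R x y \<gamma>)) = (\<integral>\<^sup>+\<gamma>. ennreal (1/2) * (inner_integral A \<gamma> + inner_integral R \<gamma>) \<partial>\<mu>)"
      unfolding campbell_def by (intro nn_integral_cong) simp
    moreover have "inner_integral A \<in> borel_measurable \<mu>" "inner_integral R \<in> borel_measurable \<mu>"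
      using inner_integral_measurable[OF jm(1)] inner_integral_measurable[OF jmR] by measurable
    ultimately show ?thesis unfolding campbell_def by (simp add: nn_integral_cmult nn_integral_add del: ennreal_half)
  qed
  also have "campbell R = campbell L" unfolding R_def by (rule campbell_reversal[OF jm(2)])
  finally show ?thesis unfolding A_def L_def .
qed

text \<open>For a test function invariant under reversal the two terms of \<open>campbell_cs\<close>
  coincide, so it cannot distinguish the two coefficients.\<close>

lemma campbell_cs_symmetric:
  assumes k: "(\<lambda>(x, y, \<gamma>). k x y \<gamma>) \<in> borel_measurable (borel \<Otimes>\<^sub>M borel \<Otimes>\<^sub>M config_borel)"
    and sym: "\<And>x y \<gamma>. \<gamma> \<in> configs \<Longrightarrow> x \<in> \<gamma> \<Longrightarrow> y \<notin> \<gamma> \<Longrightarrow> k y x (move x y \<gamma>) = k x y \<gamma>"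
  shows "campbell (\<lambda>x y \<gamma>. ennreal (cs x y \<gamma>) * k x y \<gamma>) = campbell (\<lambda>x y \<gamma>. ennreal (c x y \<gamma>) * k x y \<gamma>)"
proof -
  have half: "ennreal (1/2) * (a + a) = a" for a :: ennreal
  proof -
    have "ennreal (1/2) * (a + a) = (ennreal (1/2) * 2) * a" by (simp add: mult_2[symmetric] mult.assoc del: ennreal_half)
    also have "ennreal (1/2) * 2 = ennreal 1" by (subst ennreal_numeral[symmetric], subst ennreal_mult'[symmetric]) auto
    finally show ?thesis by simp
  qed
  have "campbell (\<lambda>x y \<gamma>. ennreal (c x y \<gamma>) * k y x (move x y \<gamma>)) = campbell (\<lambda>x y \<gamma>. ennreal (c x y \<gamma>) * k x y \<gamma>)"
    by (rule campbell_cong) (simp add: sym)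
  then show ?thesis unfolding campbell_cs[OF k] by (simp add: half del: ennreal_half)
qed

text \<open>Replacing \<open>k\<close> by its reversal merely exchanges the two terms of
  \<open>campbell_cs\<close>.\<close>

lemma campbell_cs_reversal:
  assumes k: "(\<lambda>(x, y, \<gamma>). k x y \<gamma>) \<in> borel_measurable (borel \<Otimes>\<^sub>M borel \<Otimes>\<^sub>M config_borel)"
  shows "campbell (\<lambda>x y \<gamma>. ennreal (cs x y \<gamma>) * k y x (move x y \<gamma>)) = campbell (\<lambda>x y \<gamma>. ennreal (cs x y \<gamma>) * k x y \<gamma>)"
proof -
  note [measurable (raw)] = triple_measurableD[OF k]
  have jm: "(\<lambda>(x, y, \<gamma>). k y x (move x y \<gamma>)) \<in> borel_measurable (borel \<Otimes>\<^sub>M borel \<Otimes>\<^sub>M config_borel)"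
    by measurable
  have "campbell (\<lambda>x y \<gamma>. ennreal (c x y \<gamma>) * k x y (move y x (move x y \<gamma>))) = campbell (\<lambda>x y \<gamma>. ennreal (c x y \<gamma>) * k x y \<gamma>)"
    by (rule campbell_cong) (simp add: move_back)
  then show ?thesis unfolding campbell_cs[OF k] campbell_cs[OF jm] by (simp add: add.commute)
qed

section \<open>Bounds and absolute integrability\<close>

lemma Dmp_measurable':
  fixes F :: "'a set \<Rightarrow> real"
  assumes F: "F \<in> FCb" and [measurable]: "a \<in> borel_measurable M" "b \<in> borel_measurable M" "h \<in> measurable M config_borel"
  shows "(\<lambda>w. Dmp (a w) (b w) F (h w)) \<in> borel_measurable M"
proof -
  note [measurable] = FCb_measurable[OF F]
  show ?thesis unfolding Dmp_def by measurable
qed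

lemma Dmp_reversal: "x \<in> \<gamma> \<Longrightarrow> y \<notin> \<gamma> \<Longrightarrow> Dmp y x F (move x y \<gamma>) = - Dmp x y F (\<gamma> :: 'a set)"
  by (simp add: Dmp_def move_back)

text \<open>The difference is at most twice the supremum bound of \<open>F\<close> and vanishes when
  both points avoid \<open>\<Lambda>\<close>; otherwise the sum of indicators is at least 1. This is
  the weight in the integrability assumptions on both coefficients.\<close>

lemma Dmp_bound:
  fixes F :: "'a set \<Rightarrow> real"
  assumes "F \<in> FCb"
  shows "\<exists>C>0. \<exists>\<Lambda>. compact \<Lambda> \<and>
    (\<forall>\<gamma>\<in>configs. \<forall>x y. ennreal \<bar>Dmp x y F \<gamma>\<bar> \<le> ennreal C * (indicator \<Lambda> x + indicator \<Lambda> y))"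
proof -
  obtain B where B: "B > 0" "\<And>\<gamma>. \<gamma> \<in> configs \<Longrightarrow> \<bar>F \<gamma>\<bar> \<le> B" using FCb_bounded[OF assms] by blast
  obtain \<Lambda> where \<Lambda>: "compact \<Lambda>" "\<And>x y \<gamma>. \<gamma> \<in> configs \<Longrightarrow> x \<notin> \<Lambda> \<Longrightarrow> y \<notin> \<Lambda> \<Longrightarrow> F (move x y \<gamma>) = F \<gamma>"
    using FCb_local[OF assms] by blast
  have "ennreal \<bar>Dmp x y F \<gamma>\<bar> \<le> ennreal (2 * B) * (indicator \<Lambda> x + indicator \<Lambda> y)" if \<gamma>: "\<gamma> \<in> configs" for x y \<gamma>
  proof (cases "x \<in> \<Lambda> \<or> y \<in> \<Lambda>")
    case True
    have "\<bar>Dmp x y F \<gamma>\<bar> \<le> 2 * B"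
      using B(2)[OF \<gamma>] B(2)[OF configs_move[OF \<gamma>], of x y] by (auto simp: Dmp_def)
    then have "ennreal \<bar>Dmp x y F \<gamma>\<bar> \<le> ennreal (2 * B) * 1" by (simp add: ennreal_leI)
    also have "\<dots> \<le> ennreal (2 * B) * (indicator \<Lambda> x + indicator \<Lambda> y)"
      using True by (intro mult_left_mono) (auto simp: indicator_def)
    finally show ?thesis .
  next
    case False
    then show ?thesis using \<Lambda>(2)[OF \<gamma>] by (simp add: Dmp_def)
  qed
  then show ?thesis using B(1) \<Lambda>(1) by (intro exI[of _ "2 * B"] conjI exI[of _ \<Lambda>]) auto
qed

lemma campbell_cmult:
  assumes K: "(\<lambda>(x, y, \<gamma>). K x y \<gamma>) \<in> borel_measurable (borel \<Otimes>\<^sub>M borel \<Otimes>\<^sub>M config_borel)"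
  shows "\<gamma> \<in> configs \<Longrightarrow> inner_integral (\<lambda>x y \<gamma>. a * K x y \<gamma>) \<gamma> = a * inner_integral K \<gamma>"
    and "campbell (\<lambda>x y \<gamma>. a * K x y \<gamma>) = a * campbell K"
proof -
  note [measurable (raw)] = triple_measurableD[OF K]
  show inner: "inner_integral (\<lambda>x y \<gamma>. a * K x y \<gamma>) \<gamma> = a * inner_integral K \<gamma>" if "\<gamma> \<in> configs" for \<gamma>
  proof -
    have [measurable]: "\<gamma> \<in> space config_borel" using that by simp
    have "(\<lambda>y. K x y \<gamma>) \<in> borel_measurable m" for x by measurable
    moreover have "(\<lambda>x. \<integral>\<^sup>+y. K x y \<gamma> \<partial>m) \<in> borel_measurable (config_measure \<gamma>)" by measurable
    ultimately show ?thesis unfolding inner_integral_def by (simp add: nn_integral_cmult)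
  qed
  have "campbell (\<lambda>x y \<gamma>. a * K x y \<gamma>) = (\<integral>\<^sup>+\<gamma>. a * inner_integral K \<gamma> \<partial>\<mu>)"
    unfolding campbell_def by (intro nn_integral_cong inner) simp
  moreover have "inner_integral K \<in> borel_measurable \<mu>" using inner_integral_measurable[OF K] by measurable
  ultimately show "campbell (\<lambda>x y \<gamma>. a * K x y \<gamma>) = a * campbell K"
    unfolding campbell_def by (simp add: nn_integral_cmult)
qed

lemma compact_borel[measurable]: "compact \<Lambda> \<Longrightarrow> \<Lambda> \<in> sets (borel :: 'a measure)"
  by (intro borel_closed compact_imp_closed)

lemma c_weight_finite:
  assumes "compact \<Lambda>"
  shows "campbell (\<lambda>x y \<gamma>. ennreal (c x y \<gamma>) * (indicator \<Lambda> x + indicator \<Lambda> y)) < \<infinity>"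
  using c_integrable assms unfolding integrable_coefficient_def campbell_def inner_integral_def by blast

text \<open>The weight is symmetric in x and y, so the bound for \<open>c\<close> carries over
  unchanged.\<close>

lemma cs_weight_finite:
  assumes "compact \<Lambda>"
  shows "campbell (\<lambda>x y \<gamma>. ennreal (cs x y \<gamma>) * (indicator \<Lambda> x + indicator \<Lambda> y)) < \<infinity>"
proof -
  have "campbell (\<lambda>x y \<gamma>. ennreal (cs x y \<gamma>) * (indicator \<Lambda> x + indicator \<Lambda> y)) =
    campbell (\<lambda>x y \<gamma>. ennreal (c x y \<gamma>) * (indicator \<Lambda> x + indicator \<Lambda> y))"
    using compact_borel[OF assms] by (intro campbell_cs_symmetric) (simp_all add: add.commute)
  then show ?thesis using c_weight_finite[OF assms] by simp
qed

text \<open>Stated for a general coefficient \<open>a\<close> because the integration by parts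
  starts with \<open>c\<close> and continues with \<open>cs\<close>.\<close>

lemma absint_weighted:
  assumes F: "F \<in> FCb" and a: "jointly_measurable a" and k: "jointly_measurable k"
    and a_nonneg: "\<And>x y \<gamma>. \<gamma> \<in> configs \<Longrightarrow> 0 \<le> a x y \<gamma>"
    and a_fin: "\<And>\<Lambda>. compact \<Lambda> \<Longrightarrow> campbell (\<lambda>x y \<gamma>. ennreal (a x y \<gamma>) * (indicator \<Lambda> x + indicator \<Lambda> y)) < \<infinity>"
    and kB: "\<And>x y \<gamma>. \<gamma> \<in> configs \<Longrightarrow> \<bar>k x y \<gamma>\<bar> \<le> B"
  shows "absint (\<lambda>x y \<gamma>. z * a x y \<gamma> * Dmp x y F \<gamma> * k x y \<gamma>)"
proof -
  note [measurable (raw)] = triple_measurableD[OF a] triple_measurableD[OF k] Dmp_measurable'[OF F]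
  obtain C \<Lambda> where C: "C > 0" "compact \<Lambda>"
    "\<And>x y \<gamma>. \<gamma> \<in> configs \<Longrightarrow> ennreal \<bar>Dmp x y F \<gamma>\<bar> \<le> ennreal C * (indicator \<Lambda> x + indicator \<Lambda> y)"
    using Dmp_bound[OF F] by blast
  note [measurable] = compact_borel[OF C(2)]
  have "campbell (\<lambda>x y \<gamma>. ennreal \<bar>z * a x y \<gamma> * Dmp x y F \<gamma> * k x y \<gamma>\<bar>) \<le>
    campbell (\<lambda>x y \<gamma>. ennreal (z * B * C) * (ennreal (a x y \<gamma>) * (indicator \<Lambda> x + indicator \<Lambda> y)))"
  proof (rule campbell_mono)
    fix x y :: 'a and \<gamma> :: "'a set" assume \<gamma>: "\<gamma> \<in> configs"
    have B: "0 \<le> B" using kB[OF \<gamma>, of x y] by linarith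
    have "ennreal \<bar>z * a x y \<gamma> * Dmp x y F \<gamma> * k x y \<gamma>\<bar> = ennreal z * ennreal (a x y \<gamma>) * ennreal \<bar>Dmp x y F \<gamma>\<bar> * ennreal \<bar>k x y \<gamma>\<bar>"
      using z_pos a_nonneg[OF \<gamma>] by (simp add: abs_mult ennreal_mult)
    also have "\<dots> \<le> ennreal z * ennreal (a x y \<gamma>) * (ennreal C * (indicator \<Lambda> x + indicator \<Lambda> y)) * ennreal B"
      using C(3)[OF \<gamma>] kB[OF \<gamma>] by (intro mult_mono ennreal_leI) auto
    also have "\<dots> = ennreal (z * B * C) * (ennreal (a x y \<gamma>) * (indicator \<Lambda> x + indicator \<Lambda> y))"
      using z_pos B C(1) by (simp add: ennreal_mult mult_ac)
    finally show "ennreal \<bar>z * a x y \<gamma> * Dmp x y F \<gamma> * k x y \<gamma>\<bar> \<le> ennreal (z * B * C) * (ennreal (a x y \<gamma>) * (indicator \<Lambda> x + indicator \<Lambda> y))" .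
  qed
  also have "\<dots> = ennreal (z * B * C) * campbell (\<lambda>x y \<gamma>. ennreal (a x y \<gamma>) * (indicator \<Lambda> x + indicator \<Lambda> y))"
    by (rule campbell_cmult) measurable
  also have "\<dots> < \<infinity>" using a_fin[OF C(2)] by (simp add: ennreal_mult_less_top)
  finally show ?thesis unfolding absint_def by simp
qed

lemma cs_jm: "jointly_measurable cs" and c_jm: "jointly_measurable c"
  by measurable

text \<open>The function \<open>\<phi>\<close> stands for the identity or negation, so both parts of
  a signed integrand are treated at once. Homogeneity allows nonnegative coefficients to be pulled
  out of it.\<close>

lemma integral_eqI:
  assumes "absint K" "absint L"
    and "\<And>\<phi> :: real \<Rightarrow> real. \<phi> \<in> borel_measurable borel \<Longrightarrow>
      (\<And>r s. 0 \<le> r \<Longrightarrow> \<phi> (r * s) = r * \<phi> s) \<Longrightarrow>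
      campbell (\<lambda>x y \<gamma>. ennreal (\<phi> (K x y \<gamma>))) = campbell (\<lambda>x y \<gamma>. ennreal (\<phi> (L x y \<gamma>)))"
  shows "(LINT \<gamma>|\<mu>. pair_integral K \<gamma>) = (LINT \<gamma>|\<mu>. pair_integral L \<gamma>)"
  unfolding absint_integral(2)[OF assms(1)] absint_integral(2)[OF assms(2)]
  using assms(3)[of "\<lambda>r. r"] assms(3)[of uminus] by simp

lemma weighted_eq:
  assumes \<phi>: "\<phi> \<in> borel_measurable borel" "\<And>r s. 0 \<le> r \<Longrightarrow> \<phi> (r * s) = r * \<phi> (s :: real)"
    and k: "jointly_measurable k" and a: "jointly_measurable a" "\<And>x y \<gamma>. \<gamma> \<in> configs \<Longrightarrow> 0 \<le> a x y \<gamma>"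
  shows "campbell (\<lambda>x y \<gamma>. ennreal (\<phi> (z * a x y \<gamma> * k x y \<gamma>))) =
    ennreal z * campbell (\<lambda>x y \<gamma>. ennreal (a x y \<gamma>) * ennreal (\<phi> (k x y \<gamma>)))"
proof -
  note [measurable (raw)] = triple_measurableD[OF a(1)] triple_measurableD[OF k]
  note [measurable] = \<phi>(1)
  have "campbell (\<lambda>x y \<gamma>. ennreal (\<phi> (z * a x y \<gamma> * k x y \<gamma>))) =
    campbell (\<lambda>x y \<gamma>. ennreal z * (ennreal (a x y \<gamma>) * ennreal (\<phi> (k x y \<gamma>))))"
  proof (rule campbell_cong)
    fix x y :: 'a and \<gamma> :: "'a set" assume \<gamma>: "\<gamma> \<in> configs"
    show "ennreal (\<phi> (z * a x y \<gamma> * k x y \<gamma>)) = ennreal z * (ennreal (a x y \<gamma>) * ennreal (\<phi> (k x y \<gamma>)))"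
      using z_pos a(2)[OF \<gamma>] by (simp add: \<phi>(2) ennreal_mult' mult.assoc)
  qed
  also have "\<dots> = ennreal z * campbell (\<lambda>x y \<gamma>. ennreal (a x y \<gamma>) * ennreal (\<phi> (k x y \<gamma>)))"
    by (rule campbell_cmult) measurable
  finally show ?thesis .
qed

section \<open>The generator on the core\<close>

definition cylinder_generator :: "('a set \<Rightarrow> real) \<Rightarrow> 'a set \<Rightarrow> real" where
  "cylinder_generator F \<gamma> = - 2 * (LINT x|config_measure \<gamma>. (LINT y|m. z * cs x y \<gamma> * Dmp x y F \<gamma>))"

lemma cylinder_generator_eq: "cylinder_generator F = (\<lambda>\<gamma>. - 2 * pair_integral (\<lambda>x y \<gamma>. z * cs x y \<gamma> * Dmp x y F \<gamma>) \<gamma>)"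
  by (simp add: cylinder_generator_def pair_integral_def fun_eq_iff)

text \<open>Integration by parts. The product of two differences is invariant under reversal, so
  \<open>cs\<close> may replace \<open>c\<close>; then the difference of \<open>G\<close> is split.
  Its moved half turns under reversal into minus the other half, because the difference of
  \<open>F\<close> is odd, and this produces the factor -2.\<close>

lemma kawasaki_form_eq:
  assumes F: "F \<in> FCb" and G: "G \<in> FCb"
  shows "kawasaki_form m z \<mu> c F G = L2_inner \<mu> (cylinder_generator F) G"
proof -
  note [measurable (raw)] = Dmp_measurable'[OF F] Dmp_measurable'[OF G]
  note [measurable] = FCb_measurable[OF F] FCb_measurable[OF G]
  obtain B where B: "B > 0" "\<And>\<gamma>. \<gamma> \<in> configs \<Longrightarrow> \<bar>G \<gamma>\<bar> \<le> B" using FCb_bounded[OF G] by blast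
  have DG: "\<bar>Dmp x y G \<gamma>\<bar> \<le> 2 * B" and mvG: "\<bar>G (move x y \<gamma>)\<bar> \<le> B" if "\<gamma> \<in> configs" for x y \<gamma>
    using B(2)[OF that] B(2)[OF configs_move[OF that], of x y] by (auto simp: Dmp_def)
  let ?K = "\<lambda>a k x y \<gamma>. z * a x y \<gamma> * (Dmp x y F \<gamma> * k x y \<gamma>)"
  have absint: "absint (?K c k)" "absint (?K cs k)" if "jointly_measurable k" "\<And>x y \<gamma>. \<gamma> \<in> configs \<Longrightarrow> \<bar>k x y \<gamma>\<bar> \<le> B'" for k B'
    using absint_weighted[OF F c_jm that(1) c_nonneg c_weight_finite that(2)]
      absint_weighted[OF F cs_jm that(1) cs_nonneg cs_weight_finite that(2)] by (simp_all add: mult.assoc)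
  have jm: "jointly_measurable (\<lambda>x y. Dmp x y G)" "jointly_measurable (\<lambda>x y \<gamma>. G (move x y \<gamma>))"
    "jointly_measurable (\<lambda>x y \<gamma>. G \<gamma>)" "jointly_measurable (\<lambda>x y \<gamma>. - G \<gamma>)"
    "jointly_measurable (\<lambda>x y \<gamma>. Dmp x y F \<gamma> * Dmp x y G \<gamma>)"
    "jointly_measurable (\<lambda>x y \<gamma>. Dmp x y F \<gamma> * G (move x y \<gamma>))"
    "jointly_measurable (\<lambda>x y \<gamma>. Dmp x y F \<gamma> * - G \<gamma>)"
    by measurable
  have "kawasaki_form m z \<mu> c F G = (LINT \<gamma>|\<mu>. pair_integral (?K c (\<lambda>x y. Dmp x y G)) \<gamma>)"
    unfolding kawasaki_form_def pair_integral_def by (simp add: mult.assoc)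
  also have "\<dots> = (LINT \<gamma>|\<mu>. pair_integral (?K cs (\<lambda>x y. Dmp x y G)) \<gamma>)"
  proof (rule integral_eqI[OF absint[OF jm(1) DG]])
    fix \<phi> :: "real \<Rightarrow> real" assume \<phi>: "\<phi> \<in> borel_measurable borel" "\<And>r s. 0 \<le> r \<Longrightarrow> \<phi> (r * s) = r * \<phi> s"
    note [measurable] = \<phi>(1)
    have "campbell (\<lambda>x y \<gamma>. ennreal (cs x y \<gamma>) * ennreal (\<phi> (Dmp x y F \<gamma> * Dmp x y G \<gamma>))) =
      campbell (\<lambda>x y \<gamma>. ennreal (c x y \<gamma>) * ennreal (\<phi> (Dmp x y F \<gamma> * Dmp x y G \<gamma>)))"
      by (rule campbell_cs_symmetric) (measurable, simp add: Dmp_reversal)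
    then show "campbell (\<lambda>x y \<gamma>. ennreal (\<phi> (?K c (\<lambda>x y. Dmp x y G) x y \<gamma>))) = campbell (\<lambda>x y \<gamma>. ennreal (\<phi> (?K cs (\<lambda>x y. Dmp x y G) x y \<gamma>)))"
      by (simp add: weighted_eq[OF \<phi> jm(5) c_jm c_nonneg] weighted_eq[OF \<phi> jm(5) cs_jm cs_nonneg])
  qed
  also have "\<dots> = (LINT \<gamma>|\<mu>. pair_integral (\<lambda>x y \<gamma>. ?K cs (\<lambda>x y \<gamma>. G (move x y \<gamma>)) x y \<gamma> - ?K cs (\<lambda>x y \<gamma>. G \<gamma>) x y \<gamma>) \<gamma>)"
    by (simp add: Dmp_def[of _ _ G] right_diff_distrib)
  also have "\<dots> = (LINT \<gamma>|\<mu>. pair_integral (?K cs (\<lambda>x y \<gamma>. G (move x y \<gamma>))) \<gamma>) - (LINT \<gamma>|\<mu>. pair_integral (?K cs (\<lambda>x y \<gamma>. G \<gamma>)) \<gamma>)"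
    by (rule integral_pair_integral_diff[OF absint(2)[OF jm(2) mvG] absint(2)[OF jm(3) B(2)]])
  \<comment> \<open>At the reversed move the difference of \<open>F\<close> changes sign, and the
    moved configuration becomes the current one.\<close>
  also have "(LINT \<gamma>|\<mu>. pair_integral (?K cs (\<lambda>x y \<gamma>. G (move x y \<gamma>))) \<gamma>) = (LINT \<gamma>|\<mu>. pair_integral (?K cs (\<lambda>x y \<gamma>. - G \<gamma>)) \<gamma>)"
  proof (rule integral_eqI[OF absint(2)[OF jm(2) mvG] absint(2)[OF jm(4)]])
    show "\<bar>- G \<gamma>\<bar> \<le> B" if "\<gamma> \<in> configs" for \<gamma> using B(2)[OF that] by simp
    fix \<phi> :: "real \<Rightarrow> real" assume \<phi>: "\<phi> \<in> borel_measurable borel" "\<And>r s. 0 \<le> r \<Longrightarrow> \<phi> (r * s) = r * \<phi> s"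
    note [measurable] = \<phi>(1)
    have "campbell (\<lambda>x y \<gamma>. ennreal (cs x y \<gamma>) * ennreal (\<phi> (Dmp x y F \<gamma> * G (move x y \<gamma>)))) =
      campbell (\<lambda>x y \<gamma>. ennreal (cs x y \<gamma>) * ennreal (\<phi> (Dmp y x F (move x y \<gamma>) * - G (move x y \<gamma>))))"
      by (rule campbell_cong) (simp add: Dmp_reversal)
    also have "\<dots> = campbell (\<lambda>x y \<gamma>. ennreal (cs x y \<gamma>) * ennreal (\<phi> (Dmp x y F \<gamma> * - G \<gamma>)))"
      by (rule campbell_cs_reversal[of "\<lambda>x y \<gamma>. ennreal (\<phi> (Dmp x y F \<gamma> * - G \<gamma>))"]) measurable
    finally show "campbell (\<lambda>x y \<gamma>. ennreal (\<phi> (?K cs (\<lambda>x y \<gamma>. G (move x y \<gamma>)) x y \<gamma>))) = campbell (\<lambda>x y \<gamma>. ennreal (\<phi> (?K cs (\<lambda>x y \<gamma>. - G \<gamma>) x y \<gamma>)))"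
      by (simp only: weighted_eq[OF \<phi> jm(6) cs_jm cs_nonneg] weighted_eq[OF \<phi> jm(7) cs_jm cs_nonneg])
  qed
  also have "\<dots> = - (LINT \<gamma>|\<mu>. pair_integral (?K cs (\<lambda>x y \<gamma>. G \<gamma>)) \<gamma>)"
    by (simp add: pair_integral_def)
  finally have "kawasaki_form m z \<mu> c F G = - 2 * (LINT \<gamma>|\<mu>. pair_integral (?K cs (\<lambda>x y \<gamma>. G \<gamma>)) \<gamma>)" by simp
  \<comment> \<open>\<open>G \<gamma>\<close> does not depend on x and y and leaves both inner
    integrals.\<close>
  moreover have "pair_integral (?K cs (\<lambda>x y \<gamma>. G \<gamma>)) = (\<lambda>\<gamma>. pair_integral (\<lambda>x y \<gamma>. z * cs x y \<gamma> * Dmp x y F \<gamma>) \<gamma> * G \<gamma>)"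
    unfolding pair_integral_def by (simp add: mult.assoc[symmetric])
  ultimately show ?thesis by (simp add: cylinder_generator_eq L2_inner_def mult.assoc)
qed

text \<open>Integrability is not at issue: where a Bochner integral fails to exist its value 0
  satisfies the bound.\<close>

lemma abs_pair_integral_le: "ennreal \<bar>pair_integral K \<gamma>\<bar> \<le> inner_integral (\<lambda>x y \<gamma>. ennreal \<bar>K x y \<gamma>\<bar>) \<gamma>"
proof -
  have nm: "ennreal \<bar>integral\<^sup>L M f\<bar> \<le> (\<integral>\<^sup>+x. ennreal \<bar>f x\<bar> \<partial>M)" for M :: "'c measure" and f :: "'c \<Rightarrow> real"
    using integral_norm_bound_ennreal[of M f] by (cases "integrable M f") (auto simp: not_integrable_integral_eq)
  have "ennreal \<bar>pair_integral K \<gamma>\<bar> \<le> (\<integral>\<^sup>+x. ennreal \<bar>LINT y|m. K x y \<gamma>\<bar> \<partial>config_measure \<gamma>)"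
    unfolding pair_integral_def by (rule nm)
  also have "\<dots> \<le> inner_integral (\<lambda>x y \<gamma>. ennreal \<bar>K x y \<gamma>\<bar>) \<gamma>"
    unfolding inner_integral_def by (intro nn_integral_mono nm)
  finally show ?thesis .
qed

text \<open>Inserting the bound on \<open>Dmp\<close> dominates the pair integral pointwise by a
  constant times \<open>csym_weight\<close>, whose square integrability is assumed.\<close>

lemma cylinder_generator_L2:
  assumes F: "F \<in> FCb" shows "cylinder_generator F \<in> L2 \<mu>"
proof -
  note [measurable (raw)] = Dmp_measurable'[OF F]
  let ?K = "\<lambda>x y \<gamma>. z * cs x y \<gamma> * Dmp x y F \<gamma>"
  have jm: "jointly_measurable ?K" by measurable
  have [measurable]: "pair_integral ?K \<in> borel_measurable \<mu>" using pair_integral_measurable[OF jm] by measurable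
  obtain C \<Lambda> where C: "C > 0" "compact \<Lambda>"
    "\<And>x y \<gamma>. \<gamma> \<in> configs \<Longrightarrow> ennreal \<bar>Dmp x y F \<gamma>\<bar> \<le> ennreal C * (indicator \<Lambda> x + indicator \<Lambda> y)"
    using Dmp_bound[OF F] by blast
  note [measurable] = compact_borel[OF C(2)]
  let ?W = "csym_weight m z E c \<Lambda>"
  have bound: "ennreal \<bar>pair_integral ?K \<gamma>\<bar> \<le> ennreal C * ?W \<gamma>" if \<gamma>: "\<gamma> \<in> configs" for \<gamma>
  proof -
    have "ennreal \<bar>pair_integral ?K \<gamma>\<bar> \<le> inner_integral (\<lambda>x y \<gamma>. ennreal \<bar>?K x y \<gamma>\<bar>) \<gamma>"
      by (rule abs_pair_integral_le)
    also have "\<dots> \<le> inner_integral (\<lambda>x y \<gamma>. ennreal C * (ennreal (z * cs x y \<gamma>) * (indicator \<Lambda> x + indicator \<Lambda> y))) \<gamma>"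
    proof (rule inner_integral_mono)
      fix x y
      have "ennreal \<bar>?K x y \<gamma>\<bar> = ennreal (z * cs x y \<gamma>) * ennreal \<bar>Dmp x y F \<gamma>\<bar>"
        using z_pos cs_nonneg[OF \<gamma>, of x y] by (simp add: abs_mult ennreal_mult)
      also have "\<dots> \<le> ennreal (z * cs x y \<gamma>) * (ennreal C * (indicator \<Lambda> x + indicator \<Lambda> y))"
        using C(3)[OF \<gamma>] by (intro mult_left_mono) auto
      finally show "ennreal \<bar>?K x y \<gamma>\<bar> \<le> ennreal C * (ennreal (z * cs x y \<gamma>) * (indicator \<Lambda> x + indicator \<Lambda> y))"
        by (simp add: mult_ac)
    qed
    also have "\<dots> = ennreal C * inner_integral (\<lambda>x y \<gamma>. ennreal (z * cs x y \<gamma>) * (indicator \<Lambda> x + indicator \<Lambda> y)) \<gamma>"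
      by (rule campbell_cmult(1)[OF _ \<gamma>]) measurable
    finally show ?thesis by (simp add: csym_weight_def inner_integral_def)
  qed
  have "(\<integral>\<^sup>+\<gamma>. ennreal ((pair_integral ?K \<gamma>)\<^sup>2) \<partial>\<mu>) \<le> (\<integral>\<^sup>+\<gamma>. (ennreal C)\<^sup>2 * (?W \<gamma>)\<^sup>2 \<partial>\<mu>)"
  proof (rule nn_integral_mono)
    fix \<gamma> assume "\<gamma> \<in> space \<mu>"
    then have "(ennreal \<bar>pair_integral ?K \<gamma>\<bar>)\<^sup>2 \<le> (ennreal C * ?W \<gamma>)\<^sup>2" by (intro power_mono bound) auto
    then show "ennreal ((pair_integral ?K \<gamma>)\<^sup>2) \<le> (ennreal C)\<^sup>2 * (?W \<gamma>)\<^sup>2" by (simp add: ennreal_power power_mult_distrib)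
  qed
  also have "\<dots> = (ennreal C)\<^sup>2 * (\<integral>\<^sup>+\<gamma>. (?W \<gamma>)\<^sup>2 \<partial>\<mu>)"
    using weight[OF C(2)] by (intro nn_integral_cmult) auto
  also have "\<dots> < \<infinity>" using weight[OF C(2)] C(1) by (simp add: ennreal_mult_less_top ennreal_power)
  finally have "integrable \<mu> (\<lambda>\<gamma>. (pair_integral ?K \<gamma>)\<^sup>2)" by (intro integrableI_nonneg) auto
  then have "integrable \<mu> (\<lambda>\<gamma>. 4 * (pair_integral ?K \<gamma>)\<^sup>2)" by simp
  then show ?thesis by (simp add: L2_def cylinder_generator_eq power_mult_distrib)
qed

lemma FCb_L2: "FCb \<subseteq> L2 \<mu>"
proof
  fix F :: "'a set \<Rightarrow> real" assume F: "F \<in> FCb"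
  then obtain B where B: "\<And>\<gamma>. \<gamma> \<in> configs \<Longrightarrow> \<bar>F \<gamma>\<bar> \<le> B" using FCb_bounded by blast
  have F': "F \<in> borel_measurable \<mu>" using FCb_measurable[OF F] by measurable
  have "(F \<gamma>)\<^sup>2 \<le> B\<^sup>2" if "\<gamma> \<in> configs" for \<gamma> using power_mono[OF B[OF that], of 2] by simp
  then have "integrable \<mu> (\<lambda>\<gamma>. (F \<gamma>)\<^sup>2)"
    using F' by (intro \<mu>.integrable_const_bound[of _ "B\<^sup>2"] AE_I2) auto
  then show "F \<in> L2 \<mu>" using F' by (simp add: L2_def)
qed

lemma kawasaki_operator_form: "operator_form FCb (kawasaki_form m z \<mu> c) \<mu> cylinder_generator"
proof unfold_locales
  fix F G K :: "'a set \<Rightarrow> real" and a b :: real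
  assume F: "F \<in> FCb" and G: "G \<in> FCb"
  show lin: "(\<lambda>\<gamma>. a * F \<gamma> + b * G \<gamma>) \<in> FCb" using FCb_lin[OF F G] .
  show "kawasaki_form m z \<mu> c F G = kawasaki_form m z \<mu> c G F"
    unfolding kawasaki_form_def by (simp add: mult_ac)
  show "kawasaki_form m z \<mu> c F G = L2_inner \<mu> (cylinder_generator F) G" by (rule kawasaki_form_eq[OF F G])
next
  fix F :: "'a set \<Rightarrow> real" assume F: "F \<in> FCb"
  have "0 \<le> z * c x y \<gamma> * Dmp x y F \<gamma> * Dmp x y F \<gamma>" if "\<gamma> \<in> configs" for x y \<gamma>
    using z_pos c_nonneg[OF that, of x y] by (simp add: mult.assoc)
  then show "0 \<le> kawasaki_form m z \<mu> c F F"
    unfolding kawasaki_form_def by (intro integral_nonneg_AE AE_I2 integral_nonneg) auto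
  show "cylinder_generator F \<in> L2 \<mu>" by (rule cylinder_generator_L2[OF F])
next
  fix F G K :: "'a set \<Rightarrow> real" and a b :: real
  assume F: "F \<in> FCb" and G: "G \<in> FCb" and K: "K \<in> FCb"
  show "kawasaki_form m z \<mu> c F (\<lambda>\<gamma>. a * G \<gamma> + b * K \<gamma>) = a * kawasaki_form m z \<mu> c F G + b * kawasaki_form m z \<mu> c F K"
    \<comment> \<open>Linearity is read off from the inner product representation, which spares a
      separate integrability argument for the triple integral.\<close>
    unfolding kawasaki_form_eq[OF F G] kawasaki_form_eq[OF F K] kawasaki_form_eq[OF F FCb_lin[OF G K]]
    using L2.linear[OF cylinder_generator_L2[OF F]] G K FCb_L2 by blast
qed (rule FCb_L2)

end

theorem theorem3p2:
  fixes \<A> :: "('a::{t2_space, second_countable_topology}, 'n::finite) chart set"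
    and g :: "('a, 'n) chart \<Rightarrow> 'a \<Rightarrow> real^'n^'n"
    and m :: "'a measure"
    and E :: "'a \<Rightarrow> 'a set \<Rightarrow> ereal"
    and z :: real
    and \<mu> :: "'a set measure"
    and c :: "'a \<Rightarrow> 'a \<Rightarrow> 'a set \<Rightarrow> real"
    and DH :: "('a set \<Rightarrow> real) set"
    and H :: "('a set \<Rightarrow> real) \<Rightarrow> 'a set \<Rightarrow> real"
  assumes "connected (UNIV :: 'a set)"
    and "oriented_atlas \<A>"
    and "riemannian_metric \<A> g"
    and "riemannian_volume \<A> g m"
    and "(\<lambda>(x, \<gamma>). E x \<gamma>) \<in> borel_measurable (borel \<Otimes>\<^sub>M config_borel)"
    and "\<And>x \<gamma>. \<gamma> \<in> configs \<Longrightarrow> E x \<gamma> \<noteq> -\<infinity>"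
    and "z > 0"
    and "prob_space \<mu>"
    and "sets \<mu> = sets config_borel"
    and "gibbs_identity m z E \<mu>"
    and "AE (x, \<gamma>) in m \<Otimes>\<^sub>M \<mu>. \<bar>E x \<gamma>\<bar> \<noteq> \<infinity>"
    and "ruelle_bounded_correlations m \<mu>"
    and "(\<lambda>(x, y, \<gamma>). c x y \<gamma>) \<in> borel_measurable (borel \<Otimes>\<^sub>M borel \<Otimes>\<^sub>M config_borel)"
    and "\<And>x y \<gamma>. \<gamma> \<in> configs \<Longrightarrow> 0 \<le> c x y \<gamma>"
    and "integrable_coefficient m \<mu> c"
    and "generator_of_form \<mu> (closure_domain \<mu> FCb (kawasaki_form m z \<mu> c))
           (closure_form \<mu> FCb (kawasaki_form m z \<mu> c)) DH H"
    and "\<And>\<Lambda>. compact \<Lambda> \<Longrightarrow> csym_weight m z E c \<Lambda> \<in> borel_measurable \<mu> \<and>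
           (\<integral>\<^sup>+\<gamma>. (csym_weight m z E c \<Lambda> \<gamma>)\<^sup>2 \<partial>\<mu>) < \<infinity>"
  shows "(\<forall>F\<in>FCb. F \<in> DH \<and> H F \<in> L2 \<mu> \<and>
            (AE \<gamma> in \<mu>. H F \<gamma> =
               - 2 * (LINT x|config_measure \<gamma>. (LINT y|m. z * csym E c x y \<gamma> * Dmp x y F \<gamma>)))) \<and>
         (\<forall>F\<in>FCb. \<forall>G\<in>FCb. kawasaki_form m z \<mu> c F G = (LINT \<gamma>|\<mu>. H F \<gamma> * G \<gamma>)) \<and>
         friedrichs_extension \<mu> FCb H DH H"
proof -
  have atlas: "smooth_atlas \<A>" using assms(2) by (simp add: oriented_atlas_def)
  \<comment> \<open>The geometry supplies bump functions through charts, local finiteness of the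
    volume through the continuous density, and null points through Lebesgue measure.\<close>
  interpret kawasaki_generator m E z \<mu> c
  proof (intro kawasaki_generator.intro kawasaki.intro bump_space.intro kawasaki_axioms.intro kawasaki_generator_axioms.intro)
    show "\<exists>f\<in>C0. (\<forall>x. 0 \<le> f x) \<and> 0 < f p \<and> (\<forall>x. x \<notin> V \<longrightarrow> f x = 0)" if "open V" "p \<in> V" for p :: 'a and V
      using manifold_bump[OF atlas that] .
    show "sets m = sets borel" using assms(4) by (simp add: riemannian_volume_def)
    show "sigma_finite_measure m" using volume_sigma_finite[OF atlas assms(4,3)] .
    show "emeasure m {x} = 0" for x using volume_point[OF atlas assms(4)] .
  qed (use assms in blast)+
  note form = kawasaki_operator_form and gen = assms(16)
  have DH: "F \<in> DH" and HA: "AE \<gamma> in \<mu>. H F \<gamma> = cylinder_generator F \<gamma>" if "F \<in> FCb" for F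
    using operator_form.generator_extends[OF form gen that] by auto
  have HL2: "H F \<in> L2 \<mu>" if "F \<in> FCb" for F
    using gen DH[OF that] by (auto simp: generator_of_form_def self_adjoint_operator_def L2_operator_def)
  \<comment> \<open>\<open>H F\<close> and \<open>cylinder_generator F\<close> agree almost
    everywhere, so the representation by the latter passes to the former.\<close>
  have "kawasaki_form m z \<mu> c F G = (LINT \<gamma>|\<mu>. H F \<gamma> * G \<gamma>)" if "F \<in> FCb" "G \<in> FCb" for F G
    unfolding kawasaki_form_eq[OF that] L2_inner_def
    using HA[OF that(1)] HL2[OF that(1)] cylinder_generator_L2[OF that(1)] FCb_L2 that(2)
    by (intro integral_cong_AE) (auto simp: L2_def)
  then show ?thesis
    using DH HL2 HA friedrichs_extension_of_generator[OF form gen] by (simp add: cylinder_generator_def)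
qed

end
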